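(* Let $f:\mathbb{R}\to[-\infty,\infty]$ be a fixed convex function, let $\alpha\in(0,1)$ be fixed, and for each $n\ge 1$ let $x_{n,1}\le x_{n,2}\le\cdots\le x_{n,n}$ be fixed real numbers and $Y_{n,1},\dots,Y_{n,n}$ independent real random variables such that $f(x_{n,i})$ is a median of $Y_{n,i}$ for every $i$. Let $(\hat L,\hat U)=(\hat L_n,\hat U_n)$ be the level-$(1-\alpha)$ sign-test confidence band (defined in the context) computed from $\mathbf{x}=(x_{n,i})_{i=1}^n$ and $\mathbf{Y}=(Y_{n,i})_{i=1}^n$. Suppose that for some constants $-\infty<a<b<\infty$ the following two conditions hold. (A1) Let $M_n(B):=n^{-1}\#\{i: x_{n,i}\in B\}$ for $B\subset\mathbb{R}$. There is a constant $c>0$ such that $$\liminf_{n\to\infty}\frac{M_n[a_n,b_n]}{b_n-a_n}\ge c$$ for all sequences $(a_n),(b_n)$ with $a\le a_n<b_n\le b$ and $\liminf_{n\to\infty}\log(b_n-a_n)/\log n>-1$. (A2) There is a fixed function $H$ on $[0,\infty]$ (not depending on $n$ or $i$) with $\lim_{r\to0+}H(r)/r>0$ such that for all $n$ and all $i$ with $x_{n,i}\in[a,b]$, writing $\mu_{n,i}:=f(x_{n,i})$, $$\mathbb{P}(Y_{n,i}<\mu_{n,i}+r)\ge\frac{1+H(r)}{2}\quad\text{and}\quad \mathbb{P}(Y_{n,i}>\mu_{n,i}-r)\ge\frac{1+H(r)}{2}\qquad\text{for any } r>0.$$ Then the following hold, as $n\to\infty$. (a) If $f$ is linear (affine) on $[a,b]$,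 then for arbitrary $a<a'<b'<b$, $$\sup_{x\in[a,b]}\bigl(f(x)-\hat L(x)\bigr)^+=O_p(n^{-1/2})\quad\text{and}\quad \sup_{x\in[a',b']}\bigl(\hat U(x)-f(x)\bigr)^+=O_p(n^{-1/2}).$$ (b) If $f$ is Hölder continuous on $[a,b]$ with exponent $\beta\in(1,2]$, meaning that $f$ is differentiable on $[a,b]$ and there is a constant $L>0$ with $|f'(x)-f'(y)|\le L|x-y|^{\beta-1}$ for all $x,y\in[a,b]$, then with $\rho_n:=\log(n+1)/n$ and $\delta_n:=\rho_n^{1/(2\beta+1)}$, $$\sup_{x\in[a,b]}\bigl(f(x)-\hat L(x)\bigr)^+=O_p\bigl(\rho_n^{\beta/(2\beta+1)}\bigr)\quad\text{and}\quad \sup_{x\in[a+\delta_n,\,b-\delta_n]}\bigl(\hat U(x)-f(x)\bigr)^+=O_p\bigl(\rho_n^{\beta/(2\beta+1)}\bigr).$$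
   Context: Notation: $\bar{\mathbb{R}}=[-\infty,\infty]$, $u^+=\max(u,0)$. A function $g:\mathbb{R}\to\bar{\mathbb{R}}$ is convex if its epigraph $\{(x,y)\in\mathbb{R}^2: g(x)\le y\}$ is convex. A number $m$ is a median of a random variable $Y$ if $\mathbb{P}(Y\le m)\ge 1/2$ and $\mathbb{P}(Y\ge m)\ge 1/2$. For $\mathbf{x}\in\mathbb{R}^n$, $g(\mathbf{x}):=(g(x_i))_{i=1}^n$. Sign function: $\underline{\mathrm{sign}}(x):=1\{x>0\}-1\{x\le0\}$ for $x\in\bar{\mathbb{R}}$, applied component-wise to vectors. Test statistic: let $\psi(x):=\max(1-|x|,0)$, $\Gamma(u):=(2\log(e/u))^{1/2}$, $\beta_d:=\bigl(\sum_{i=1-d}^{d-1}\psi(i/d)^2\bigr)^{-1/2}$, and for $\boldsymbol{\sigma}\in\{-1,1\}^n$ $$T_{d,j}(\boldsymbol{\sigma}):=\beta_d\sum_{i=1}^n\psi\Bigl(\frac{i-j}{d}\Bigr)\sigma_i,\qquad T_o(\boldsymbol{\sigma}):=\max_{d=1,\dots,\lfloor(n+1)/2\rfloor}\Bigl(\max_{j=1,\dots,n}T_{d,j}(\boldsymbol{\sigma})-\Gamma\Bigl(\frac{2d-1}{n}\Bigr)\Bigr).$$ For $\mathbf{v}\in\bar{\mathbb{R}}^n$ let $T(\mathbf{v}):=\max\{T_o(\underline{\mathrm{sign}}(\mathbf{v})),T_o(\underline{\mathrm{sign}}(-\mathbf{v}))\}$. Let $\boldsymbol{\xi}$ be uniformly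 distributed on $\{-1,1\}^n$, and let $\kappa=\kappa(n,\alpha)$ be the smallest $(1-\alpha)$-quantile of $T(\boldsymbol{\xi})$. Confidence band: suprema and infima of families of functions $\mathbb{R}\to\bar{\mathbb{R}}$ are taken pointwise, and $$\hat U:=\sup\bigl\{g:\mathbb{R}\to\bar{\mathbb{R}}\text{ convex}: T_o(\underline{\mathrm{sign}}(g(\mathbf{x})-\mathbf{Y}))\le\kappa\bigr\},$$ $$\hat L:=\inf\bigl\{g:\mathbb{R}\to\bar{\mathbb{R}}\text{ convex}: g\le\hat U,\ T_o(\underline{\mathrm{sign}}(\mathbf{Y}-g(\mathbf{x})))\le\kappa\bigr\}$$ (the infimum of an empty family is $+\infty$). $Z_n=O_p(r_n)$ means that for every $\epsilon>0$ there is $K<\infty$ with $\limsup_{n\to\infty}\mathbb{P}(|Z_n|>Kr_n)\le\epsilon$. *)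

theory Defs
  imports "HOL-Probability.Probability"
begin

text \<open>Vectors in \<open>\<real>\<^sup>n\<close> are functions on \<^typ>\<open>nat\<close> of which only the values at
  \<open>1, \<dots>, n\<close> are used.\<close>

definition convex_fun :: "(real \<Rightarrow> ereal) \<Rightarrow> bool" where
  "convex_fun g \<longleftrightarrow> convex {(u, y). g u \<le> ereal y}"

definition is_median :: "'w measure \<Rightarrow> ('w \<Rightarrow> real) \<Rightarrow> ereal \<Rightarrow> bool" where
  "is_median M Y m \<longleftrightarrow>
     measure M {\<omega> \<in> space M. ereal (Y \<omega>) \<le> m} \<ge> 1 / 2 \<and>
     measure M {\<omega> \<in> space M. ereal (Y \<omega>) \<ge> m} \<ge> 1 / 2"

definition usign :: "ereal \<Rightarrow> real" where
  "usign u = (if u > 0 then 1 else - 1)"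

definition psi :: "real \<Rightarrow> real" where
  "psi u = max (1 - \<bar>u\<bar>) 0"

definition Gam :: "real \<Rightarrow> real" where
  "Gam u = sqrt (2 * ln (exp 1 / u))"

definition beta_coef :: "nat \<Rightarrow> real" where
  "beta_coef d = (\<Sum>i\<in>{1 - int d..int d - 1}. (psi (real_of_int i / real d))\<^sup>2) powr (- 1 / 2)"

definition T_loc :: "nat \<Rightarrow> nat \<Rightarrow> nat \<Rightarrow> (nat \<Rightarrow> real) \<Rightarrow> real" where
  "T_loc n d j \<sigma> = beta_coef d * (\<Sum>i=1..n. psi ((real i - real j) / real d) * \<sigma> i)"

definition T_o :: "nat \<Rightarrow> (nat \<Rightarrow> real) \<Rightarrow> real" where
  "T_o n \<sigma> =
     Max ((\<lambda>d. Max ((\<lambda>j. T_loc n d j \<sigma>) ` {1..n}) - Gam ((2 * real d - 1) / real n))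
          ` {1..(n + 1) div 2})"

definition T_stat :: "nat \<Rightarrow> (nat \<Rightarrow> ereal) \<Rightarrow> real" where
  "T_stat n v = max (T_o n (\<lambda>i. usign (v i))) (T_o n (\<lambda>i. usign (- v i)))"

definition rademacher :: "nat \<Rightarrow> (nat \<Rightarrow> real) pmf" where
  "rademacher n = pmf_of_set (PiE {1..n} (\<lambda>_. {- 1, 1}))"

definition is_quantile :: "'w pmf \<Rightarrow> ('w \<Rightarrow> real) \<Rightarrow> real \<Rightarrow> real \<Rightarrow> bool" where
  "is_quantile p X \<gamma> q \<longleftrightarrow>
     measure_pmf.prob p {\<xi>. X \<xi> \<le> q} \<ge> \<gamma> \<and> measure_pmf.prob p {\<xi>. X \<xi> \<ge> q} \<ge> 1 - \<gamma>"

definition kappa :: "nat \<Rightarrow> real \<Rightarrow> real" where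
  "kappa n \<alpha> =
     (LEAST q. is_quantile (rademacher n) (\<lambda>\<xi>. T_stat n (\<lambda>i. ereal (\<xi> i))) (1 - \<alpha>) q)"

text \<open>In the two definitions below, \<open>Sup\<close> and \<open>Inf\<close> are those of the pointwise ordered
  complete lattice \<^typ>\<open>real \<Rightarrow> ereal\<close>.\<close>

definition U_hat :: "nat \<Rightarrow> real \<Rightarrow> (nat \<Rightarrow> real) \<Rightarrow> (nat \<Rightarrow> real) \<Rightarrow> real \<Rightarrow> ereal" where
  "U_hat n \<alpha> x y =
     Sup {g. convex_fun g \<and> T_o n (\<lambda>i. usign (g (x i) - ereal (y i))) \<le> kappa n \<alpha>}"

definition L_hat :: "nat \<Rightarrow> real \<Rightarrow> (nat \<Rightarrow> real) \<Rightarrow> (nat \<Rightarrow> real) \<Rightarrow> real \<Rightarrow> ereal" where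
  "L_hat n \<alpha> x y =
     Inf {g. convex_fun g \<and> g \<le> U_hat n \<alpha> x y \<and>
             T_o n (\<lambda>i. usign (ereal (y i) - g (x i))) \<le> kappa n \<alpha>}"

text \<open>Outer probability agrees with probability on measurable events, and keeps the notion
  meaningful when measurability of \<open>Z n\<close> (a supremum over a family of convex functions) has
  not been established: \<^const>\<open>measure\<close> would return 0 on a non-measurable set.\<close>

definition bounded_in_prob ::
    "(nat \<Rightarrow> 'w measure) \<Rightarrow> (nat \<Rightarrow> 'w \<Rightarrow> ereal) \<Rightarrow> (nat \<Rightarrow> real) \<Rightarrow> bool" where
  "bounded_in_prob M Z r \<longleftrightarrow>
     (\<forall>\<epsilon>::real. \<epsilon> > 0 \<longrightarrow> (\<exists>K::real.
        limsup (\<lambda>n. outer_measure_of (M n) {\<omega> \<in> space (M n). \<bar>Z n \<omega>\<bar> > ereal (K * r n)})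
          \<le> ennreal \<epsilon>))"

definition design_mass :: "nat \<Rightarrow> (nat \<Rightarrow> real) \<Rightarrow> real set \<Rightarrow> real" where
  "design_mass n x B = real (card {i \<in> {1..n}. x i \<in> B}) / real n"

definition affine_on :: "real \<Rightarrow> real \<Rightarrow> (real \<Rightarrow> ereal) \<Rightarrow> bool" where
  "affine_on a b f \<longleftrightarrow> (\<exists>p q. \<forall>u\<in>{a..b}. f u = ereal (p + q * u))"

text \<open>Differentiability on \<open>[a, b]\<close> entails finiteness there and is one-sided at \<open>a\<close> and \<open>b\<close>;
  in particular \<open>f\<close> may be infinite outside \<open>[a, b]\<close>.\<close>

definition smooth_hoelder_on :: "real \<Rightarrow> real \<Rightarrow> real \<Rightarrow> (real \<Rightarrow> ereal) \<Rightarrow> bool" where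
  "smooth_hoelder_on \<beta> a b f \<longleftrightarrow>
     (\<forall>u\<in>{a..b}. \<bar>f u\<bar> \<noteq> \<infinity>) \<and>
     (\<exists>f'. (\<forall>u\<in>{a..b}. ((\<lambda>v. real_of_ereal (f v)) has_real_derivative f' u) (at u within {a..b})) \<and>
           (\<exists>L>0. \<forall>u\<in>{a..b}. \<forall>v\<in>{a..b}. \<bar>f' u - f' v\<bar> \<le> L * \<bar>u - v\<bar> powr (\<beta> - 1)))"

definition rho :: "nat \<Rightarrow> real" where
  "rho n = ln (real n + 1) / real n"

end

theory Submission
  imports Defs "HOL-Real_Asymp.Real_Asymp"
begin

text \<open>Two facts carry the proof: the critical values \<^term>\<open>kappa n \<alpha>\<close> stay bounded as \<open>n\<close> grows, and
  a convex candidate that is far from the median curve \<open>f\<close> at one point is far from it on a whole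
  interval, where a single local sign test detects it.

  Boundedness of the critical values is tightness of the multiscale statistic under Rademacher signs
  (\<open>multiscale_statistic_tight\<close>). The union bound is taken over a grid of scales and locations that is
  finer than the dyadic one by a factor growing like the logarithm of \<open>n / d\<close>; the penalty
  \<^const>\<open>Gam\<close> compensates the number of grid points. Between grid points
  no chaining is needed: the kernel is a triangle, so the statistics of neighbouring scales and
  locations differ by sums of the signs over few windows, and a maximal inequality
  (\<open>rademacher_maximal\<close>) controls all of these partial sums at once.

  For the band, let \<open>f\<close> be affine up to an error \<open>E\<close> on intervals of length \<open>\<delta>\<close>. If a convex \<open>g\<close>
  exceeds \<open>f + E + \<epsilon>\<close> at a point, then \<open>g\<close> exceeds \<open>f + \<epsilon>\<close> on the whole interval of length \<open>\<delta>\<close>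
  to the left or to the right of that point (\<open>upper_candidate_le\<close>). If \<open>g\<close> stays below the upper band but falls below
  \<open>f - 3 (E + \<epsilon>)\<close> at a point, then it is below \<open>f - \<epsilon>\<close> on an interval of length \<open>\<delta> / 2\<close>
  (\<open>lower_candidate_ge\<close>). In both cases this interval contains a cell of a fixed grid of mesh
  \<open>\<delta> / 4\<close>. A cell contains of the order of \<open>n \<delta>\<close> design points, and the signs there have a bias of
  the order of \<open>\<epsilon>\<close>; by Hoeffding's inequality the local test of the cell rejects \<open>g\<close> unless an event of
  probability at most \<open>exp (- z\<^sup>2 / 2)\<close> occurs, where \<open>z\<close> is a multiple of \<open>sqrt (n \<delta>) \<epsilon>\<close> minus the penalty and
  a constant. The exceptional events do not depend on \<open>g\<close>, so a union bound over the cells suffices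
  (\<open>band_failure_probability\<close>).

  The two parts of the theorem differ only in the choice of \<open>\<delta>\<close> and \<open>\<epsilon>\<close>: for affine \<open>f\<close>, \<open>E = 0\<close>,
  \<open>\<delta>\<close> is constant and \<open>\<epsilon>\<close> is of the order \<open>n\<^sup>-\<^sup>1\<^sup>/\<^sup>2\<close>; for smooth \<open>f\<close>, \<open>E = L \<delta>\<^sup>\<beta>\<close> and \<open>\<epsilon> = K \<delta>\<^sup>\<beta>\<close>
  with \<open>\<delta>\<^sup>2\<^sup>\<beta>\<^sup>+\<^sup>1 = \<rho>\<^sub>n\<close>, so that the signal is of the order \<open>sqrt (log n)\<close>, like the
  penalty.\<close>

section \<open>A maximal inequality for Rademacher sums\<close>

definition sign_vectors :: "'i set \<Rightarrow> ('i \<Rightarrow> real) set" where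
  "sign_vectors I = PiE I (\<lambda>_. {- 1, 1})"

lemma finite_sign_vectors: "finite I \<Longrightarrow> finite (sign_vectors I)"
  unfolding sign_vectors_def by (intro finite_PiE) auto

lemma card_sign_vectors: "finite I \<Longrightarrow> card (sign_vectors I) = 2 ^ card I"
  unfolding sign_vectors_def by (simp add: card_PiE numeral_2_eq_2)

lemma sum_sign_vectors_insert:
  fixes F :: "('i \<Rightarrow> real) \<Rightarrow> real"
  assumes "finite I" "i \<notin> I"
  shows "(\<Sum>\<xi>\<in>sign_vectors (insert i I). F \<xi>) =
    (\<Sum>\<xi>\<in>sign_vectors I. F (\<xi>(i := 1)) + F (\<xi>(i := - 1)))"
proof -
  have eq: "sign_vectors (insert i I) = (\<lambda>(y, g). g(i := y)) ` ({- 1, 1} \<times> sign_vectors I)"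
    unfolding sign_vectors_def by (rule PiE_insert_eq)
  have inj: "inj_on (\<lambda>(y, g). g(i := y)) ({- 1, 1} \<times> sign_vectors I)"
    unfolding sign_vectors_def by (rule inj_combinator[OF assms(2)])
  have "(\<Sum>\<xi>\<in>sign_vectors (insert i I). F \<xi>) =
      (\<Sum>(y, g)\<in>{- 1, 1} \<times> sign_vectors I. F (g(i := y)))"
    unfolding eq by (subst sum.reindex[OF inj]) (simp add: case_prod_unfold)
  also have "\<dots> = (\<Sum>y\<in>{- 1, 1}. \<Sum>g\<in>sign_vectors I. F (g(i := y)))"
    by (simp add: sum.cartesian_product)
  finally show ?thesis by (simp add: sum.distrib add.commute)
qed

text \<open>The power series are compared term by term: the odd terms on the left cancel, and
  \<open>2\<^sup>k k! \<le> (2k)!\<close>.\<close>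
lemma cosh_le_exp_half_square: "exp \<theta> + exp (- \<theta>) \<le> 2 * exp (\<theta>\<^sup>2 / 2)" for \<theta> :: real
proof -
  have "(\<lambda>k. \<theta> ^ k /\<^sub>R fact k + (- \<theta>) ^ k /\<^sub>R fact k) sums (exp \<theta> + exp (- \<theta>))"
    by (intro sums_add exp_converges)
  then have s1: "(\<lambda>k. \<theta> ^ (2 * k) /\<^sub>R fact (2 * k) + (- \<theta>) ^ (2 * k) /\<^sub>R fact (2 * k))
      sums (exp \<theta> + exp (- \<theta>))"
  proof (subst sums_mono_reindex[of "\<lambda>k. 2 * k"])
    show "strict_mono (\<lambda>k::nat. 2 * k)" by (auto simp: strict_mono_def)
    show "\<theta> ^ k /\<^sub>R fact k + (- \<theta>) ^ k /\<^sub>R fact k = 0" if "k \<notin> range ((*) 2)" for k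
    proof -
      have "odd k" using that by (auto elim!: evenE)
      then show ?thesis by simp
    qed
  qed
  have s2: "(\<lambda>k. 2 * ((\<theta>\<^sup>2 / 2) ^ k /\<^sub>R fact k)) sums (2 * exp (\<theta>\<^sup>2 / 2))"
    by (intro sums_mult exp_converges)
  show ?thesis
  proof (rule sums_le[OF _ s1 s2])
    fix k :: nat
    have "(2 ^ k * fact k :: nat) \<le> fact (2 * k)"
    proof (induction k)
      case (Suc k)
      have "2 ^ Suc k * fact (Suc k) = 2 * (k + 1) * (2 ^ k * fact k :: nat)" by (simp add: algebra_simps)
      also have "\<dots> \<le> ((2 * k + 2) * (2 * k + 1)) * fact (2 * k)"
        by (intro mult_mono Suc) auto
      also have "\<dots> = fact (2 * Suc k)" by (simp add: algebra_simps)
      finally show ?case .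
    qed simp
    then have "real (2 ^ k * fact k) \<le> real (fact (2 * k))" by (rule of_nat_mono)
    then have "(2 ^ k * fact k :: real) \<le> fact (2 * k)" by simp
    then have le: "\<theta> ^ (2 * k) / fact (2 * k) \<le> \<theta> ^ (2 * k) / (2 ^ k * fact k)"
      by (intro divide_left_mono) auto
    have e1: "(\<theta>\<^sup>2 / 2) ^ k /\<^sub>R fact k = \<theta> ^ (2 * k) / (2 ^ k * fact k)"
      unfolding power_divide power_mult real_scaleR_def by (simp only: divide_inverse inverse_mult_distrib mult_ac)
    have e2: "\<theta> ^ (2 * k) /\<^sub>R fact (2 * k) = \<theta> ^ (2 * k) / fact (2 * k)"
      unfolding real_scaleR_def by (simp only: divide_inverse mult_ac)
    have e3: "(- \<theta>) ^ (2 * k) = \<theta> ^ (2 * k)" by simp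
    show "\<theta> ^ (2 * k) /\<^sub>R fact (2 * k) + (- \<theta>) ^ (2 * k) /\<^sub>R fact (2 * k)
        \<le> 2 * ((\<theta>\<^sup>2 / 2) ^ k /\<^sub>R fact k)"
      unfolding e3 e2 e1 using le by linarith
  qed
qed

lemma ex_le_Suc_split: "(\<exists>k\<le>Suc n. P k) \<longleftrightarrow> P 0 \<or> (\<exists>k\<le>n. P (Suc k))"
  by (metis Suc_le_mono le0 not0_implies_Suc)

text \<open>The induction is on the first summand. For \<open>t > 0\<close>, conditioning on its sign turns the event
  that some partial sum reaches \<open>t\<close> into the same event for the remaining summands with \<open>t\<close>
  moved to \<open>t - w\<close> or \<open>t + w\<close>; averaging the two exponential bounds costs one factor
  \<open>cosh (\<theta> w) \<le> exp (\<theta>\<^sup>2 w\<^sup>2 / 2)\<close>. For \<open>t \<le> 0\<close> the bound is at least 1. So the maximum of all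
  partial sums obeys the same exponential bound as the full sum. The weights may
  vanish, which confines the sums to a window.\<close>
lemma sign_vectors_maximal:
  fixes w :: "'i \<Rightarrow> real"
  assumes "distinct is" "\<theta> \<ge> 0"
  shows "(\<Sum>\<xi>\<in>sign_vectors (set is).
      of_bool (\<exists>k\<le>length is. t \<le> (\<Sum>i\<leftarrow>take k is. w i * \<xi> i)))
    \<le> 2 ^ length is * exp (\<theta>\<^sup>2 * (\<Sum>i\<leftarrow>is. (w i)\<^sup>2) / 2 - \<theta> * t)"
  using assms(1)
proof (induction "is" arbitrary: t)
  case Nil
  have "t \<le> 0 \<Longrightarrow> 1 \<le> exp (- (\<theta> * t))" using assms(2) by (simp add: mult_nonneg_nonpos)
  then show ?case by (simp add: sign_vectors_def)
next
  case (Cons i "is")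
  let ?V = "\<Sum>i\<leftarrow>is. (w i)\<^sup>2"
  let ?E = "\<lambda>t is \<xi>. \<exists>k\<le>length is. t \<le> (\<Sum>i\<leftarrow>take k is. w i * \<xi> i)"
  have i: "i \<notin> set is" and dist: "distinct is" using Cons.prems by auto
  have V: "0 \<le> ?V" by (intro sum_list_nonneg) auto
  show ?case
  proof (cases "t \<le> 0")
    case True
    have "(\<Sum>\<xi>\<in>sign_vectors (set (i # is)). of_bool (?E t (i # is) \<xi>)) \<le>
        (\<Sum>\<xi>\<in>sign_vectors (set (i # is)). (1 :: real))"
      by (intro sum_mono) auto
    also have "\<dots> = 2 ^ length (i # is)"
      using Cons.prems by (simp add: card_sign_vectors distinct_card del: set_simps)
    also have "\<dots> \<le> 2 ^ length (i # is) * exp (\<theta>\<^sup>2 * (\<Sum>i\<leftarrow>i # is. (w i)\<^sup>2) / 2 - \<theta> * t)"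
    proof -
      have "0 \<le> \<theta>\<^sup>2 * (\<Sum>i\<leftarrow>i # is. (w i)\<^sup>2) / 2 - \<theta> * t"
        using mult_nonneg_nonpos[OF assms(2) True]
          mult_nonneg_nonneg[OF zero_le_power2[of \<theta>] add_nonneg_nonneg[OF zero_le_power2[of "w i"] V]]
        unfolding list.map sum_list.Cons by linarith
      then have "1 \<le> exp (\<theta>\<^sup>2 * (\<Sum>i\<leftarrow>i # is. (w i)\<^sup>2) / 2 - \<theta> * t)" by simp
      then show ?thesis by simp
    qed
    finally show ?thesis .
  next
    case False
    have step: "?E t (i # is) (\<xi>(i := y)) \<longleftrightarrow> ?E (t - w i * y) is \<xi>" for \<xi> :: "'i \<Rightarrow> real" and y
    proof -
      have "(\<Sum>l\<leftarrow>take k is. w l * (\<xi>(i := y)) l) = (\<Sum>l\<leftarrow>take k is. w l * \<xi> l)" for k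
        using i by (intro arg_cong[where f = sum_list] map_cong refl) (auto dest: in_set_takeD)
      moreover have "?E t (i # is) (\<xi>(i := y)) \<longleftrightarrow>
          (\<exists>k\<le>length is. t \<le> (\<Sum>l\<leftarrow>take (Suc k) (i # is). w l * (\<xi>(i := y)) l))"
        using False ex_le_Suc_split[of "length is" "\<lambda>k. t \<le> (\<Sum>l\<leftarrow>take k (i # is). w l * (\<xi>(i := y)) l)"]
        by simp
      ultimately show ?thesis by (simp add: algebra_simps)
    qed
    have "(\<Sum>\<xi>\<in>sign_vectors (set (i # is)). of_bool (?E t (i # is) \<xi>) :: real) =
        (\<Sum>\<xi>\<in>sign_vectors (set is). of_bool (?E (t - w i) is \<xi>)) +
        (\<Sum>\<xi>\<in>sign_vectors (set is). of_bool (?E (t + w i) is \<xi>))"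
      using sum_sign_vectors_insert[OF _ i] step by (simp add: sum.distrib)
    also have "\<dots> \<le> 2 ^ length is * exp (\<theta>\<^sup>2 * ?V / 2 - \<theta> * (t - w i)) +
        2 ^ length is * exp (\<theta>\<^sup>2 * ?V / 2 - \<theta> * (t + w i))"
      by (intro add_mono Cons.IH dist)
    also have "\<dots> = 2 ^ length is * exp (\<theta>\<^sup>2 * ?V / 2 - \<theta> * t) *
        (exp (\<theta> * w i) + exp (- (\<theta> * w i)))"
    proof -
      have "\<theta>\<^sup>2 * ?V / 2 - \<theta> * (t - w i) = (\<theta>\<^sup>2 * ?V / 2 - \<theta> * t) + \<theta> * w i"
        "\<theta>\<^sup>2 * ?V / 2 - \<theta> * (t + w i) = (\<theta>\<^sup>2 * ?V / 2 - \<theta> * t) + - (\<theta> * w i)"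
        by (simp_all add: algebra_simps)
      then show ?thesis by (simp only: exp_add distrib_left mult.assoc)
    qed
    also have "\<dots> \<le> 2 ^ length is * exp (\<theta>\<^sup>2 * ?V / 2 - \<theta> * t) * (2 * exp ((\<theta> * w i)\<^sup>2 / 2))"
      by (intro mult_left_mono cosh_le_exp_half_square) auto
    also have "\<dots> = 2 ^ length (i # is) * exp (\<theta>\<^sup>2 * (\<Sum>i\<leftarrow>i # is. (w i)\<^sup>2) / 2 - \<theta> * t)"
    proof -
      have "\<theta>\<^sup>2 * (\<Sum>i\<leftarrow>i # is. (w i)\<^sup>2) / 2 - \<theta> * t =
          (\<theta>\<^sup>2 * ?V / 2 - \<theta> * t) + (\<theta> * w i)\<^sup>2 / 2"
        unfolding list.map sum_list.Cons power_mult_distrib distrib_left add_divide_distrib by linarith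
      then show ?thesis by (simp only: exp_add list.size power_Suc mult_ac One_nat_def add_Suc_right add_0_right)
    qed
    finally show ?thesis .
  qed
qed

lemma rademacher_prob:
  "measure_pmf.prob (rademacher n) {\<xi>. P \<xi>} =
    (\<Sum>\<xi>\<in>sign_vectors {1..n}. of_bool (P \<xi>)) / 2 ^ n"
proof -
  have fin: "finite (sign_vectors {1..n})" by (simp add: finite_sign_vectors)
  have card: "card (sign_vectors {1..n}) = 2 ^ n" by (simp add: card_sign_vectors)
  then have ne: "sign_vectors {1..n} \<noteq> {}" by fastforce
  have "measure_pmf.prob (rademacher n) {\<xi>. P \<xi>} =
      card (sign_vectors {1..n} \<inter> {\<xi>. P \<xi>}) / card (sign_vectors {1..n})"
    unfolding rademacher_def using measure_pmf_of_set[OF ne fin] by (simp add: sign_vectors_def)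
  then show ?thesis using fin card by (simp add: of_bool_def sum.If_cases)
qed

text \<open>Hoeffding's bound, obtained from the exponential bound with \<open>\<theta> = t / V\<close>.\<close>
lemma rademacher_maximal:
  fixes w :: "nat \<Rightarrow> real"
  assumes V: "(\<Sum>i=1..n. (w i)\<^sup>2) \<le> V" "V > 0" and t: "t \<ge> 0"
  shows "measure_pmf.prob (rademacher n) {\<xi>. \<exists>k\<le>n. t \<le> (\<Sum>i=1..k. w i * \<xi> i)}
    \<le> exp (- t\<^sup>2 / (2 * V))"
proof -
  let ?is = "[1..<Suc n]"
  have set: "set ?is = {1..n}" by auto
  have pre: "(\<Sum>i\<leftarrow>take k ?is. g i) = (\<Sum>i=1..k. g i)" if "k \<le> n" for g :: "nat \<Rightarrow> real" and k
  proof -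
    have "take k ?is = [1..<Suc k]" using that by (subst take_upt) auto
    then show ?thesis by (simp only: interv_sum_list_conv_sum_set_nat set_upt atLeastLessThanSuc_atLeastAtMost)
  qed
  have V': "(\<Sum>i\<leftarrow>?is. (w i)\<^sup>2) \<le> V" using pre[of n] V(1) by simp
  have "measure_pmf.prob (rademacher n) {\<xi>. \<exists>k\<le>n. t \<le> (\<Sum>i=1..k. w i * \<xi> i)} =
      (\<Sum>\<xi>\<in>sign_vectors (set ?is).
        of_bool (\<exists>k\<le>length ?is. t \<le> (\<Sum>i\<leftarrow>take k ?is. w i * \<xi> i))) / 2 ^ n"
  proof -
    have "(\<exists>k\<le>n. t \<le> (\<Sum>i=1..k. w i * \<xi> i)) \<longleftrightarrow>
        (\<exists>k\<le>length ?is. t \<le> (\<Sum>i\<leftarrow>take k ?is. w i * \<xi> i))" for \<xi>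
    proof -
      have "length ?is = n" by simp
      then show ?thesis
        using pre[of _ "\<lambda>i. w i * \<xi> i"] by (simp del: upt_Suc One_nat_def cong: conj_cong)
    qed
    then show ?thesis unfolding rademacher_prob set by presburger
  qed
  also have "\<dots> \<le> exp ((t / V)\<^sup>2 * (\<Sum>i\<leftarrow>?is. (w i)\<^sup>2) / 2 - t / V * t)"
    using sign_vectors_maximal[of ?is "t / V" t w] V t
    by (simp add: pos_divide_le_eq mult.commute[of _ "2 ^ n"] del: upt_Suc)
  also have "\<dots> \<le> exp ((t / V)\<^sup>2 * V / 2 - t / V * t)"
    using V' by (simp add: mult_left_mono)
  also have "(t / V)\<^sup>2 * V / 2 - t / V * t = - t\<^sup>2 / (2 * V)"
    using V(2) by (simp add: power2_eq_square field_simps)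
  finally show ?thesis .
qed

lemma rademacher_maximal_abs:
  fixes w :: "nat \<Rightarrow> real"
  assumes V: "(\<Sum>i=1..n. (w i)\<^sup>2) \<le> V" "V > 0" and t: "t \<ge> 0"
  shows "measure_pmf.prob (rademacher n) {\<xi>. \<exists>k\<le>n. t \<le> \<bar>\<Sum>i=1..k. w i * \<xi> i\<bar>}
    \<le> 2 * exp (- t\<^sup>2 / (2 * V))"
proof -
  have abs: "t \<le> \<bar>u\<bar> \<longleftrightarrow> t \<le> u \<or> t \<le> - u" for u :: real by linarith
  have "{\<xi>. \<exists>k\<le>n. t \<le> \<bar>\<Sum>i=1..k. w i * \<xi> i\<bar>} =
      {\<xi>. \<exists>k\<le>n. t \<le> (\<Sum>i=1..k. w i * \<xi> i)} \<union> {\<xi>. \<exists>k\<le>n. t \<le> (\<Sum>i=1..k. - w i * \<xi> i)}"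
    unfolding abs mult_minus_left sum_negf by blast
  then have "measure_pmf.prob (rademacher n) {\<xi>. \<exists>k\<le>n. t \<le> \<bar>\<Sum>i=1..k. w i * \<xi> i\<bar>}
      \<le> measure_pmf.prob (rademacher n) {\<xi>. \<exists>k\<le>n. t \<le> (\<Sum>i=1..k. w i * \<xi> i)} +
        measure_pmf.prob (rademacher n) {\<xi>. \<exists>k\<le>n. t \<le> (\<Sum>i=1..k. - w i * \<xi> i)}"
    by (simp add: measure_subadditive)
  also have "\<dots> \<le> exp (- t\<^sup>2 / (2 * V)) + exp (- t\<^sup>2 / (2 * V))"
    using V t by (intro add_mono rademacher_maximal) auto
  finally show ?thesis by simp
qed

section \<open>The triangular kernel\<close>

lemma psi_nonneg: "0 \<le> psi u" and psi_le_1: "psi u \<le> 1"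
  by (auto simp: psi_def)

lemma psi_eq_0: "1 \<le> \<bar>u\<bar> \<Longrightarrow> psi u = 0"
  by (auto simp: psi_def)

lemma psi_scaled: "d > 0 \<Longrightarrow> d * psi (u / d) = max (d - \<bar>u\<bar>) 0"
  by (auto simp: psi_def max_def field_simps)

lemma sum_abs_symmetric_interval:
  "d \<ge> 1 \<Longrightarrow> (\<Sum>z\<in>{1 - int d..int d - 1}. \<bar>real_of_int z\<bar>) = real d * (real d - 1)"
proof (induction d rule: nat_induct_at_least)
  case (Suc d)
  have "{1 - int (Suc d)..int (Suc d) - 1} = insert (- int d) (insert (int d) {1 - int d..int d - 1})"
    using Suc by auto
  then show ?case using Suc by (simp add: algebra_simps)
qed simp

lemma sum_psi:
  assumes "d \<ge> 1"
  shows "(\<Sum>z\<in>{1 - int d..int d - 1}. psi (real_of_int z / real d)) = real d"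
proof -
  have "(\<Sum>z\<in>{1 - int d..int d - 1}. psi (real_of_int z / real d)) =
      (\<Sum>z\<in>{1 - int d..int d - 1}. 1 - \<bar>real_of_int z\<bar> / real d)"
    using assms by (intro sum.cong refl) (auto simp: psi_def field_simps)
  also have "\<dots> = real d"
    using assms sum_abs_symmetric_interval[OF assms]
    by (simp add: sum_subtractf field_simps flip: sum_divide_distrib)
  finally show ?thesis .
qed

definition kernel_energy :: "nat \<Rightarrow> real" where
  "kernel_energy d = (\<Sum>z\<in>{1 - int d..int d - 1}. (psi (real_of_int z / real d))\<^sup>2)"

lemma beta_coef_eq: "beta_coef d = 1 / sqrt (kernel_energy d)"
  unfolding beta_coef_def kernel_energy_def
  by (simp add: powr_minus_divide powr_half_sqrt sum_nonneg)

lemma kernel_energy_le: "d \<ge> 1 \<Longrightarrow> kernel_energy d \<le> real d"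
  unfolding kernel_energy_def
  by (subst sum_psi[symmetric])
     (auto intro!: sum_mono simp: power2_eq_square psi_nonneg psi_le_1 mult_left_le)

text \<open>Cauchy-Schwarz against the constant function, as the kernel sums to \<open>d\<close> over its \<open>2d - 1\<close> points.\<close>
lemma kernel_energy_ge:
  assumes "d \<ge> 1"
  shows "real d / 2 \<le> kernel_energy d"
proof -
  have "(real d)\<^sup>2 \<le> (\<Sum>z\<in>{1 - int d..int d - 1}. 1\<^sup>2) * kernel_energy d"
    using Cauchy_Schwarz_ineq_sum[of "\<lambda>_. 1" "\<lambda>z. psi (real_of_int z / real d)" "{1 - int d..int d - 1}"]
      sum_psi[OF assms] by (simp add: kernel_energy_def)
  also have "\<dots> \<le> (2 * real d) * kernel_energy d"
    by (intro mult_right_mono) (auto simp: kernel_energy_def sum_nonneg)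
  finally show ?thesis using assms by (simp add: power2_eq_square field_simps)
qed

lemma kernel_energy_mono:
  assumes "1 \<le> d" "d \<le> e"
  shows "kernel_energy d \<le> kernel_energy e"
proof -
  have "kernel_energy d \<le> (\<Sum>z\<in>{1 - int d..int d - 1}. (psi (real_of_int z / real e))\<^sup>2)"
    unfolding kernel_energy_def
  proof (intro sum_mono power_mono psi_nonneg)
    fix z :: int
    have "\<bar>real_of_int z\<bar> / real e \<le> \<bar>real_of_int z\<bar> / real d"
      using assms by (intro divide_left_mono) auto
    then show "psi (real_of_int z / real d) \<le> psi (real_of_int z / real e)"
      by (auto simp: psi_def)
  qed
  also have "\<dots> \<le> kernel_energy e"
    unfolding kernel_energy_def using assms by (intro sum_mono2) auto
  finally show ?thesis .
qed

lemma beta_coef_pos: "d \<ge> 1 \<Longrightarrow> beta_coef d > 0"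
  using kernel_energy_ge[of d] by (simp add: beta_coef_eq)

lemma beta_coef_ge:
  assumes "d \<ge> 1" shows "1 / sqrt (real d) \<le> beta_coef d"
  unfolding beta_coef_eq using kernel_energy_le[OF assms] kernel_energy_ge[OF assms] assms
  by (intro divide_left_mono real_sqrt_le_mono mult_pos_pos real_sqrt_gt_zero) linarith+

lemma beta_coef_le:
  assumes "d \<ge> 1" shows "beta_coef d \<le> sqrt (2 / real d)"
proof -
  have "1 / sqrt (kernel_energy d) \<le> 1 / sqrt (real d / 2)"
    using kernel_energy_ge[OF assms] assms
    by (intro divide_left_mono real_sqrt_le_mono mult_pos_pos real_sqrt_gt_zero) linarith+
  then show ?thesis by (simp add: beta_coef_eq real_sqrt_divide)
qed

lemma beta_coef_antimono:
  assumes "1 \<le> d" "d \<le> e" shows "beta_coef e \<le> beta_coef d"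
  unfolding beta_coef_eq
  using kernel_energy_mono[OF assms] kernel_energy_ge[of d] kernel_energy_ge[of e] assms
  by (intro divide_left_mono real_sqrt_le_mono mult_pos_pos real_sqrt_gt_zero) linarith+

lemma sum_window_le:
  fixes g :: "int \<Rightarrow> real"
  assumes "\<And>z. g z \<ge> 0" "\<And>z. int d \<le> \<bar>z\<bar> \<Longrightarrow> g z = 0"
  shows "(\<Sum>i=1..n. g (int i - int j)) \<le> (\<Sum>z\<in>{1 - int d..int d - 1}. g z)"
proof -
  have "(\<Sum>i=1..n. g (int i - int j)) = (\<Sum>z\<in>(\<lambda>i. int i - int j) ` {1..n}. g z)"
    by (subst sum.reindex) (auto simp: inj_on_def)
  also have "\<dots> = (\<Sum>z\<in>(\<lambda>i. int i - int j) ` {1..n} \<inter> {1 - int d..int d - 1}. g z)"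
    by (rule sum.mono_neutral_right) (auto intro!: assms(2))
  also have "\<dots> \<le> (\<Sum>z\<in>{1 - int d..int d - 1}. g z)"
    by (rule sum_mono2) (auto intro: assms(1))
  finally show ?thesis .
qed

lemma sum_window_eq:
  fixes g :: "int \<Rightarrow> real"
  assumes "\<And>z. int d \<le> \<bar>z\<bar> \<Longrightarrow> g z = 0" "d \<le> j" "j + d \<le> n + 1"
  shows "(\<Sum>i=1..n. g (int i - int j)) = (\<Sum>z\<in>{1 - int d..int d - 1}. g z)"
proof -
  have "(\<Sum>i=1..n. g (int i - int j)) = (\<Sum>z\<in>(\<lambda>i. int i - int j) ` {1..n}. g z)"
    by (subst sum.reindex) (auto simp: inj_on_def)
  also have "\<dots> = (\<Sum>z\<in>{1 - int d..int d - 1}. g z)"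
  proof (rule sum.mono_neutral_right)
    show "{1 - int d..int d - 1} \<subseteq> (\<lambda>i. int i - int j) ` {1..n}"
    proof
      fix z assume "z \<in> {1 - int d..int d - 1}"
      then have "z = int (nat (z + int j)) - int j" "nat (z + int j) \<in> {1..n}"
        using assms(2,3) by auto
      then show "z \<in> (\<lambda>i. int i - int j) ` {1..n}" by blast
    qed
  qed (auto intro!: assms(1))
  finally show ?thesis .
qed

text \<open>The local statistics have subgaussian variance at most 1, also near the boundary, where part of the
  kernel falls outside \<open>{1..n}\<close>.\<close>
lemma psi_window_energy:
  assumes "d \<ge> 1"
  shows "(\<Sum>i=1..n. (beta_coef d * psi ((real i - real j) / real d))\<^sup>2) \<le> 1"
proof -
  have "(\<Sum>i=1..n. (psi ((real i - real j) / real d))\<^sup>2) =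
      (\<Sum>i=1..n. (\<lambda>z. (psi (real_of_int z / real d))\<^sup>2) (int i - int j))"
    by simp
  also have "\<dots> \<le> kernel_energy d"
    unfolding kernel_energy_def
    by (rule sum_window_le) (use assms in \<open>auto intro!: psi_eq_0\<close>)
  finally have "(beta_coef d)\<^sup>2 * (\<Sum>i=1..n. (psi ((real i - real j) / real d))\<^sup>2)
      \<le> (beta_coef d)\<^sup>2 * kernel_energy d"
    by (intro mult_left_mono) auto
  also have "\<dots> = 1"
    using kernel_energy_ge[OF assms] assms by (simp add: beta_coef_eq power_divide)
  finally show ?thesis by (simp add: power_mult_distrib sum_distrib_left)
qed

lemma psi_window_sum:
  assumes "d \<ge> 1" "d \<le> j" "j + d \<le> n + 1"
  shows "(\<Sum>i=1..n. psi ((real i - real j) / real d)) = real d"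
proof -
  have "(\<Sum>i=1..n. psi ((real i - real j) / real d)) =
      (\<Sum>i=1..n. (\<lambda>z. psi (real_of_int z / real d)) (int i - int j))"
    by simp
  also have "\<dots> = (\<Sum>z\<in>{1 - int d..int d - 1}. psi (real_of_int z / real d))"
    by (rule sum_window_eq) (use assms in \<open>auto intro!: psi_eq_0\<close>)
  also have "\<dots> = real d" by (rule sum_psi[OF assms(1)])
  finally show ?thesis .
qed

section \<open>Tent sums and their increments\<close>

definition window_sum :: "nat \<Rightarrow> (nat \<Rightarrow> real) \<Rightarrow> int \<Rightarrow> int \<Rightarrow> real" where
  "window_sum n \<sigma> p q = (\<Sum>i=1..n. (if p \<le> int i \<and> int i \<le> q then \<sigma> i else 0))"

text \<open>This is \<open>d\<close> times the unnormalized local statistic. With this scaling the kernel is an integer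
  valued tent, and enlarging \<open>d\<close> or \<open>j\<close> by one adds or subtracts plain sums over windows. Hence
  all local statistics with similar \<open>d\<close> and \<open>j\<close> are controlled by one maximum of partial sums.\<close>
definition tent_sum :: "nat \<Rightarrow> (nat \<Rightarrow> real) \<Rightarrow> nat \<Rightarrow> nat \<Rightarrow> real" where
  "tent_sum n \<sigma> d j = (\<Sum>i=1..n. max (real d - \<bar>real i - real j\<bar>) 0 * \<sigma> i)"

lemma T_loc_eq_tent_sum: "d \<ge> 1 \<Longrightarrow> T_loc n d j \<sigma> = beta_coef d * (tent_sum n \<sigma> d j / real d)"
  unfolding T_loc_def tent_sum_def sum_divide_distrib
  by (intro arg_cong2[where f = "(*)"] refl sum.cong)
     (auto simp: field_simps simp flip: psi_scaled)

lemma tent_sum_Suc_scale: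
  "tent_sum n \<sigma> (Suc d) j = tent_sum n \<sigma> d j + window_sum n \<sigma> (int j - int d) (int j + int d)"
  unfolding tent_sum_def window_sum_def sum.distrib[symmetric]
proof (rule sum.cong[OF refl])
  fix i :: nat
  have "max (int (Suc d) - \<bar>int i - int j\<bar>) 0 = max (int d - \<bar>int i - int j\<bar>) 0 +
      (if int j - int d \<le> int i \<and> int i \<le> int j + int d then 1 else 0)"
    by (auto simp: max_def abs_if)
  from this[THEN arg_cong[where f = real_of_int]]
  have "max (real (Suc d) - \<bar>real i - real j\<bar>) 0 = max (real d - \<bar>real i - real j\<bar>) 0 +
      (if int j - int d \<le> int i \<and> int i \<le> int j + int d then 1 else 0)"
    by (simp add: of_int_max split: if_splits)
  then show "max (real (Suc d) - \<bar>real i - real j\<bar>) 0 * \<sigma> i =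
      max (real d - \<bar>real i - real j\<bar>) 0 * \<sigma> i +
      (if int j - int d \<le> int i \<and> int i \<le> int j + int d then \<sigma> i else 0)"
    by (simp add: algebra_simps)
qed

lemma tent_sum_Suc_shift:
  "tent_sum n \<sigma> d (Suc j) = tent_sum n \<sigma> d j + window_sum n \<sigma> (int j + 1) (int j + int d)
    - window_sum n \<sigma> (int j - int d + 1) (int j)"
  unfolding tent_sum_def window_sum_def sum.distrib[symmetric] sum_subtractf[symmetric]
proof (rule sum.cong[OF refl])
  fix i :: nat
  have "max (int d - \<bar>int i - int (Suc j)\<bar>) 0 = max (int d - \<bar>int i - int j\<bar>) 0 +
      (if int j + 1 \<le> int i \<and> int i \<le> int j + int d then 1 else 0) -
      (if int j - int d + 1 \<le> int i \<and> int i \<le> int j then 1 else 0)"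
    by (auto simp: max_def abs_if)
  from this[THEN arg_cong[where f = real_of_int]]
  have eq: "max (real d - \<bar>real i - real (Suc j)\<bar>) 0 = max (real d - \<bar>real i - real j\<bar>) 0 +
      (if int j + 1 \<le> int i \<and> int i \<le> int j + int d then 1 else 0) -
      (if int j - int d + 1 \<le> int i \<and> int i \<le> int j then 1 else 0)"
    by (simp add: of_int_max split: if_splits)
  show "max (real d - \<bar>real i - real (Suc j)\<bar>) 0 * \<sigma> i =
      max (real d - \<bar>real i - real j\<bar>) 0 * \<sigma> i +
      (if int j + 1 \<le> int i \<and> int i \<le> int j + int d then \<sigma> i else 0) -
      (if int j - int d + 1 \<le> int i \<and> int i \<le> int j then \<sigma> i else 0)"
    unfolding eq by (simp add: algebra_simps)
qed

lemma tent_sum_scale_increment: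
  assumes "\<And>p q. lo \<le> p \<Longrightarrow> q \<le> hi \<Longrightarrow> \<bar>window_sum n \<sigma> p q\<bar> \<le> \<nu>"
    and "d \<le> e" "lo \<le> int j - int e" "int j + int e \<le> hi"
  shows "\<bar>tent_sum n \<sigma> e j - tent_sum n \<sigma> d j\<bar> \<le> \<nu> * (real e - real d)"
  using assms(2-)
proof (induction e rule: dec_induct)
  case (step e)
  have "\<bar>window_sum n \<sigma> (int j - int e) (int j + int e)\<bar> \<le> \<nu>"
    using step.prems by (intro assms(1)) auto
  moreover have "\<bar>tent_sum n \<sigma> e j - tent_sum n \<sigma> d j\<bar> \<le> \<nu> * (real e - real d)"
    using step.prems by (intro step.IH) auto
  ultimately show ?case
    by (simp add: tent_sum_Suc_scale distrib_left right_diff_distrib abs_le_iff)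
qed simp

lemma tent_sum_shift_increment:
  assumes "\<And>p q. lo \<le> p \<Longrightarrow> q \<le> hi \<Longrightarrow> \<bar>window_sum n \<sigma> p q\<bar> \<le> \<nu>"
    and "j \<le> l" "lo \<le> int j - int d" "int l + int d \<le> hi"
  shows "\<bar>tent_sum n \<sigma> d l - tent_sum n \<sigma> d j\<bar> \<le> 2 * \<nu> * (real l - real j)"
  using assms(2-)
proof (induction l rule: dec_induct)
  case (step l)
  have "\<bar>window_sum n \<sigma> (int l + 1) (int l + int d)\<bar> \<le> \<nu>"
    using step by (intro assms(1)) auto
  moreover have "\<bar>window_sum n \<sigma> (int l - int d + 1) (int l)\<bar> \<le> \<nu>"
    using step by (intro assms(1)) auto
  moreover have "\<bar>tent_sum n \<sigma> d l - tent_sum n \<sigma> d j\<bar> \<le> 2 * \<nu> * (real l - real j)"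
    using step.prems by (intro step.IH) auto
  ultimately show ?case
    by (simp add: tent_sum_Suc_shift distrib_left right_diff_distrib abs_le_iff)
qed simp

text \<open>At most \<open>r\<close> unit steps in scale and \<open>r\<close> in location lead from one sum to the other, and each costs
  at most two window sums. The result is a small multiple \<open>r / e\<close> of the largest window sum, which is
  what replaces a chaining argument.\<close>
lemma tent_sum_normalized_increment:
  assumes w: "\<And>p q. lo \<le> p \<Longrightarrow> q \<le> hi \<Longrightarrow> \<bar>window_sum n \<sigma> p q\<bar> \<le> \<nu>"
    and d: "1 \<le> d" "d \<le> e" "e \<le> d + r" and j: "j \<le> l" "l \<le> j + r"
    and rng: "lo \<le> int j - int e" "int l + int e \<le> hi"
  shows "\<bar>tent_sum n \<sigma> e l / real e - tent_sum n \<sigma> d j / real d\<bar> \<le> 4 * \<nu> * real r / real e"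
proof -
  have nu: "0 \<le> \<nu>" using w[of "lo" "hi"] by simp
  have a1: "\<bar>tent_sum n \<sigma> e l - tent_sum n \<sigma> e j\<bar> \<le> 2 * \<nu> * real r"
    using tent_sum_shift_increment[OF w j(1) rng(1,2)] mult_left_mono[of "real l - real j" "real r" "2 * \<nu>"] nu j
    by simp
  have a2: "\<bar>tent_sum n \<sigma> e j - tent_sum n \<sigma> d j\<bar> \<le> \<nu> * real r"
    using tent_sum_scale_increment[OF w d(2) rng(1), of hi] mult_left_mono[of "real e - real d" "real r" "\<nu>"] nu d j rng
    by simp
  have "tent_sum n \<sigma> 0 j = 0" by (simp add: tent_sum_def)
  then have a3: "\<bar>tent_sum n \<sigma> d j\<bar> \<le> \<nu> * real d"
    using tent_sum_scale_increment[where lo = lo and hi = hi and d = 0 and e = d and j = j, OF w] d j rng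
    by simp
  have e: "real e > 0" "real d > 0" using d by auto
  have eq: "tent_sum n \<sigma> e l / real e - tent_sum n \<sigma> d j / real d =
      (tent_sum n \<sigma> e l - tent_sum n \<sigma> e j) / real e + (tent_sum n \<sigma> e j - tent_sum n \<sigma> d j) / real e
      - tent_sum n \<sigma> d j / real d * ((real e - real d) / real e)"
    using e by (simp add: field_simps)
  have "\<bar>tent_sum n \<sigma> d j / real d\<bar> \<le> \<nu>" using a3 e by (simp add: field_simps abs_mult)
  then have b3: "\<bar>tent_sum n \<sigma> d j / real d * ((real e - real d) / real e)\<bar> \<le> \<nu> * (real r / real e)"
    unfolding abs_mult using e d nu by (intro mult_mono) (auto simp: divide_right_mono)
  have b1: "\<bar>(tent_sum n \<sigma> e l - tent_sum n \<sigma> e j) / real e\<bar> \<le> 2 * \<nu> * real r / real e"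
    using a1 e by (simp add: abs_divide divide_right_mono)
  have b2: "\<bar>(tent_sum n \<sigma> e j - tent_sum n \<sigma> d j) / real e\<bar> \<le> \<nu> * real r / real e"
    using a2 e by (simp add: abs_divide divide_right_mono)
  have "4 * \<nu> * real r / real e = 2 * \<nu> * real r / real e + \<nu> * real r / real e + \<nu> * (real r / real e)"
    by (simp add: field_simps)
  then show ?thesis unfolding eq using b1 b2 b3 by linarith
qed

text \<open>A window sum is the difference of two partial sums that start at the left end of the window.\<close>
lemma window_sum_le_partial_sums:
  assumes "\<And>k. k \<le> n \<Longrightarrow>
      \<bar>\<Sum>i=1..k. (if lo \<le> int i \<and> int i \<le> hi then 1 else 0) * \<sigma> i\<bar> \<le> \<mu>"
    and "lo \<le> p" "q \<le> hi"
  shows "\<bar>window_sum n \<sigma> p q\<bar> \<le> 2 * \<mu>"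
proof -
  let ?h = "\<lambda>i. (if lo \<le> int i \<and> int i \<le> hi then 1 else 0) * \<sigma> i"
  define K where "K z = min n (nat z)" for z :: int
  have mu: "0 \<le> \<mu>" using assms(1)[of 0] by simp
  show ?thesis
  proof (cases "p \<le> q")
    case True
    have split: "(\<Sum>i=1..K q. ?h i) = (\<Sum>i=1..K (p - 1). ?h i) + window_sum n \<sigma> p q"
    proof -
      have K: "{1..K (p - 1)} \<subseteq> {1..K q}" using True by (auto simp: K_def)
      have "(\<Sum>i=1..K q. ?h i) = (\<Sum>i\<in>{1..K q} - {1..K (p - 1)}. ?h i) + (\<Sum>i=1..K (p - 1). ?h i)"
        by (rule sum.subset_diff[OF K]) simp
      also have "(\<Sum>i\<in>{1..K q} - {1..K (p - 1)}. ?h i) =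
          (\<Sum>i\<in>{1..K q} - {1..K (p - 1)}. if p \<le> int i \<and> int i \<le> q then \<sigma> i else 0)"
        using assms(2,3) by (intro sum.cong refl) (auto simp: K_def)
      also have "\<dots> = window_sum n \<sigma> p q"
        unfolding window_sum_def using True
        by (intro sum.mono_neutral_left) (auto simp: K_def)
      finally show ?thesis by simp
    qed
    have "\<bar>\<Sum>i=1..K q. ?h i\<bar> \<le> \<mu>" "\<bar>\<Sum>i=1..K (p - 1). ?h i\<bar> \<le> \<mu>"
      by (intro assms(1); simp add: K_def)+
    then show ?thesis using split by linarith
  next
    case False
    then have "window_sum n \<sigma> p q = 0" unfolding window_sum_def by (intro sum.neutral) auto
    then show ?thesis using mu by simp
  qed
qed

section \<open>The multiscale statistic is tight\<close>

text \<open>Scales are grouped into dyadic blocks \<open>2\<^sup>k \<le> d < 2\<^sup>k\<^sup>+\<^sup>1\<close> with \<open>2\<^sup>k\<^sup>+\<^sup>m \<le> n < 2\<^sup>k\<^sup>+\<^sup>m\<^sup>+\<^sup>1\<close>. On such a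
  block, \<open>n / (2d - 1) \<ge> max 1 (2\<^sup>m / 4)\<close>, and this is the resulting lower bound of
  \<^const>\<open>Gam\<close>. The natural number subtraction produces the maximum with 1.\<close>
definition scale_penalty :: "nat \<Rightarrow> real" where
  "scale_penalty m = sqrt (2 + 2 * real (m - 2) * ln 2)"

lemma scale_penalty_le_Gam:
  assumes d: "1 \<le> d" "d < 2 ^ Suc k" "2 * d \<le> n + 1" and n: "2 ^ (k + m) \<le> n"
  shows "scale_penalty m \<le> Gam ((2 * real d - 1) / real n)"
proof -
  have pos: "2 * real d - 1 > 0" "real n > 0" using d n by (auto intro!: gr0I)
  have "2 ^ (m - 2) * (2 * d - 1) \<le> n"
  proof (cases "m < 2")
    case False
    have "2 ^ (m - 2) * (2 * d - 1) \<le> 2 ^ (m - 2) * (2 * 2 ^ Suc k)"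
      using d by (intro mult_left_mono) auto
    also have "\<dots> = (2 ^ ((m - 2) + 2 + k) :: nat)" by (simp add: power_add)
    also have "(m - 2) + 2 + k = k + m" using False by simp
    finally show ?thesis using n by simp
  qed (use d in auto)
  then have "real (2 ^ (m - 2) * (2 * d - 1)) \<le> real n" by (rule of_nat_mono)
  then have "2 ^ (m - 2) * (2 * real d - 1) \<le> real n" using d by (simp add: of_nat_diff)
  then have le: "2 ^ (m - 2) \<le> real n / (2 * real d - 1)" using pos by (simp add: pos_le_divide_eq)
  have "ln (exp 1 / ((2 * real d - 1) / real n)) = 1 + ln (real n / (2 * real d - 1))"
    using pos by (simp add: ln_div ln_mult)
  moreover have "real (m - 2) * ln 2 \<le> ln (real n / (2 * real d - 1))"
    using le pos by (subst ln_realpow[symmetric]) (auto intro!: ln_mono)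
  ultimately show ?thesis unfolding scale_penalty_def Gam_def by simp
qed

lemma exp_neg_scale_penalty: "exp (- (scale_penalty m)\<^sup>2 / 2) \<le> 4 / 2 ^ m"
proof -
  have "(scale_penalty m)\<^sup>2 = 2 + 2 * real (m - 2) * ln 2"
    unfolding scale_penalty_def by (subst real_sqrt_pow2) auto
  then have "exp (- (scale_penalty m)\<^sup>2 / 2) = exp (- 1) * exp (- (real (m - 2) * ln 2))"
    by (simp flip: exp_add)
  also have "exp (- (real (m - 2) * ln 2)) = 1 / 2 ^ (m - 2)"
    by (simp add: exp_minus exp_of_nat_mult divide_inverse)
  also have "exp (- 1 :: real) * (1 / 2 ^ (m - 2)) \<le> 1 * (1 / 2 ^ (m - 2))"
    by (intro mult_right_mono) auto
  also have "\<dots> \<le> 4 / 2 ^ m"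
  proof -
    have "(2::real) ^ m \<le> 2 ^ (m - 2 + 2)" by (intro power_increasing) auto
    then show ?thesis by (simp add: power_add field_simps)
  qed
  finally show ?thesis .
qed

lemma scale_penalty_ge: "sqrt (real (m + 1) / 2) \<le> scale_penalty m"
proof -
  have "ln 2 \<ge> (1 / 2 :: real)" using ln2_ge_two_thirds by simp
  then have "real (m - 2) * (1 / 2) \<le> real (m - 2) * ln 2" by (intro mult_left_mono) auto
  moreover have "real m - 2 \<le> real (m - 2)" by linarith
  ultimately have "real (m + 1) / 2 \<le> 2 + 2 * real (m - 2) * ln 2" by simp
  then show ?thesis unfolding scale_penalty_def by simp
qed

lemma exp_neg_le_power: "z > 0 \<Longrightarrow> exp (- z) \<le> (8 / z) ^ 8" for z :: real
proof -
  assume z: "z > 0"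
  have "(z / 8) ^ 8 \<le> (exp (z / 8)) ^ 8"
    using z exp_ge_add_one_self[of "z / 8"] by (intro power_mono) linarith+
  also have "\<dots> = exp z" by (simp flip: exp_of_nat_mult)
  finally show ?thesis using z by (simp add: exp_minus power_divide field_simps)
qed

text \<open>The left-hand side is the union bound for one block: \<open>2\<^sup>m\<^sup>+\<^sup>3 (m + 1)\<^sup>2\<close> anchors, each with two
  exceptional events of two tails. In the first term the penalty cancels the factor \<open>2\<^sup>m\<close> up to a
  constant, and what is left, at most \<open>exp (- C sqrt ((m + 1) / 2))\<close>, beats every power of
  \<open>m + 1\<close>; the second term is much smaller. So the bounds are summable over the blocks, with a sum
  that is small for large \<open>C\<close>.\<close>
lemma block_failure_bound:
  assumes "\<eta> > 0"
  obtains C :: real where "C > 0"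
    "\<And>m. 2 ^ (m + 4) * (real (m + 1))\<^sup>2 *
      (exp (- (scale_penalty m + C)\<^sup>2 / 2) + exp (- (C * real (m + 1))\<^sup>2 / 2)) \<le> \<eta> / (real (m + 1))\<^sup>2"
proof -
  (* 1024 = 2^4 * 4 * 16: the 2^4 of the union bound, the 4 of exp_neg_scale_penalty and
     (sqrt 2)^8 from the lower bound of the penalty; 16 belongs to the second term. *)
  define C where "C = max 10 ((1024 * 8 ^ 8 + 16) / \<eta>)"
  have C: "C \<ge> 10" "(1024 * 8 ^ 8 + 16) / C \<le> \<eta>"
    using assms by (auto simp: C_def field_simps max_def)
  have "2 ^ (m + 4) * (real (m + 1))\<^sup>2 *
      (exp (- (scale_penalty m + C)\<^sup>2 / 2) + exp (- (C * real (m + 1))\<^sup>2 / 2)) \<le> \<eta> / (real (m + 1))\<^sup>2" for m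
  proof -
    define x where "x = real (m + 1)"
    let ?g = "scale_penalty m"
    have x: "x \<ge> 1" by (simp add: x_def)
    have g: "sqrt (x / 2) \<le> ?g" using scale_penalty_ge[of m] by (simp add: x_def)
    have g0: "?g \<ge> 0" using g x by (smt (verit) real_sqrt_ge_zero divide_nonneg_nonneg)
    have "exp (- (?g + C)\<^sup>2 / 2) \<le> exp (- ?g\<^sup>2 / 2 + - (C * sqrt (x / 2)))"
    proof -
      have "C * sqrt (x / 2) \<le> C * ?g" using g C by (intro mult_left_mono) auto
      moreover have "(?g + C)\<^sup>2 = ?g\<^sup>2 + 2 * (C * ?g) + C\<^sup>2" by (simp add: power2_sum)
      moreover have "C\<^sup>2 \<ge> 0" by simp
      ultimately show ?thesis unfolding exp_le_cancel_iff by linarith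
    qed
    also have "\<dots> = exp (- ?g\<^sup>2 / 2) * exp (- (C * sqrt (x / 2)))" by (rule exp_add)
    also have "\<dots> \<le> 4 / 2 ^ m * (8 / (C * sqrt (x / 2))) ^ 8"
      using C x by (intro mult_mono exp_neg_scale_penalty exp_neg_le_power) auto
    also have "(8 / (C * sqrt (x / 2))) ^ 8 = 8 ^ 8 * 16 / (C ^ 8 * x ^ 4)"
    proof -
      have "sqrt (x / 2) ^ 8 = ((sqrt (x / 2))\<^sup>2) ^ 4" by (simp flip: power_mult)
      also have "\<dots> = x ^ 4 / 16" using x by (simp add: power_divide)
      finally have "sqrt (x / 2) ^ 8 = x ^ 4 / 16" .
      then show ?thesis by (simp only: power_divide[of 8] power_mult_distrib) simp
    qed
    finally have "2 ^ (m + 4) * x\<^sup>2 * exp (- (?g + C)\<^sup>2 / 2)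
        \<le> 2 ^ (m + 4) * x\<^sup>2 * (4 / 2 ^ m * (8 ^ 8 * 16 / (C ^ 8 * x ^ 4)))"
      by (intro mult_left_mono) auto
    also have "\<dots> = 1024 * 8 ^ 8 / C ^ 8 / x\<^sup>2"
      using x C by (simp add: power_add field_simps power2_eq_square power4_eq_xxxx)
    also have "\<dots> \<le> 1024 * 8 ^ 8 / C / x\<^sup>2"
      using C x power_increasing[of 1 8 C]
      by (intro divide_right_mono divide_left_mono) auto
    finally have first: "2 ^ (m + 4) * x\<^sup>2 * exp (- (?g + C)\<^sup>2 / 2) \<le> 1024 * 8 ^ 8 / C / x\<^sup>2" .
    have "exp (- (C * x)\<^sup>2 / 2) \<le> exp (- (5 * (C * x)))"
    proof -
      have "10 * (C * x) \<le> (C * x) * (C * x)"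
        using C x mult_mono[of 10 C 1 x] by (intro mult_right_mono) auto
      then show ?thesis by (simp add: power2_eq_square)
    qed
    also have "\<dots> \<le> exp (- (5 * x)) * exp (- C)"
    proof -
      have "C * 1 \<le> C * x" "10 * x \<le> C * x" "0 \<le> C * x"
        using C x by (intro mult_left_mono mult_right_mono mult_nonneg_nonneg; linarith)+
      then show ?thesis unfolding exp_add[symmetric] exp_le_cancel_iff by linarith
    qed
    also have "\<dots> \<le> 1 / (2 ^ m * x ^ 4) * (1 / C)"
    proof (intro mult_mono)
      have "2 ^ m * x ^ 4 \<le> exp (real m) * exp x ^ 4"
      proof (intro mult_mono power_mono)
        have "(2::real) ^ m \<le> exp 1 ^ m" using exp_ge_add_one_self[of "1::real"] by (intro power_mono) auto
        then show "(2::real) ^ m \<le> exp (real m)" by (simp flip: exp_of_nat_mult)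
        show "x \<le> exp x" using exp_ge_add_one_self[of x] by linarith
      qed (use x in auto)
      also have "\<dots> = exp (real m + 4 * x)" by (simp add: exp_add flip: exp_of_nat_mult)
      also have "\<dots> \<le> exp (5 * x)" by (simp add: x_def)
      finally show "exp (- (5 * x)) \<le> 1 / (2 ^ m * x ^ 4)"
        using x unfolding exp_minus inverse_eq_divide by (intro divide_left_mono) auto
      have "C \<le> exp C" using exp_ge_add_one_self[of C] by linarith
      then show "exp (- C) \<le> 1 / C" using C by (simp add: exp_minus divide_inverse le_imp_inverse_le)
    qed (use x in auto)
    finally have "2 ^ (m + 4) * x\<^sup>2 * exp (- (C * x)\<^sup>2 / 2) \<le> 2 ^ (m + 4) * x\<^sup>2 * (1 / (2 ^ m * x ^ 4) * (1 / C))"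
      by (intro mult_left_mono) auto
    also have "\<dots> = 16 / C / x\<^sup>2"
      using x C by (simp add: power_add field_simps power2_eq_square power4_eq_xxxx)
    finally have "2 ^ (m + 4) * x\<^sup>2 * (exp (- (?g + C)\<^sup>2 / 2) + exp (- (C * x)\<^sup>2 / 2))
        \<le> 1024 * 8 ^ 8 / C / x\<^sup>2 + 16 / C / x\<^sup>2"
      using first by (simp only: distrib_left)
    also have "\<dots> = (1024 * 8 ^ 8 + 16) / C / x\<^sup>2" by (simp add: add_divide_distrib)
    also have "\<dots> \<le> \<eta> / x\<^sup>2" using C by (intro divide_right_mono) auto
    finally show ?thesis by (simp only: x_def)
  qed
  then show thesis using that[of C] C by force
qed

text \<open>The anchor has the smaller scale, so its normalizing coefficient is the larger one, and the
  comparison needs an error term only for the unnormalized sums.\<close>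
lemma T_loc_near_anchor:
  assumes d: "1 \<le> d" "d \<le> e" "e \<le> d + r" and j: "j \<le> l" "l \<le> j + r"
    and w: "\<And>p q. lo \<le> p \<Longrightarrow> q \<le> hi \<Longrightarrow> \<bar>window_sum n \<sigma> p q\<bar> \<le> \<nu>"
    and rng: "lo \<le> int j - int e" "int l + int e \<le> hi"
  shows "\<bar>T_loc n e l \<sigma>\<bar> \<le> \<bar>T_loc n d j \<sigma>\<bar> + sqrt (2 / real e) * (4 * \<nu> * real r / real e)"
proof -
  have e: "1 \<le> e" using d by simp
  let ?a = "tent_sum n \<sigma> e l / real e" and ?b = "tent_sum n \<sigma> d j / real d"
  have "\<bar>?a - ?b\<bar> \<le> 4 * \<nu> * real r / real e"
    by (rule tent_sum_normalized_increment[OF w d j rng])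
  then have "\<bar>?a\<bar> \<le> \<bar>?b\<bar> + 4 * \<nu> * real r / real e" and nn: "0 \<le> 4 * \<nu> * real r / real e" by linarith+
  then have "beta_coef e * \<bar>?a\<bar> \<le> beta_coef e * (\<bar>?b\<bar> + 4 * \<nu> * real r / real e)"
    using beta_coef_pos[OF e] by (intro mult_left_mono) auto
  also have "\<dots> \<le> beta_coef d * \<bar>?b\<bar> + sqrt (2 / real e) * (4 * \<nu> * real r / real e)"
    unfolding distrib_left using beta_coef_antimono[OF d(1,2)] beta_coef_le[OF e] nn
    by (intro add_mono mult_right_mono) auto
  finally show ?thesis
    using beta_coef_pos[OF e] beta_coef_pos[OF d(1)]
    by (simp add: T_loc_eq_tent_sum[OF e] T_loc_eq_tent_sum[OF d(1)] abs_mult)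
qed

lemma window_sum_probability:
  assumes "real_of_int (hi - lo) + 1 \<le> V" "V > 0" "t \<ge> 0"
  shows "measure_pmf.prob (rademacher n)
      {\<xi>. \<exists>k\<le>n. t \<le> \<bar>\<Sum>i=1..k. (if lo \<le> int i \<and> int i \<le> hi then 1 else 0) * \<xi> i\<bar>}
    \<le> 2 * exp (- t\<^sup>2 / (2 * V))"
proof (rule rademacher_maximal_abs[OF _ assms(2,3)])
  have "(\<Sum>i=1..n. (if lo \<le> int i \<and> int i \<le> hi then 1 else 0 :: real)\<^sup>2) =
      (\<Sum>z\<in>int ` {1..n}. (if lo \<le> z \<and> z \<le> hi then 1 else 0))"
    by (subst sum.reindex) (auto intro!: sum.cong)
  also have "\<dots> = (\<Sum>z\<in>int ` {1..n} \<inter> {lo..hi}. 1)"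
    by (rule sum.mono_neutral_cong_right) auto
  also have "\<dots> \<le> (\<Sum>z\<in>{lo..hi}. 1)"
    by (rule sum_mono2) auto
  also have "\<dots> \<le> V" using assms(1,2) by (cases "lo \<le> hi") auto
  finally show "(\<Sum>i=1..n. (if lo \<le> int i \<and> int i \<le> hi then 1 else 0 :: real)\<^sup>2) \<le> V" .
qed

lemma T_loc_probability:
  assumes "d \<ge> 1" "t \<ge> 0"
  shows "measure_pmf.prob (rademacher n) {\<xi>. t \<le> \<bar>T_loc n d j \<xi>\<bar>} \<le> 2 * exp (- t\<^sup>2 / 2)"
proof -
  let ?w = "\<lambda>i. beta_coef d * psi ((real i - real j) / real d)"
  have "T_loc n d j \<xi> = (\<Sum>i=1..n. ?w i * \<xi> i)" for \<xi>
    by (simp add: T_loc_def sum_distrib_left mult.assoc)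
  then have "measure_pmf.prob (rademacher n) {\<xi>. t \<le> \<bar>T_loc n d j \<xi>\<bar>} \<le>
      measure_pmf.prob (rademacher n) {\<xi>. \<exists>k\<le>n. t \<le> \<bar>\<Sum>i=1..k. ?w i * \<xi> i\<bar>}"
    by (intro measure_pmf.finite_measure_mono) auto
  also have "\<dots> \<le> 2 * exp (- t\<^sup>2 / (2 * 1))"
    by (rule rademacher_maximal_abs[OF psi_window_energy]) (use assms in auto)
  finally show ?thesis by simp
qed

text \<open>Within the block of scale \<open>D = 2\<^sup>k\<close>, anchors form a grid of step \<open>s\<close>, about \<open>D / (m + 1)\<close>, in scale
  and location. Every \<open>(e, l)\<close> lies less than \<open>s\<close> above an anchor. If the partial sums in the
  window around the anchor are of the size \<open>(m + 1) sqrt D\<close>, the passage to the anchor costs only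
  \<open>O(1)\<close>. When \<open>D < m + 1\<close>, the step is 1 and every pair is an anchor.\<close>
lemma T_loc_block:
  fixes k m n :: nat and C \<gamma> :: real and \<sigma> :: "nat \<Rightarrow> real"
  defines "D \<equiv> 2 ^ k" and "G \<equiv> m + 1"
  defines "s \<equiv> max 1 (D div G)"
  assumes n: "n < 2 ^ (k + m + 1)" and C: "C \<ge> 0"
    and anchor: "\<And>p q. p < 2 * G \<Longrightarrow> q < 2 ^ (m + 2) * G \<Longrightarrow> \<bar>T_loc n (D + s * p) (s * q) \<sigma>\<bar> \<le> \<gamma>"
    and window: "\<And>q i. q < 2 ^ (m + 2) * G \<Longrightarrow> i \<le> n \<Longrightarrow>
      \<bar>\<Sum>i=1..i. (if int (s * q) - 2 * int D \<le> int i \<and> int i \<le> int (s * q) + 3 * int D then 1 else 0) * \<sigma> i\<bar>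
        \<le> C * real G * sqrt (6 * real D)"
    and e: "2 ^ k \<le> e" "e < 2 ^ Suc k" and l: "l \<le> n"
  shows "\<bar>T_loc n e l \<sigma>\<bar> \<le> \<gamma> + 28 * C"
proof -
  have D: "D \<ge> 1" by (simp add: D_def)
  have s: "s \<ge> 1" by (simp add: s_def)
  have G: "G \<ge> 1" by (simp add: G_def)
  have Ds: "D < 2 * (s * G)"
  proof -
    have "D < (D div G + 1) * G" using G by (metis Suc_eq_plus1 div_less_iff_less_mult lessI less_eq_Suc_le One_nat_def)
    also have "\<dots> \<le> (2 * s) * G" by (intro mult_right_mono) (auto simp: s_def)
    finally show ?thesis by simp
  qed
  have sD: "s \<le> D" using D div_le_dividend[of D G] by (simp add: s_def)
  (* The anchor of (e, l) is obtained by rounding the scale and the location down. *)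
  define p q where "p = (e - D) div s" and "q = l div s"
  have p: "s * p \<le> e - D" "e - D \<le> s * p + (s - 1)"
    using s mult_div_mod_eq[of s "e - D"] mod_less_divisor[of s "e - D"]
    unfolding p_def by linarith+
  have q: "s * q \<le> l" "l \<le> s * q + (s - 1)"
    using s mult_div_mod_eq[of s l] mod_less_divisor[of s l]
    unfolding q_def by linarith+
  have "s * p < s * (2 * G)"
  proof -
    have "s * p < D" using p(1) e unfolding D_def by simp
    also have "D < s * (2 * G)" using Ds by (simp only: mult.left_commute)
    finally show ?thesis .
  qed
  then have pG: "p < 2 * G" by (rule mult_less_cancel1[THEN iffD1, THEN conjunct2])
  have "s * q < 2 ^ (m + 1) * D" using q(1) l n by (simp add: D_def power_add mult_ac)
  also have "\<dots> \<le> 2 ^ (m + 1) * (2 * (s * G))" using Ds by (intro mult_left_mono) auto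
  finally have "s * q < s * (2 ^ (m + 2) * G)" by (simp add: mult_ac)
  then have qG: "q < 2 ^ (m + 2) * G" by simp
  define \<nu> where "\<nu> = 2 * (C * real G * sqrt (6 * real D))"
  have w: "\<bar>window_sum n \<sigma> a b\<bar> \<le> \<nu>"
    if "int (s * q) - 2 * int D \<le> a" "b \<le> int (s * q) + 3 * int D" for a b
    unfolding \<nu>_def
    by (rule window_sum_le_partial_sums[where lo = "int (s * q) - 2 * int D" and hi = "int (s * q) + 3 * int D"])
       (use window[OF qG] that in auto)
  have e1: "e \<ge> 1" "D \<le> e" "e < 2 * D" using e D by (auto simp: D_def)
  have "\<bar>T_loc n e l \<sigma>\<bar> \<le> \<bar>T_loc n (D + s * p) (s * q) \<sigma>\<bar> +
      sqrt (2 / real e) * (4 * \<nu> * real (s - 1) / real e)"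
  proof (rule T_loc_near_anchor[OF _ _ _ _ _ w])
    show "int (s * q) - 2 * int D \<le> int (s * q) - int e" using e1 by linarith
    have "l + e \<le> s * q + 3 * D" using q(2) sD s e1 by linarith
    then show "int l + int e \<le> int (s * q) + 3 * int D" by linarith
  qed (use D p q e1 in auto)
  also have "\<dots> \<le> \<gamma> + 28 * C"
  proof (intro add_mono anchor pG qG)
    have "real (s - 1) \<le> real (D div G)" by (simp add: s_def)
    also have "\<dots> \<le> real D / real G" by (rule of_nat_div_le_of_nat)
    finally have r: "real (s - 1) * real G \<le> real D" using G by (simp add: field_simps)
    have "sqrt (2 / real e) * (4 * \<nu> * real (s - 1) / real e) =
        8 * C * (sqrt (2 / real e) * sqrt (6 * real D)) * (real (s - 1) * real G / real e)"
      by (simp add: \<nu>_def field_simps)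
    also have "\<dots> \<le> 8 * C * (7 / 2) * 1"
    proof (intro mult_mono)
      have "sqrt (2 / real e) * sqrt (6 * real D) = sqrt (12 * (real D / real e))"
        by (simp flip: real_sqrt_mult)
      also have "\<dots> \<le> sqrt ((7 / 2)\<^sup>2)"
      proof (rule real_sqrt_le_mono)
        have "real D / real e \<le> 1" using e1 by simp
        then show "12 * (real D / real e) \<le> (7 / 2)\<^sup>2" by (simp add: power2_eq_square)
      qed
      finally show "sqrt (2 / real e) * sqrt (6 * real D) \<le> 7 / 2" by simp
      have "real (s - 1) * real G \<le> real e" using r e1 by linarith
      then show "real (s - 1) * real G / real e \<le> 1" using e1 by (simp add: divide_le_eq)
    qed (use C in auto)
    finally show "sqrt (2 / real e) * (4 * \<nu> * real (s - 1) / real e) \<le> 28 * C" by simp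
  qed
  finally show ?thesis .
qed

lemma T_loc_block_probability:
  fixes k m n :: nat and C :: real
  assumes n: "n < 2 ^ (k + m + 1)" and C: "C > 0"
  shows "measure_pmf.prob (rademacher n)
      {\<xi>. \<exists>e l. 2 ^ k \<le> e \<and> e < 2 ^ Suc k \<and> l \<le> n \<and> scale_penalty m + 29 * C < \<bar>T_loc n e l \<xi>\<bar>}
    \<le> 2 ^ (m + 4) * (real (m + 1))\<^sup>2 *
      (exp (- (scale_penalty m + C)\<^sup>2 / 2) + exp (- (C * real (m + 1))\<^sup>2 / 2))"
proof -
  define D G :: nat where "D = 2 ^ k" and "G = m + 1"
  define s where "s = max 1 (D div G)"
  define I where "I = {..<2 * G} \<times> {..<2 ^ (m + 2) * G}"
  define t where "t = C * real G * sqrt (6 * real D)"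
  let ?lo = "\<lambda>q. int (s * q) - 2 * int D" and ?hi = "\<lambda>q. int (s * q) + 3 * int D"
  define A where "A = (\<lambda>(p, q). {\<xi>. scale_penalty m + C \<le> \<bar>T_loc n (D + s * p) (s * q) \<xi>\<bar>})"
  define B where "B = (\<lambda>(p :: nat, q). {\<xi>. \<exists>i\<le>n.
    t \<le> \<bar>\<Sum>i=1..i. (if ?lo q \<le> int i \<and> int i \<le> ?hi q then 1 else 0) * \<xi> i\<bar>})"
  let ?P = "measure_pmf.prob (rademacher n)"
  let ?b = "2 * exp (- (scale_penalty m + C)\<^sup>2 / 2) + 2 * exp (- (C * real G)\<^sup>2 / 2)"
  have "?P {\<xi>. \<exists>e l. 2 ^ k \<le> e \<and> e < 2 ^ Suc k \<and> l \<le> n \<and> scale_penalty m + 29 * C < \<bar>T_loc n e l \<xi>\<bar>}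
      \<le> ?P (\<Union>i\<in>I. A i \<union> B i)"
  proof (rule measure_pmf.finite_measure_mono)
    show "{\<xi>. \<exists>e l. 2 ^ k \<le> e \<and> e < 2 ^ Suc k \<and> l \<le> n \<and> scale_penalty m + 29 * C < \<bar>T_loc n e l \<xi>\<bar>}
        \<subseteq> (\<Union>i\<in>I. A i \<union> B i)"
    proof (rule subsetI, rule ccontr)
      fix \<xi>
      assume "\<xi> \<in> {\<xi>. \<exists>e l. 2 ^ k \<le> e \<and> e < 2 ^ Suc k \<and> l \<le> n \<and> scale_penalty m + 29 * C < \<bar>T_loc n e l \<xi>\<bar>}"
      then obtain e l where el: "2 ^ k \<le> e" "e < 2 ^ Suc k" "l \<le> n" "scale_penalty m + 29 * C < \<bar>T_loc n e l \<xi>\<bar>"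
        by blast
      assume "\<xi> \<notin> (\<Union>i\<in>I. A i \<union> B i)"
      then have A: "\<bar>T_loc n (D + s * p) (s * q) \<xi>\<bar> \<le> scale_penalty m + C"
        and B: "\<And>i. i \<le> n \<Longrightarrow> \<bar>\<Sum>i=1..i. (if ?lo q \<le> int i \<and> int i \<le> ?hi q then 1 else 0) * \<xi> i\<bar> \<le> t"
        if "p < 2 * G" "q < 2 ^ (m + 2) * G" for p q
        using that by (fastforce simp: I_def A_def B_def)+
      have G: "0 < 2 * G" by (simp add: G_def)
      have "\<bar>T_loc n e l \<xi>\<bar> \<le> (scale_penalty m + C) + 28 * C"
        by (rule T_loc_block[of n k m C \<xi> "scale_penalty m + C" e l, folded D_def G_def, folded s_def, folded t_def,
              OF n less_imp_le[OF C] A B[OF G]])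
           (use el in \<open>simp_all add: D_def\<close>)
      then show False using el(4) by simp
    qed
  qed simp
  also have "\<dots> \<le> (\<Sum>i\<in>I. ?P (A i \<union> B i))"
    by (rule measure_pmf.finite_measure_subadditive_finite) (auto simp: I_def)
  also have "\<dots> \<le> (\<Sum>i\<in>I. ?b)"
  proof (rule sum_mono)
    fix i assume "i \<in> I"
    obtain p q where i: "i = (p, q)" by force
    have D: "D \<ge> 1" by (simp add: D_def)
    have "scale_penalty m \<ge> 0" by (simp add: scale_penalty_def)
    then have "?P (A i) \<le> 2 * exp (- (scale_penalty m + C)\<^sup>2 / 2)"
      unfolding i A_def prod.case using C D by (intro T_loc_probability) auto
    moreover have "?P (B i) \<le> 2 * exp (- (C * real G)\<^sup>2 / 2)"
    proof -
      have "- t\<^sup>2 / (2 * (6 * real D)) = - (C * real G)\<^sup>2 / 2"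
        using D by (simp add: t_def power_mult_distrib)
      moreover have "?P (B i) \<le> 2 * exp (- t\<^sup>2 / (2 * (6 * real D)))"
        unfolding i B_def prod.case using C D by (intro window_sum_probability) (auto simp: t_def)
      ultimately show ?thesis by (simp only:)
    qed
    ultimately show "?P (A i \<union> B i) \<le> ?b"
      using measure_subadditive[of "A i" "measure_pmf (rademacher n)" "B i"] by simp
  qed
  also have "\<dots> = real (2 * G * (2 ^ (m + 2) * G)) * ?b" by (simp add: I_def)
  also have "\<dots> = 2 ^ (m + 4) * (real G)\<^sup>2 *
      (exp (- (scale_penalty m + C)\<^sup>2 / 2) + exp (- (C * real G)\<^sup>2 / 2))"
    by (simp add: power_add power2_eq_square algebra_simps)
  finally show ?thesis by (simp only: G_def)
qed

lemma sum_inverse_squares_le: "(\<Sum>m\<le>n. 1 / (real (m + 1))\<^sup>2) \<le> 2 - 1 / real (n + 1)"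
proof (induction n)
  case (Suc n)
  have "1 / (real (Suc n + 1))\<^sup>2 \<le> 1 / real (n + 1) - 1 / real (Suc n + 1)"
  proof -
    have "1 / (real (Suc n + 1))\<^sup>2 \<le> 1 / (real (n + 1) * real (Suc n + 1))"
      unfolding power2_eq_square by (intro divide_left_mono mult_right_mono) auto
    also have "\<dots> = 1 / real (n + 1) - 1 / real (Suc n + 1)"
      by (simp add: field_simps)
    finally show ?thesis .
  qed
  then show ?case using Suc by simp
qed simp

text \<open>The bounds for the dyadic blocks are summed; the block of scale \<open>2\<^sup>k\<close> has index \<open>m = K - k\<close>, where
  \<open>2\<^sup>K \<le> n < 2\<^sup>K\<^sup>+\<^sup>1\<close>.\<close>
lemma multiscale_statistic_tight:
  assumes "\<eta> > 0"
  obtains B :: real where "\<And>n. n \<ge> 1 \<Longrightarrow> measure_pmf.prob (rademacher n)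
      {\<xi>. \<exists>e\<in>{1..(n + 1) div 2}. \<exists>l\<le>n. B + Gam ((2 * real e - 1) / real n) < \<bar>T_loc n e l \<xi>\<bar>} \<le> \<eta>"
proof -
  obtain C :: real where C: "C > 0"
    "\<And>m. 2 ^ (m + 4) * (real (m + 1))\<^sup>2 *
      (exp (- (scale_penalty m + C)\<^sup>2 / 2) + exp (- (C * real (m + 1))\<^sup>2 / 2)) \<le> (\<eta> / 2) / (real (m + 1))\<^sup>2"
    using block_failure_bound[of "\<eta> / 2"] assms by auto
  have "measure_pmf.prob (rademacher n)
      {\<xi>. \<exists>e\<in>{1..(n + 1) div 2}. \<exists>l\<le>n. 29 * C + Gam ((2 * real e - 1) / real n) < \<bar>T_loc n e l \<xi>\<bar>} \<le> \<eta>"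
    if n: "n \<ge> 1" for n
  proof -
    let ?P = "measure_pmf.prob (rademacher n)"
    obtain K where K: "2 ^ K \<le> n" "n < 2 ^ Suc K"
      using ex_power_ivl1[of 2 n] n by auto
    define S where "S k = {\<xi>. \<exists>e l. 2 ^ k \<le> e \<and> e < 2 ^ Suc k \<and> l \<le> n \<and>
      scale_penalty (K - k) + 29 * C < \<bar>T_loc n e l \<xi>\<bar>}" for k
    have "?P {\<xi>. \<exists>e\<in>{1..(n + 1) div 2}. \<exists>l\<le>n. 29 * C + Gam ((2 * real e - 1) / real n) < \<bar>T_loc n e l \<xi>\<bar>}
        \<le> ?P (\<Union>k\<in>{..K}. S k)"
    proof (rule measure_pmf.finite_measure_mono)
      show "{\<xi>. \<exists>e\<in>{1..(n + 1) div 2}. \<exists>l\<le>n. 29 * C + Gam ((2 * real e - 1) / real n) < \<bar>T_loc n e l \<xi>\<bar>}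
          \<subseteq> (\<Union>k\<in>{..K}. S k)"
      proof
        fix \<xi> assume "\<xi> \<in> {\<xi>. \<exists>e\<in>{1..(n + 1) div 2}. \<exists>l\<le>n.
            29 * C + Gam ((2 * real e - 1) / real n) < \<bar>T_loc n e l \<xi>\<bar>}"
        then obtain e l where e: "1 \<le> e" "e \<le> (n + 1) div 2" "l \<le> n"
          "29 * C + Gam ((2 * real e - 1) / real n) < \<bar>T_loc n e l \<xi>\<bar>" by auto
        obtain k where k: "2 ^ k \<le> e" "e < 2 ^ Suc k" using ex_power_ivl1[of 2 e] e by auto
        have "2 * e \<le> n + 1" using e(2) by linarith
        then have "e < 2 ^ Suc K" using K n by linarith
        then have "(2::nat) ^ k < 2 ^ Suc K" using k by linarith
        then have kK: "k \<le> K" by (simp add: power_strict_increasing_iff less_Suc_eq_le del: power_Suc)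
        have "scale_penalty (K - k) \<le> Gam ((2 * real e - 1) / real n)"
          using K kK \<open>2 * e \<le> n + 1\<close> e k by (intro scale_penalty_le_Gam[where k = k]) auto
        then have "scale_penalty (K - k) + 29 * C < \<bar>T_loc n e l \<xi>\<bar>" using e by linarith
        then show "\<xi> \<in> (\<Union>k\<in>{..K}. S k)" using k kK e by (auto simp: S_def)
      qed
    qed simp
    also have "\<dots> \<le> (\<Sum>k\<in>{..K}. ?P (S k))"
      by (rule measure_pmf.finite_measure_subadditive_finite) auto
    also have "\<dots> \<le> (\<Sum>k\<in>{..K}. (\<eta> / 2) / (real (K - k + 1))\<^sup>2)"
    proof (rule sum_mono)
      fix k assume "k \<in> {..K}"
      then have "n < 2 ^ (k + (K - k) + 1)" using K by simp
      from T_loc_block_probability[OF this C(1)]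
      show "?P (S k) \<le> (\<eta> / 2) / (real (K - k + 1))\<^sup>2"
        unfolding S_def using C(2)[of "K - k"] by linarith
    qed
    also have "\<dots> = (\<Sum>m\<in>{..K}. (\<eta> / 2) / (real (m + 1))\<^sup>2)"
      by (rule sum.reindex_bij_witness[of _ "\<lambda>m. K - m" "\<lambda>k. K - k"]) auto
    also have "\<dots> = \<eta> / 2 * (\<Sum>m\<le>K. 1 / (real (m + 1))\<^sup>2)"
      by (simp add: sum_distrib_left)
    also have "\<dots> \<le> \<eta> / 2 * 2"
    proof (intro mult_left_mono)
      show "(\<Sum>m\<le>K. 1 / (real (m + 1))\<^sup>2) \<le> 2"
        using sum_inverse_squares_le[of K] by (smt (verit) zero_le_divide_1_iff of_nat_0_le_iff)
    qed (use assms in auto)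
    finally show ?thesis by simp
  qed
  then show thesis by (rule that)
qed

section \<open>Critical values are bounded\<close>

text \<open>With finite support, the least \<open>q\<close> of sufficient probability is attained at a support point; it
  is also a quantile in the two-sided sense, because no smaller support point has enough
  probability.\<close>
lemma least_quantile_le:
  assumes fin: "finite (set_pmf p)" and \<gamma>: "0 < \<gamma>"
    and B: "\<gamma> \<le> measure_pmf.prob p {\<xi>. X \<xi> \<le> B}"
  shows "(LEAST q. is_quantile p X \<gamma> q) \<le> B"
proof -
  define V where "V = X ` set_pmf p"
  define F where "F q = measure_pmf.prob p {\<xi>. X \<xi> \<le> q}" for q
  define S where "S = {v \<in> V. \<gamma> \<le> F v}"
  have finV: "finite V" using fin by (simp add: V_def)
  \<comment> \<open>A down-closed event of large probability contains a support point in \<open>S\<close>.\<close>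
  have attained: "\<exists>v\<in>S. P v" if P: "\<And>u v. P v \<Longrightarrow> u \<le> v \<Longrightarrow> P u"
    "\<gamma> \<le> measure_pmf.prob p {\<xi>. P (X \<xi>)}" for P
  proof -
    let ?W = "{v \<in> V. P v}"
    have W: "finite ?W" using finV by simp
    have "?W \<noteq> {}"
    proof
      assume "?W = {}"
      then have "{\<xi>. P (X \<xi>)} \<inter> set_pmf p = {}" by (auto simp: V_def)
      then have "measure_pmf.prob p {\<xi>. P (X \<xi>)} = 0" by (metis measure_Int_set_pmf measure_empty)
      then show False using P(2) \<gamma> by simp
    qed
    then have M: "Max ?W \<in> ?W" by (rule Max_in[OF W])
    have "{\<xi>. P (X \<xi>)} \<inter> set_pmf p \<subseteq> {\<xi>. X \<xi> \<le> Max ?W}"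
      using W by (auto simp: V_def)
    then have "measure_pmf.prob p ({\<xi>. P (X \<xi>)} \<inter> set_pmf p) \<le> F (Max ?W)"
      unfolding F_def by (intro measure_pmf.finite_measure_mono) auto
    then have "\<gamma> \<le> F (Max ?W)" using P(2) by (simp add: measure_Int_set_pmf)
    then show ?thesis using M by (auto simp: S_def)
  qed
  have finS: "finite S" using finV by (simp add: S_def)
  have neS: "S \<noteq> {}" using attained[of "\<lambda>v. v \<le> B"] B by auto
  let ?q = "Min S"
  have q: "?q \<in> S" by (rule Min_in[OF finS neS])
  have low: "?q \<le> q" if large: "\<gamma> \<le> measure_pmf.prob p {\<xi>. X \<xi> \<le> q}" for q
  proof -
    obtain v where "v \<in> S" "v \<le> q" using attained[of "\<lambda>v. v \<le> q"] large by auto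
    then show ?thesis using Min_le[OF finS] by force
  qed
  have "measure_pmf.prob p {\<xi>. X \<xi> < ?q} < \<gamma>"
  proof (rule ccontr)
    assume "\<not> ?thesis"
    then obtain v where "v \<in> S" "v < ?q" using attained[of "\<lambda>v. v < ?q"] by auto
    then show False using Min_le[OF finS, of v] by simp
  qed
  moreover have "measure_pmf.prob p {\<xi>. X \<xi> \<ge> ?q} = 1 - measure_pmf.prob p {\<xi>. X \<xi> < ?q}"
    by (subst measure_pmf.prob_compl[symmetric]) (auto intro!: arg_cong[where f = "measure_pmf.prob p"])
  ultimately have "is_quantile p X \<gamma> ?q" using q by (auto simp: is_quantile_def S_def F_def)
  then have "(LEAST q. is_quantile p X \<gamma> q) = ?q"
    by (rule Least_equality) (auto simp: is_quantile_def intro: low)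
  then show ?thesis using low[OF B] by simp
qed

lemma T_loc_le_T_o:
  assumes "d \<in> {1..(n + 1) div 2}" "j \<in> {1..n}"
  shows "T_loc n d j \<sigma> - Gam ((2 * real d - 1) / real n) \<le> T_o n \<sigma>"
proof -
  have "T_loc n d j \<sigma> \<le> Max ((\<lambda>j. T_loc n d j \<sigma>) ` {1..n})"
    using assms(2) by (intro Max_ge) auto
  then have "T_loc n d j \<sigma> - Gam ((2 * real d - 1) / real n) \<le>
      Max ((\<lambda>j. T_loc n d j \<sigma>) ` {1..n}) - Gam ((2 * real d - 1) / real n)" by simp
  also have "\<dots> \<le> T_o n \<sigma>"
    unfolding T_o_def by (rule Max_ge) (use assms(1) in auto)
  finally show ?thesis .
qed

lemma T_o_le:
  assumes "n \<ge> 1"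
    and "\<And>d j. d \<in> {1..(n + 1) div 2} \<Longrightarrow> j \<in> {1..n} \<Longrightarrow>
      T_loc n d j \<sigma> \<le> B + Gam ((2 * real d - 1) / real n)"
  shows "T_o n \<sigma> \<le> B"
proof -
  have "Max ((\<lambda>j. T_loc n d j \<sigma>) ` {1..n}) \<le> B + Gam ((2 * real d - 1) / real n)"
    if "d \<in> {1..(n + 1) div 2}" for d
    using assms(1) assms(2)[OF that] by (subst Max_le_iff) auto
  then show ?thesis
    unfolding T_o_def using assms(1) by (subst Max_le_iff) (auto simp: algebra_simps)
qed

lemma T_loc_cong: "(\<And>i. i \<in> {1..n} \<Longrightarrow> \<sigma> i = \<tau> i) \<Longrightarrow> T_loc n d j \<sigma> = T_loc n d j \<tau>"
  unfolding T_loc_def by (auto intro!: sum.cong)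

lemma T_loc_mono:
  assumes "d \<ge> 1" "\<And>i. i \<in> {1..n} \<Longrightarrow> \<bar>int i - int j\<bar> < int d \<Longrightarrow> \<sigma> i \<le> \<tau> i"
  shows "T_loc n d j \<sigma> \<le> T_loc n d j \<tau>"
  unfolding T_loc_def
proof (rule mult_left_mono[OF sum_mono])
  fix i assume i: "i \<in> {1..n}"
  show "psi ((real i - real j) / real d) * \<sigma> i \<le> psi ((real i - real j) / real d) * \<tau> i"
  proof (cases "\<bar>int i - int j\<bar> < int d")
    case True
    then show ?thesis using assms(2)[OF i] by (intro mult_left_mono psi_nonneg) auto
  next
    case False
    then have "psi ((real i - real j) / real d) = 0" using assms(1) by (intro psi_eq_0) (auto simp: field_simps)
    then show ?thesis by simp
  qed
qed (use beta_coef_pos[OF assms(1)] in auto)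

text \<open>Since the local statistics are odd in the signs, a bound on their absolute values controls both
  terms of \<^const>\<open>T_stat\<close>.\<close>
lemma kappa_bounded:
  assumes "0 < \<alpha>" "\<alpha> < 1"
  obtains B where "\<And>n. n \<ge> 1 \<Longrightarrow> kappa n \<alpha> \<le> B"
proof -
  obtain B where B: "\<And>n. n \<ge> 1 \<Longrightarrow> measure_pmf.prob (rademacher n)
      {\<xi>. \<exists>e\<in>{1..(n + 1) div 2}. \<exists>l\<le>n. B + Gam ((2 * real e - 1) / real n) < \<bar>T_loc n e l \<xi>\<bar>} \<le> \<alpha>"
    using multiscale_statistic_tight[OF assms(1)] by blast
  have "kappa n \<alpha> \<le> B" if n: "n \<ge> 1" for n
  proof -
    let ?T = "\<lambda>\<xi>. T_stat n (\<lambda>i. ereal (\<xi> i))"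
    let ?bad = "{\<xi>. \<exists>e\<in>{1..(n + 1) div 2}. \<exists>l\<le>n. B + Gam ((2 * real e - 1) / real n) < \<bar>T_loc n e l \<xi>\<bar>}"
    have ne: "PiE {1..n} (\<lambda>_. {- 1, 1 :: real}) \<noteq> {}" "finite (PiE {1..n} (\<lambda>_. {- 1, 1 :: real}))"
      by (auto simp: PiE_eq_empty_iff intro!: finite_PiE)
    then have set: "set_pmf (rademacher n) = PiE {1..n} (\<lambda>_. {- 1, 1 :: real})"
      unfolding rademacher_def by (rule set_pmf_of_set)
    have "?T \<xi> \<le> B" if \<xi>: "\<xi> \<in> set_pmf (rademacher n)" "\<xi> \<notin> ?bad" for \<xi>
    proof -
      have val: "\<xi> i = - 1 \<or> \<xi> i = 1" if "i \<in> {1..n}" for i using \<xi>(1) that unfolding set by auto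
      have s: "usign (ereal (\<xi> i)) = \<xi> i" "usign (- ereal (\<xi> i)) = - \<xi> i" if "i \<in> {1..n}" for i
        using val[OF that] by (auto simp: usign_def)
      have neg: "T_loc n d j (\<lambda>i. - \<xi> i) = - T_loc n d j \<xi>" for d j
        by (simp add: T_loc_def sum_negf)
      have b: "\<bar>T_loc n d j \<xi>\<bar> \<le> B + Gam ((2 * real d - 1) / real n)"
        if "d \<in> {1..(n + 1) div 2}" "j \<in> {1..n}" for d j
        using \<xi>(2) that by force
      have "T_loc n d j (\<lambda>i. usign (ereal (\<xi> i))) = T_loc n d j \<xi>" for d j
        by (rule T_loc_cong) (rule s)
      moreover have "T_loc n d j (\<lambda>i. usign (- ereal (\<xi> i))) = T_loc n d j (\<lambda>i. - \<xi> i)" for d j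
        by (rule T_loc_cong) (rule s)
      ultimately show ?thesis
        unfolding T_stat_def using n b neg by (intro max.boundedI T_o_le) (auto simp: abs_le_iff)
    qed
    then have "set_pmf (rademacher n) - {\<xi>. ?T \<xi> \<le> B} \<subseteq> ?bad" by blast
    then have "set_pmf (rademacher n) \<inter> - {\<xi>. ?T \<xi> \<le> B} \<subseteq> ?bad" by blast
    then have "measure_pmf.prob (rademacher n) (- {\<xi>. ?T \<xi> \<le> B} \<inter> set_pmf (rademacher n)) \<le> \<alpha>"
      using B[OF n] measure_pmf.finite_measure_mono[of "- {\<xi>. ?T \<xi> \<le> B} \<inter> set_pmf (rademacher n)" ?bad "rademacher n"]
      by (simp add: Int_commute)
    then have "1 - \<alpha> \<le> measure_pmf.prob (rademacher n) {\<xi>. ?T \<xi> \<le> B}"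
      using measure_pmf.prob_compl[of "{\<xi>. ?T \<xi> \<le> B}" "rademacher n"]
      by (simp add: measure_Int_set_pmf Compl_eq_Diff_UNIV)
    then show ?thesis
      unfolding kappa_def using assms ne set by (intro least_quantile_le) auto
  qed
  then show thesis by (rule that)
qed

section \<open>Convex candidates and local rejections\<close>

lemma convex_funD:
  assumes "convex_fun g" "g s \<le> ereal A" "g t \<le> ereal B" "0 \<le> \<theta>" "\<theta> \<le> 1"
  shows "g ((1 - \<theta>) * s + \<theta> * t) \<le> ereal ((1 - \<theta>) * A + \<theta> * B)"
proof -
  have "(1 - \<theta>) *\<^sub>R (s, A) + \<theta> *\<^sub>R (t, B) \<in> {(u, y). g u \<le> ereal y}"
    using assms unfolding convex_fun_def by (intro convexD) auto
  then show ?thesis by simp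
qed

text \<open>Since only signs at design points in \<open>A\<close> enter, such a rejection passes on to every candidate that
  compares suitably with the median curve on \<open>A\<close>, whatever it does elsewhere.\<close>
definition rejects_on :: "nat \<Rightarrow> real \<Rightarrow> (nat \<Rightarrow> real) \<Rightarrow> real set \<Rightarrow> (nat \<Rightarrow> real) \<Rightarrow> bool" where
  "rejects_on n c x A \<sigma> \<longleftrightarrow> (\<exists>d\<in>{1..(n + 1) div 2}. \<exists>j\<in>{1..n}.
     (\<forall>i\<in>{1..n}. \<bar>int i - int j\<bar> < int d \<longrightarrow> x i \<in> A) \<and>
     c + Gam ((2 * real d - 1) / real n) < T_loc n d j \<sigma>)"

lemma rejects_on_imp_T_o_gt:
  assumes "rejects_on n c x A \<sigma>" "\<And>i. i \<in> {1..n} \<Longrightarrow> x i \<in> A \<Longrightarrow> \<sigma> i \<le> \<tau> i"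
  shows "c < T_o n \<tau>"
proof -
  obtain d j where dj: "d \<in> {1..(n + 1) div 2}" "j \<in> {1..n}"
    "\<forall>i\<in>{1..n}. \<bar>int i - int j\<bar> < int d \<longrightarrow> x i \<in> A"
    "c + Gam ((2 * real d - 1) / real n) < T_loc n d j \<sigma>"
    using assms(1) unfolding rejects_on_def by blast
  have "T_loc n d j \<sigma> \<le> T_loc n d j \<tau>" by (rule T_loc_mono) (use dj assms(2) in auto)
  then show ?thesis using T_loc_le_T_o[OF dj(1,2), of \<tau>] dj(4) by linarith
qed

lemma usign_mono: "u \<le> v \<Longrightarrow> usign u \<le> usign v"
  by (auto simp: usign_def)

text \<open>The band is tested only on the cells of a grid of mesh \<open>h\<close>. Every interval of length \<open>2 h\<close>
  contains a cell, so finitely many local statistics, fixed in advance, serve for all candidate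
  functions at once.\<close>
definition cell :: "real \<Rightarrow> real \<Rightarrow> nat \<Rightarrow> real set" where
  "cell a h k = {a + real k * h..a + (real k + 1) * h}"

lemma interval_contains_cell:
  assumes "h > 0" "a \<le> s" "s + 2 * h \<le> b"
  obtains k where "(real k + 1) * h \<le> b - a" "cell a h k \<subseteq> {s..s + 2 * h}"
proof -
  define k where "k = nat \<lceil>(s - a) / h\<rceil>"
  have "0 \<le> (s - a) / h" using assms by simp
  then have k: "(s - a) / h \<le> real k" "real k < (s - a) / h + 1"
    unfolding k_def by linarith+
  then have "s - a \<le> real k * h" "real k * h < s - a + h"
    using assms(1) by (simp_all add: field_simps)
  then show thesis
    using assms by (intro that[of k]) (auto simp: cell_def distrib_right)
qed

text \<open>A one-sided form of being affine at scale \<open>\<delta>\<close> that covers both kinds of median curves: \<open>E = 0\<close>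
  for affine curves, and \<open>E = L \<delta>\<^sup>\<beta>\<close> for curves that are smooth of order \<open>\<beta>\<close>.\<close>
definition affine_up_to :: "real \<Rightarrow> real \<Rightarrow> real \<Rightarrow> real \<Rightarrow> (real \<Rightarrow> real) \<Rightarrow> bool" where
  "affine_up_to a b \<delta> E \<phi> \<longleftrightarrow>
     (\<exists>m. \<forall>u\<in>{a..b}. \<forall>t\<in>{a..b}. \<bar>t - u\<bar> \<le> \<delta> \<longrightarrow> \<phi> t \<le> \<phi> u + m u * (t - u) + E)"

text \<open>If \<open>g\<close> were too large at \<open>u\<close>, it could not come below \<open>\<phi> + \<epsilon>\<close> on both sides of \<open>u\<close> within
  distance \<open>\<delta>\<close>: between two such points convexity keeps \<open>g\<close> below the affine
  approximation of \<open>\<phi>\<close> at \<open>u\<close>, raised by \<open>E + \<epsilon>\<close>. So \<open>g\<close> exceeds \<open>\<phi> + \<epsilon>\<close> on a whole interval of length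
  \<open>\<delta>\<close>, hence on a cell, and the local test there rejects \<open>g\<close>.\<close>
lemma upper_candidate_le:
  assumes f: "\<And>u. u \<in> {a..b} \<Longrightarrow> f u = ereal (\<phi> u)" and aff: "affine_up_to a b \<delta> E \<phi>"
    and h: "h > 0" "2 * h \<le> \<delta>"
    and rej: "\<And>k. (real k + 1) * h \<le> b - a \<Longrightarrow>
      rejects_on n c x (cell a h k) (\<lambda>i. usign (f (x i) + ereal \<epsilon> - ereal (y i)))"
    and g: "convex_fun g" "T_o n (\<lambda>i. usign (g (x i) - ereal (y i))) \<le> c"
    and u: "u \<in> {a + \<delta>..b - \<delta>}"
  shows "g u \<le> ereal (\<phi> u + E + \<epsilon>)"
proof (rule ccontr)
  assume big: "\<not> ?thesis"
  obtain m where m: "\<And>u t. u \<in> {a..b} \<Longrightarrow> t \<in> {a..b} \<Longrightarrow> \<bar>t - u\<bar> \<le> \<delta> \<Longrightarrow> \<phi> t \<le> \<phi> u + m u * (t - u) + E"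
    using aff unfolding affine_up_to_def by blast
  let ?c = "\<phi> u + E + \<epsilon>"
  have sub: "{u - \<delta>..u + \<delta>} \<subseteq> {a..b}" using u by auto
  have \<delta>: "\<delta> > 0" using h by simp
  have uab: "u \<in> {a..b}" using sub \<delta> by auto
  have above_on_cell: False
    if s: "a \<le> s" "s + 2 * h \<le> b" "\<And>t. t \<in> {s..s + 2 * h} \<Longrightarrow> ereal (\<phi> t + \<epsilon>) < g t" for s
  proof -
    obtain k where k: "(real k + 1) * h \<le> b - a" "cell a h k \<subseteq> {s..s + 2 * h}"
      using interval_contains_cell[OF h(1) s(1,2)] by blast
    have "c < T_o n (\<lambda>i. usign (g (x i) - ereal (y i)))"
    proof (rule rejects_on_imp_T_o_gt[OF rej[OF k(1)]])
      fix i assume "x i \<in> cell a h k"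
      then have xi: "x i \<in> {s..s + 2 * h}" using k by blast
      then have "f (x i) = ereal (\<phi> (x i))" using s by (intro f) auto
      then have "f (x i) + ereal \<epsilon> \<le> g (x i)" using s(3)[OF xi] by simp
      then show "usign (f (x i) + ereal \<epsilon> - ereal (y i)) \<le> usign (g (x i) - ereal (y i))"
        by (intro usign_mono ereal_minus_mono) auto
    qed
    then show False using g(2) by simp
  qed
  obtain s where s: "s \<in> {u - \<delta>..u}" "g s \<le> ereal (\<phi> s + \<epsilon>)"
    using above_on_cell[of "u - \<delta>"] h sub \<delta> by (force simp: not_less[symmetric])
  obtain t where t: "t \<in> {u..u + \<delta>}" "g t \<le> ereal (\<phi> t + \<epsilon>)"
    using above_on_cell[of u] h sub \<delta> by (force simp: not_less[symmetric])
  have "\<phi> s \<le> \<phi> u + m u * (s - u) + E" using s sub by (intro m uab) auto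
  then have gs: "g s \<le> ereal (?c + m u * (s - u))" using s(2) by (intro order_trans[OF s(2)]) auto
  have "\<phi> t \<le> \<phi> u + m u * (t - u) + E" using t sub by (intro m uab) auto
  then have gt: "g t \<le> ereal (?c + m u * (t - u))" using t(2) by (intro order_trans[OF t(2)]) auto
  show False
  proof (cases "s = t")
    case True
    then have "s = u" using s t by auto
    then show False using gs big by simp
  next
    case False
    define \<theta> where "\<theta> = (u - s) / (t - s)"
    have ts: "t - s > 0" using False s t by auto
    have \<theta>: "0 \<le> \<theta>" "\<theta> \<le> 1" using s t ts by (auto simp: \<theta>_def divide_le_eq)
    have th: "\<theta> * (t - s) = u - s" using ts by (simp add: \<theta>_def)
    then have mid: "(1 - \<theta>) * s + \<theta> * t = u" by (simp add: algebra_simps)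
    have "(1 - \<theta>) * (?c + m u * (s - u)) + \<theta> * (?c + m u * (t - u)) =
        ?c + m u * (((1 - \<theta>) * s + \<theta> * t) - u)" by (simp add: algebra_simps)
    then show False using convex_funD[OF g(1) gs gt \<theta>] big unfolding mid by simp
  qed
qed

text \<open>If \<open>g\<close> were too small at \<open>u\<close>, the upper bound at a point \<open>v\<close> at distance \<open>\<delta>\<close> and convexity
  would push \<open>g\<close> below \<open>\<phi> - \<epsilon>\<close> on the half of the segment that is closer to \<open>u\<close>, hence on a
  cell. The point \<open>v\<close> may be taken towards the middle of the interval, so \<open>u\<close> itself can be an endpoint.\<close>
lemma lower_candidate_ge:
  assumes f: "\<And>u. u \<in> {a..b} \<Longrightarrow> f u = ereal (\<phi> u)" and aff: "affine_up_to a b \<delta> E \<phi>"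
    and h: "h > 0" "4 * h \<le> \<delta>" and \<delta>: "4 * \<delta> \<le> b - a" and \<epsilon>: "\<epsilon> \<ge> 0"
    and rej: "\<And>k. (real k + 1) * h \<le> b - a \<Longrightarrow>
      rejects_on n c x (cell a h k) (\<lambda>i. usign (ereal (y i) - (f (x i) - ereal \<epsilon>)))"
    and g: "convex_fun g" "T_o n (\<lambda>i. usign (ereal (y i) - g (x i))) \<le> c"
    and upper: "\<And>u. u \<in> {a + \<delta>..b - \<delta>} \<Longrightarrow> g u \<le> ereal (\<phi> u + E + \<epsilon>)"
    and u: "u \<in> {a..b}"
  shows "ereal (\<phi> u - 3 * (E + \<epsilon>)) \<le> g u"
proof (rule ccontr)
  assume small: "\<not> ?thesis"
  obtain m where m: "\<And>u t. u \<in> {a..b} \<Longrightarrow> t \<in> {a..b} \<Longrightarrow> \<bar>t - u\<bar> \<le> \<delta> \<Longrightarrow> \<phi> t \<le> \<phi> u + m u * (t - u) + E"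
    using aff unfolding affine_up_to_def by blast
  have \<delta>0: "\<delta> > 0" using h by simp
  have E: "E \<ge> 0" using m[OF u u] \<delta>0 by simp
  \<comment> \<open>A point at distance \<open>\<delta>\<close> towards the middle, where the upper band controls \<open>g\<close>.\<close>
  obtain v where v: "v \<in> {a + \<delta>..b - \<delta>}" "\<bar>v - u\<bar> = \<delta>"
  proof (cases "u \<le> (a + b) / 2")
    case True
    then show ?thesis using that[of "u + \<delta>"] u \<delta> \<delta>0 by auto
  next
    case False
    then show ?thesis using that[of "u - \<delta>"] u \<delta> \<delta>0 by auto
  qed
  have below: "g t \<le> ereal (\<phi> t - \<epsilon>)" if t: "t = u + \<theta> * (v - u)" "0 \<le> \<theta>" "\<theta> \<le> 1 / 2" for t \<theta>
  proof -
    have tuv: "t = (1 - \<theta>) * u + \<theta> * v" using t by (simp add: algebra_simps)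
    have tab: "t \<in> {a..b}"
    proof -
      have "t \<in> closed_segment u v" unfolding closed_segment_def
        using t tuv by (intro CollectI exI[of _ \<theta>]) auto
      also have "closed_segment u v \<subseteq> {a..b}"
        using u v \<delta>0 by (intro closed_segment_subset) auto
      finally show ?thesis .
    qed
    have d1: "\<bar>u - t\<bar> \<le> \<delta>"
      using t v(2) mult_right_mono[of \<theta> 1 \<delta>] \<delta>0 by (simp add: abs_mult)
    have "v - t = (1 - \<theta>) * (v - u)" using t by (simp add: algebra_simps)
    then have d2: "\<bar>v - t\<bar> \<le> \<delta>"
      using t v(2) mult_right_mono[of "1 - \<theta>" 1 \<delta>] \<delta>0 by (simp add: abs_mult)
    have fu: "\<phi> u \<le> \<phi> t + m t * (u - t) + E" by (rule m[OF tab u d1])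
    have fv: "\<phi> v \<le> \<phi> t + m t * (v - t) + E" using v \<delta>0 by (intro m tab d2) auto
    have gu: "g u \<le> ereal (\<phi> t + m t * (u - t) + E - 3 * (E + \<epsilon>))"
    proof -
      have "g u \<le> ereal (\<phi> u - 3 * (E + \<epsilon>))" using small by simp
      also have "\<dots> \<le> ereal (\<phi> t + m t * (u - t) + E - 3 * (E + \<epsilon>))" using fu by simp
      finally show ?thesis .
    qed
    have gv: "g v \<le> ereal (\<phi> t + m t * (v - t) + E + (E + \<epsilon>))"
    proof -
      have "g v \<le> ereal (\<phi> v + E + \<epsilon>)" by (rule upper[OF v(1)])
      also have "\<dots> \<le> ereal (\<phi> t + m t * (v - t) + E + (E + \<epsilon>))" using fv by simp
      finally show ?thesis .
    qed
    have "(1 - \<theta>) * (\<phi> t + m t * (u - t) + E - 3 * (E + \<epsilon>)) + \<theta> * (\<phi> t + m t * (v - t) + E + (E + \<epsilon>))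
        = \<phi> t + E + m t * (((1 - \<theta>) * u + \<theta> * v) - t) - (3 - 4 * \<theta>) * (E + \<epsilon>)"
      by (simp add: algebra_simps)
    also have "\<dots> = \<phi> t + E - (3 - 4 * \<theta>) * (E + \<epsilon>)" using tuv by simp
    also have "\<dots> \<le> \<phi> t - \<epsilon>"
      using mult_right_mono[of 1 "3 - 4 * \<theta>" "E + \<epsilon>"] t E \<epsilon> by simp
    finally have "ereal ((1 - \<theta>) * (\<phi> t + m t * (u - t) + E - 3 * (E + \<epsilon>)) +
        \<theta> * (\<phi> t + m t * (v - t) + E + (E + \<epsilon>))) \<le> ereal (\<phi> t - \<epsilon>)"
      by (rule ereal_less_eq(3)[THEN iffD2])
    moreover have "g t \<le> ereal ((1 - \<theta>) * (\<phi> t + m t * (u - t) + E - 3 * (E + \<epsilon>)) +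
        \<theta> * (\<phi> t + m t * (v - t) + E + (E + \<epsilon>)))"
      unfolding tuv using t by (intro convex_funD[OF g(1) gu[unfolded tuv] gv[unfolded tuv]]) auto
    ultimately show ?thesis by (rule order_trans[rotated])
  qed
  obtain s where s: "a \<le> s" "s + 2 * h \<le> b" "\<And>t. t \<in> {s..s + 2 * h} \<Longrightarrow> \<exists>\<theta>. t = u + \<theta> * (v - u) \<and> 0 \<le> \<theta> \<and> \<theta> \<le> 1 / 2"
  proof (cases "v = u + \<delta>")
    case True
    show ?thesis
    proof (rule that[of u])
      fix t assume "t \<in> {u..u + 2 * h}"
      then show "\<exists>\<theta>. t = u + \<theta> * (v - u) \<and> 0 \<le> \<theta> \<and> \<theta> \<le> 1 / 2"
        using True h \<delta>0 by (intro exI[of _ "(t - u) / \<delta>"]) (auto simp: field_simps)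
    qed (use True v u h \<delta>0 in auto)
  next
    case False
    then have veq: "v = u - \<delta>" using v(2) by auto
    show ?thesis
    proof (rule that[of "u - 2 * h"])
      fix t assume "t \<in> {u - 2 * h..u - 2 * h + 2 * h}"
      then show "\<exists>\<theta>. t = u + \<theta> * (v - u) \<and> 0 \<le> \<theta> \<and> \<theta> \<le> 1 / 2"
        using veq h \<delta>0 by (intro exI[of _ "(u - t) / \<delta>"]) (auto simp: field_simps)
    qed (use veq v u h \<delta>0 in auto)
  qed
  obtain k where k: "(real k + 1) * h \<le> b - a" "cell a h k \<subseteq> {s..s + 2 * h}"
    using interval_contains_cell[OF h(1) s(1,2)] by blast
  have "c < T_o n (\<lambda>i. usign (ereal (y i) - g (x i)))"
  proof (rule rejects_on_imp_T_o_gt[OF rej[OF k(1)]])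
    fix i assume "x i \<in> cell a h k"
    then have xi: "x i \<in> {s..s + 2 * h}" using k by blast
    then have "f (x i) = ereal (\<phi> (x i))" using s by (intro f) auto
    moreover have "g (x i) \<le> ereal (\<phi> (x i) - \<epsilon>)" using s(3)[OF xi] below by blast
    ultimately have "g (x i) \<le> f (x i) - ereal \<epsilon>" by simp
    then show "usign (ereal (y i) - (f (x i) - ereal \<epsilon>)) \<le> usign (ereal (y i) - g (x i))"
      by (intro usign_mono ereal_minus_mono) auto
  qed
  then show False using g(2) by simp
qed

section \<open>Probability of the local rejections\<close>

text \<open>The mean of the local statistic is at least \<open>beta_coef d * d * p \<ge> sqrt d * p\<close>, and Hoeffding's
  inequality bounds the deviation because the squared weights sum to at most 1.\<close>
lemma (in prob_space) T_loc_lower_deviation: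
  assumes indep: "indep_vars (\<lambda>_. borel) Y {1..n}"
    and S: "\<And>i. S i \<in> borel_measurable borel" "\<And>i y. \<bar>S i y\<bar> \<le> 1"
    and win: "1 \<le> d" "d \<le> j" "j + d \<le> n + 1"
    and mean: "\<And>i. i \<in> {1..n} \<Longrightarrow> \<bar>int i - int j\<bar> < int d \<Longrightarrow> p \<le> expectation (\<lambda>\<omega>. S i (Y i \<omega>))"
    and p: "p \<ge> 0" and s: "s \<ge> 0"
  shows "prob {\<omega> \<in> space M. T_loc n d j (\<lambda>i. S i (Y i \<omega>)) \<le> sqrt (real d) * p - s} \<le> exp (- s\<^sup>2 / 2)"
proof -
  define w where "w i = beta_coef d * psi ((real i - real j) / real d)" for i
  define X where "X i \<omega> = w i * S i (Y i \<omega>)" for i \<omega>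
  have w0: "w i \<ge> 0" for i
    using beta_coef_pos[OF win(1)] psi_nonneg by (simp add: w_def)
  have indX: "indep_vars (\<lambda>_. borel) X {1..n}"
    unfolding X_def by (rule indep_vars_compose2[OF indep]) (use S(1) in measurable)
  interpret H: Hoeffding_ineq M "{1..n}" X "\<lambda>i. - w i" w "\<Sum>i=1..n. expectation (X i)"
  proof (unfold_locales)
    fix i
    have "\<bar>X i \<omega>\<bar> \<le> w i" for \<omega>
      using mult_left_mono[OF S(2)[of i "Y i \<omega>"] w0[of i]] w0[of i] by (simp add: X_def abs_mult)
    then show "AE \<omega> in M. X i \<omega> \<in> {- w i..w i}" by (auto simp: abs_le_iff minus_le_iff)
  qed (use indX in auto)
  have V: "(\<Sum>i=1..n. (w i - - w i)\<^sup>2) = 4 * (\<Sum>i=1..n. (w i)\<^sup>2)"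
    by (simp add: sum_distrib_left power2_eq_square algebra_simps)
  have "j \<in> {1..n}" using win by auto
  then have "(w j)\<^sup>2 \<le> (\<Sum>i=1..n. (w i)\<^sup>2)" by (intro member_le_sum) auto
  moreover have "w j > 0" using beta_coef_pos[OF win(1)] by (simp add: w_def psi_def)
  ultimately have Vpos: "(\<Sum>i=1..n. (w i)\<^sup>2) > 0" by (smt (verit) zero_less_power)
  have Vle: "(\<Sum>i=1..n. (w i)\<^sup>2) \<le> 1" unfolding w_def by (rule psi_window_energy[OF win(1)])
  have mean_le: "sqrt (real d) * p \<le> (\<Sum>i=1..n. expectation (X i))"
  proof -
    have "sqrt (real d) \<le> beta_coef d * real d"
      using mult_right_mono[OF beta_coef_ge[OF win(1)], of "real d"] by (simp add: real_div_sqrt)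
    then have "sqrt (real d) * p \<le> beta_coef d * real d * p" using p by (rule mult_right_mono)
    also have "\<dots> = (\<Sum>i=1..n. w i * p)"
      using psi_window_sum[OF win] by (simp add: w_def flip: sum_distrib_left sum_distrib_right)
    also have "\<dots> \<le> (\<Sum>i=1..n. expectation (X i))"
    proof (rule sum_mono)
      fix i assume i: "i \<in> {1..n}"
      show "w i * p \<le> expectation (X i)"
      proof (cases "\<bar>int i - int j\<bar> < int d")
        case True
        then show ?thesis
          unfolding X_def using mean[OF i] w0[of i] by (simp add: mult_left_mono)
      next
        case False
        then have "w i = 0"
          unfolding w_def using win(1) by (subst psi_eq_0) (auto simp: field_simps)
        then show ?thesis by (simp add: X_def[abs_def])
      qed
    qed
    finally show ?thesis .
  qed
  have T: "T_loc n d j (\<lambda>i. S i (Y i \<omega>)) = (\<Sum>i=1..n. X i \<omega>)" for \<omega>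
    by (simp add: T_loc_def X_def w_def sum_distrib_left mult.assoc)
  have "prob {\<omega> \<in> space M. T_loc n d j (\<lambda>i. S i (Y i \<omega>)) \<le> sqrt (real d) * p - s} \<le>
      prob {\<omega> \<in> space M. (\<Sum>i=1..n. X i \<omega>) \<le> (\<Sum>i=1..n. expectation (X i)) - s}"
  proof (rule finite_measure_mono)
    show "{\<omega> \<in> space M. T_loc n d j (\<lambda>i. S i (Y i \<omega>)) \<le> sqrt (real d) * p - s} \<subseteq>
        {\<omega> \<in> space M. (\<Sum>i=1..n. X i \<omega>) \<le> (\<Sum>i=1..n. expectation (X i)) - s}"
      unfolding T using mean_le by auto
    have "\<And>i. i \<in> {1..n} \<Longrightarrow> X i \<in> borel_measurable M" using H.random_variable by blast
    then have "(\<lambda>\<omega>. \<Sum>i=1..n. X i \<omega>) \<in> borel_measurable M" by (rule borel_measurable_sum)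
    then show "{\<omega> \<in> space M. (\<Sum>i=1..n. X i \<omega>) \<le> (\<Sum>i=1..n. expectation (X i)) - s} \<in> events"
      by measurable
  qed
  also have "\<dots> \<le> exp (- 2 * s\<^sup>2 / (\<Sum>i=1..n. (w i - - w i)\<^sup>2))"
    using s Vpos V by (intro H.Hoeffding_ineq_le) auto
  also have "\<dots> = exp (- (s\<^sup>2 / (2 * (\<Sum>i=1..n. (w i)\<^sup>2))))" unfolding V by (simp add: field_simps)
  also have "\<dots> \<le> exp (- (s\<^sup>2 / (2 * 1)))"
    unfolding exp_le_cancel_iff neg_le_iff_le using Vle Vpos by (intro divide_left_mono) auto
  finally show ?thesis by simp
qed

text \<open>The design points in an interval have consecutive indices, so a centred window fits among them.\<close>
lemma sorted_window:
  assumes mono: "mono_on {1..n} (x :: nat \<Rightarrow> real)" and d: "1 \<le> d"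
    and card: "2 * d \<le> card {i \<in> {1..n}. x i \<in> {s..t}} + 1"
  obtains j where "j \<in> {1..n}" "d \<le> j" "j + d \<le> n + 1"
    "\<forall>i\<in>{1..n}. \<bar>int i - int j\<bar> < int d \<longrightarrow> x i \<in> {s..t}"
proof -
  let ?I = "{i \<in> {1..n}. x i \<in> {s..t}}"
  have fin: "finite ?I" by simp
  have ne: "?I \<noteq> {}"
  proof
    assume "?I = {}"
    then have "card ?I = 0" by (simp only: card.empty)
    then show False using card d by linarith
  qed
  define l u where "l = Min ?I" and "u = Max ?I"
  have l: "l \<in> ?I" and u: "u \<in> ?I" unfolding l_def u_def using Min_in[OF fin ne] Max_in[OF fin ne] by auto
  have "?I \<subseteq> {l..u}" unfolding l_def u_def using fin by auto
  then have "card ?I \<le> card {l..u}" by (intro card_mono) auto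
  then have len: "l + 2 * d \<le> u + 2" using card d l u by auto
  have inside: "x i \<in> {s..t}" if "i \<in> {l..u}" for i
  proof -
    have "x l \<le> x i" "x i \<le> x u" using that l u by (auto intro!: mono_onD[OF mono])
    then show ?thesis using l u by auto
  qed
  show thesis
  proof (rule that[of "l + d - 1"])
    show "\<forall>i\<in>{1..n}. \<bar>int i - int (l + d - 1)\<bar> < int d \<longrightarrow> x i \<in> {s..t}"
    proof (intro ballI impI inside)
      fix i assume "\<bar>int i - int (l + d - 1)\<bar> < int d"
      then have "int l \<le> int i" "int i \<le> int u" using len d by linarith+
      then show "i \<in> {l..u}" by simp
    qed
  qed (use len d l u in auto)
qed

lemma (in prob_space) expectation_sign:
  assumes [measurable]: "Measurable.pred M P"
  shows "expectation (\<lambda>\<omega>. if P \<omega> then 1 else - 1) = 2 * prob {\<omega> \<in> space M. P \<omega>} - 1"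
proof -
  have "expectation (\<lambda>\<omega>. if P \<omega> then 1 else - 1 :: real) =
      expectation (\<lambda>\<omega>. 2 * indicator {\<omega> \<in> space M. P \<omega>} \<omega> - 1)"
    by (intro Bochner_Integration.integral_cong) (auto simp: indicator_def)
  also have "\<dots> = 2 * prob {\<omega> \<in> space M. P \<omega>} - 1"
    by (subst Bochner_Integration.integral_diff)
       (auto simp: prob_space emeasure_eq_measure less_top[symmetric] intro!: integrable_real_indicator)
  finally show ?thesis .
qed

lemma (in prob_space) rejects_on_probability:
  assumes indep: "indep_vars (\<lambda>_. borel) Y {1..n}" and mono: "mono_on {1..n} x"
    and S: "\<And>i. S i \<in> borel_measurable borel" "\<And>i y. \<bar>S i y\<bar> \<le> 1"
    and mean: "\<And>i. i \<in> {1..n} \<Longrightarrow> x i \<in> {s..t} \<Longrightarrow> p \<le> expectation (\<lambda>\<omega>. S i (Y i \<omega>))"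
    and p: "p \<ge> 0" and d: "1 \<le> d" "2 * d \<le> card {i \<in> {1..n}. x i \<in> {s..t}}"
    and z: "0 \<le> z" "z \<le> sqrt (real d) * p - c - Gam ((2 * real d - 1) / real n)"
  obtains N where "N \<in> events" "prob N \<le> exp (- z\<^sup>2 / 2)"
    "\<And>\<omega>. \<omega> \<in> space M \<Longrightarrow> \<omega> \<notin> N \<Longrightarrow> rejects_on n c x {s..t} (\<lambda>i. S i (Y i \<omega>))"
proof -
  obtain j where j: "j \<in> {1..n}" "d \<le> j" "j + d \<le> n + 1"
    "\<forall>i\<in>{1..n}. \<bar>int i - int j\<bar> < int d \<longrightarrow> x i \<in> {s..t}"
    using sorted_window[OF mono d(1), of s t] d(2) by auto
  define N where "N = {\<omega> \<in> space M. T_loc n d j (\<lambda>i. S i (Y i \<omega>)) \<le> sqrt (real d) * p - z}"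
  have dn: "d \<in> {1..(n + 1) div 2}" using j d by auto
  show thesis
  proof (rule that)
    have [measurable]: "Y i \<in> borel_measurable M" if "i \<in> {1..n}" for i
      using indep that unfolding indep_vars_def by blast
    note [measurable] = S(1)
    have "(\<lambda>\<omega>. T_loc n d j (\<lambda>i. S i (Y i \<omega>))) \<in> borel_measurable M"
      unfolding T_loc_def by measurable
    then show "N \<in> events" unfolding N_def by measurable
    show "prob N \<le> exp (- z\<^sup>2 / 2)"
      unfolding N_def using j z by (intro T_loc_lower_deviation[OF indep S d(1)] mean p) auto
    fix \<omega> assume "\<omega> \<in> space M" "\<omega> \<notin> N"
    then have "sqrt (real d) * p - z < T_loc n d j (\<lambda>i. S i (Y i \<omega>))" by (simp add: N_def)
    then have "c + Gam ((2 * real d - 1) / real n) < T_loc n d j (\<lambda>i. S i (Y i \<omega>))" using z by linarith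
    then show "rejects_on n c x {s..t} (\<lambda>i. S i (Y i \<omega>))"
      unfolding rejects_on_def using dn j by blast
  qed
qed

lemma usign_measurable [measurable]: "usign \<in> borel_measurable borel"
  unfolding usign_def[abs_def] by measurable

lemma abs_usign: "\<bar>usign u\<bar> \<le> 1"
  by (simp add: usign_def)

text \<open>The factor 3 is the one lost in the passage from the upper to the lower bound.\<close>
definition band_holds ::
    "nat \<Rightarrow> real \<Rightarrow> (nat \<Rightarrow> real) \<Rightarrow> (nat \<Rightarrow> real) \<Rightarrow> real \<Rightarrow> real \<Rightarrow> real \<Rightarrow> real \<Rightarrow> (real \<Rightarrow> real) \<Rightarrow> bool" where
  "band_holds n \<alpha> x y a b \<delta> R \<phi> \<longleftrightarrow>
     (\<forall>u\<in>{a + \<delta>..b - \<delta>}. U_hat n \<alpha> x y u \<le> ereal (\<phi> u + R)) \<and>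
     (\<forall>u\<in>{a..b}. ereal (\<phi> u - 3 * R) \<le> L_hat n \<alpha> x y u)"

lemma band_holds_if_rejects:
  assumes f: "\<And>u. u \<in> {a..b} \<Longrightarrow> f u = ereal (\<phi> u)" and aff: "affine_up_to a b \<delta> E \<phi>"
    and h: "h > 0" "4 * h \<le> \<delta>" and \<delta>: "4 * \<delta> \<le> b - a" and \<epsilon>: "\<epsilon> \<ge> 0"
    and up: "\<And>k. (real k + 1) * h \<le> b - a \<Longrightarrow>
      rejects_on n (kappa n \<alpha>) x (cell a h k) (\<lambda>i. usign (f (x i) + ereal \<epsilon> - ereal (y i)))"
    and lo: "\<And>k. (real k + 1) * h \<le> b - a \<Longrightarrow>
      rejects_on n (kappa n \<alpha>) x (cell a h k) (\<lambda>i. usign (ereal (y i) - (f (x i) - ereal \<epsilon>)))"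
  shows "band_holds n \<alpha> x y a b \<delta> (E + \<epsilon>) \<phi>"
proof -
  have U: "U_hat n \<alpha> x y u \<le> ereal (\<phi> u + E + \<epsilon>)" if "u \<in> {a + \<delta>..b - \<delta>}" for u
    unfolding U_hat_def Sup_fun_def
    using h that by (intro SUP_least) (auto intro!: upper_candidate_le[OF f aff h(1) _ up])
  have L: "ereal (\<phi> u - 3 * (E + \<epsilon>)) \<le> L_hat n \<alpha> x y u" if "u \<in> {a..b}" for u
    unfolding L_hat_def Inf_fun_def
  proof (rule INF_greatest)
    fix g assume "g \<in> {g. convex_fun g \<and> g \<le> U_hat n \<alpha> x y \<and>
             T_o n (\<lambda>i. usign (ereal (y i) - g (x i))) \<le> kappa n \<alpha>}"
    then have g: "convex_fun g" "g \<le> U_hat n \<alpha> x y" "T_o n (\<lambda>i. usign (ereal (y i) - g (x i))) \<le> kappa n \<alpha>"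
      by auto
    show "ereal (\<phi> u - 3 * (E + \<epsilon>)) \<le> g u"
      by (rule lower_candidate_ge[OF f aff h \<delta> \<epsilon> lo g(1,3) _ that])
         (use g(2) U in \<open>auto simp: le_fun_def intro: order_trans\<close>)
  qed
  show ?thesis using U L by (simp add: band_holds_def add.assoc)
qed

text \<open>A union bound over at most \<open>(b - a) / h\<close> cells and the two directions. The exceptional set itself
  depends on suprema over families of convex functions, hence the outer measure; it is covered by
  finitely many measurable events.\<close>
lemma (in prob_space) band_failure_probability:
  assumes indep: "indep_vars (\<lambda>_. borel) Y {1..n}" and mono: "mono_on {1..n} x"
    and f: "\<And>u. u \<in> {a..b} \<Longrightarrow> f u = ereal (\<phi> u)" and aff: "affine_up_to a b \<delta> E \<phi>"
    and h: "h > 0" "4 * h \<le> \<delta>" and \<delta>: "4 * \<delta> \<le> b - a" and \<epsilon>: "\<epsilon> \<ge> 0" and p: "p \<ge> 0"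
    and signs: "\<And>i. i \<in> {1..n} \<Longrightarrow> x i \<in> {a..b} \<Longrightarrow>
      (1 + p) / 2 \<le> prob {\<omega> \<in> space M. ereal (Y i \<omega>) < f (x i) + ereal \<epsilon>} \<and>
      (1 + p) / 2 \<le> prob {\<omega> \<in> space M. ereal (Y i \<omega>) > f (x i) - ereal \<epsilon>}"
    and d: "1 \<le> d" "\<And>k. (real k + 1) * h \<le> b - a \<Longrightarrow> 2 * d \<le> card {i \<in> {1..n}. x i \<in> cell a h k}"
    and z: "0 \<le> z" "z \<le> sqrt (real d) * p - kappa n \<alpha> - Gam ((2 * real d - 1) / real n)"
  shows "outer_measure_of M {\<omega> \<in> space M. \<not> band_holds n \<alpha> x (\<lambda>i. Y i \<omega>) a b \<delta> (E + \<epsilon>) \<phi>}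
    \<le> ennreal (2 * ((b - a) / h) * exp (- z\<^sup>2 / 2))"
proof -
  define K where "K = {k. (real k + 1) * h \<le> b - a}"
  have K: "K \<subseteq> {..<nat \<lfloor>(b - a) / h\<rfloor>}"
  proof
    fix k assume "k \<in> K"
    then have "real k + 1 \<le> (b - a) / h" using h by (simp add: K_def field_simps)
    then show "k \<in> {..<nat \<lfloor>(b - a) / h\<rfloor>}" by simp linarith
  qed
  have finK: "finite K" using K finite_subset by blast
  have "0 \<le> (b - a) / h" using h \<delta> by (intro divide_nonneg_pos) linarith+
  then have cardK: "real (card K) \<le> (b - a) / h"
    using card_mono[OF _ K] by simp linarith
  have cell_ab: "cell a h k \<subseteq> {a..b}" if "k \<in> K" for k
    using that h by (auto simp: K_def cell_def distrib_right intro: order_trans[of _ "a + real k * h"])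
  have Ym: "Y i \<in> borel_measurable M" if "i \<in> {1..n}" for i
    using indep that unfolding indep_vars_def by blast
  let ?S = "\<lambda>i y. usign (f (x i) + ereal \<epsilon> - ereal y)" and ?R = "\<lambda>i y. usign (ereal y - (f (x i) - ereal \<epsilon>))"
  have Sm: "?S i \<in> borel_measurable borel" for i by measurable
  have Rm: "?R i \<in> borel_measurable borel" for i by measurable
  have means: "p \<le> expectation (\<lambda>\<omega>. ?S i (Y i \<omega>))" "p \<le> expectation (\<lambda>\<omega>. ?R i (Y i \<omega>))"
    if i: "i \<in> {1..n}" "x i \<in> {a..b}" for i
  proof -
    note [measurable] = Ym[OF i(1)]
    have fx: "f (x i) = ereal (\<phi> (x i))" using i(2) by (rule f)
    have "expectation (\<lambda>\<omega>. ?S i (Y i \<omega>)) = 2 * prob {\<omega> \<in> space M. ereal (Y i \<omega>) < f (x i) + ereal \<epsilon>} - 1"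
      by (subst expectation_sign[symmetric]) (auto simp: fx usign_def intro!: Bochner_Integration.integral_cong)
    then show "p \<le> expectation (\<lambda>\<omega>. ?S i (Y i \<omega>))" using signs[OF i] by simp
    have "expectation (\<lambda>\<omega>. ?R i (Y i \<omega>)) = 2 * prob {\<omega> \<in> space M. ereal (Y i \<omega>) > f (x i) - ereal \<epsilon>} - 1"
      by (subst expectation_sign[symmetric]) (auto simp: fx usign_def intro!: Bochner_Integration.integral_cong)
    then show "p \<le> expectation (\<lambda>\<omega>. ?R i (Y i \<omega>))" using signs[OF i] by simp
  qed
  have event: "\<exists>N. N \<in> events \<and> prob N \<le> exp (- z\<^sup>2 / 2) \<and> (\<forall>\<omega>\<in>space M. \<omega> \<notin> N \<longrightarrow>
      rejects_on n (kappa n \<alpha>) x (cell a h k) (\<lambda>i. S i (Y i \<omega>)))"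
    if k: "k \<in> K" and S: "\<And>i. S i \<in> borel_measurable borel" "\<And>i y. \<bar>S i y\<bar> \<le> 1"
      and mean: "\<And>i. i \<in> {1..n} \<Longrightarrow> x i \<in> {a..b} \<Longrightarrow> p \<le> expectation (\<lambda>\<omega>. S i (Y i \<omega>))" for k S
  proof -
    let ?s = "a + real k * h" and ?t = "a + (real k + 1) * h"
    have card: "2 * d \<le> card {i \<in> {1..n}. x i \<in> {?s..?t}}"
      using k d(2)[of k] by (simp add: K_def cell_def)
    have mean': "p \<le> expectation (\<lambda>\<omega>. S i (Y i \<omega>))" if "i \<in> {1..n}" "x i \<in> {?s..?t}" for i
      using that cell_ab[OF k] by (intro mean) (auto simp: cell_def)
    obtain N where "N \<in> events" "prob N \<le> exp (- z\<^sup>2 / 2)"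
      "\<And>\<omega>. \<omega> \<in> space M \<Longrightarrow> \<omega> \<notin> N \<Longrightarrow> rejects_on n (kappa n \<alpha>) x {?s..?t} (\<lambda>i. S i (Y i \<omega>))"
      using rejects_on_probability[OF indep mono S mean' p d(1) card z] by metis
    then show ?thesis unfolding cell_def by blast
  qed
  have "\<forall>k\<in>K. \<exists>N. N \<in> events \<and> prob N \<le> exp (- z\<^sup>2 / 2) \<and> (\<forall>\<omega>\<in>space M. \<omega> \<notin> N \<longrightarrow>
      rejects_on n (kappa n \<alpha>) x (cell a h k) (\<lambda>i. ?S i (Y i \<omega>)))"
    by (intro ballI event Sm abs_usign means(1))
  from bchoice[OF this] obtain N where N: "\<forall>k\<in>K. N k \<in> events \<and> prob (N k) \<le> exp (- z\<^sup>2 / 2) \<and>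
      (\<forall>\<omega>\<in>space M. \<omega> \<notin> N k \<longrightarrow>
        rejects_on n (kappa n \<alpha>) x (cell a h k) (\<lambda>i. ?S i (Y i \<omega>)))" ..
  have "\<forall>k\<in>K. \<exists>N. N \<in> events \<and> prob N \<le> exp (- z\<^sup>2 / 2) \<and> (\<forall>\<omega>\<in>space M. \<omega> \<notin> N \<longrightarrow>
      rejects_on n (kappa n \<alpha>) x (cell a h k) (\<lambda>i. ?R i (Y i \<omega>)))"
    by (intro ballI event Rm abs_usign means(2))
  from bchoice[OF this] obtain N' where N': "\<forall>k\<in>K. N' k \<in> events \<and> prob (N' k) \<le> exp (- z\<^sup>2 / 2) \<and>
      (\<forall>\<omega>\<in>space M. \<omega> \<notin> N' k \<longrightarrow>
        rejects_on n (kappa n \<alpha>) x (cell a h k) (\<lambda>i. ?R i (Y i \<omega>)))" ..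
  let ?F = "{\<omega> \<in> space M. \<not> band_holds n \<alpha> x (\<lambda>i. Y i \<omega>) a b \<delta> (E + \<epsilon>) \<phi>}"
  let ?B = "\<Union>k\<in>K. N k \<union> N' k"
  have "?F \<subseteq> ?B"
  proof (rule subsetI, rule ccontr)
    fix \<omega> assume \<omega>: "\<omega> \<in> ?F" "\<omega> \<notin> ?B"
    have "band_holds n \<alpha> x (\<lambda>i. Y i \<omega>) a b \<delta> (E + \<epsilon>) \<phi>"
      using \<omega> N N' by (intro band_holds_if_rejects[OF f aff h \<delta> \<epsilon>]) (auto simp: K_def)
    then show False using \<omega> by simp
  qed
  have Bm: "?B \<in> events" using N N' finK by (intro sets.finite_UN) auto
  have "outer_measure_of M ?F \<le> outer_measure_of M ?B" by (rule outer_measure_of_mono[OF \<open>?F \<subseteq> ?B\<close>])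
  also have "\<dots> = ennreal (prob ?B)" using Bm by (simp add: emeasure_eq_measure)
  also have "\<dots> \<le> ennreal (2 * ((b - a) / h) * exp (- z\<^sup>2 / 2))"
  proof (rule ennreal_leI)
    have "prob ?B \<le> (\<Sum>k\<in>K. prob (N k \<union> N' k))"
      by (rule finite_measure_subadditive_finite[OF finK]) (use N N' in auto)
    also have "\<dots> \<le> (\<Sum>k\<in>K. 2 * exp (- z\<^sup>2 / 2))"
    proof (rule sum_mono)
      fix k assume k: "k \<in> K"
      show "prob (N k \<union> N' k) \<le> 2 * exp (- z\<^sup>2 / 2)"
        using measure_subadditive[of "N k" M "N' k"] N[rule_format, OF k] N'[rule_format, OF k] by simp
    qed
    also have "\<dots> = 2 * (real (card K) * exp (- z\<^sup>2 / 2))" by simp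
    also have "\<dots> \<le> 2 * ((b - a) / h * exp (- z\<^sup>2 / 2))"
      by (intro mult_left_mono mult_right_mono cardK) auto
    finally show "prob ?B \<le> 2 * ((b - a) / h) * exp (- z\<^sup>2 / 2)" by (simp only: mult.assoc)
  qed
  finally show ?thesis .
qed

section \<open>From the band to boundedness in probability\<close>

lemma sup_excess_le:
  fixes w :: "real \<Rightarrow> ereal"
  assumes "S \<noteq> {}" "\<And>u. u \<in> S \<Longrightarrow> w u \<le> ereal R" "0 \<le> R"
  shows "\<bar>SUP u\<in>S. max (w u) 0\<bar> \<le> ereal R"
proof -
  have le: "(SUP u\<in>S. max (w u) 0) \<le> ereal R" using assms by (intro SUP_least) auto
  obtain u where "u \<in> S" using assms(1) by blast
  then have "0 \<le> (SUP u\<in>S. max (w u) 0)" by (intro SUP_upper2[of u]) auto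
  then show ?thesis using le by simp
qed

lemma band_holds_upper:
  assumes band: "band_holds n \<alpha> x y a b \<delta> R \<phi>" and f: "\<And>u. u \<in> {a..b} \<Longrightarrow> f u = ereal (\<phi> u)"
    and s: "a + \<delta> \<le> s" "s \<le> t" "t \<le> b - \<delta>" and \<delta>: "0 \<le> \<delta>" and R: "0 \<le> R"
  shows "\<bar>SUP u\<in>{s..t}. max (U_hat n \<alpha> x y u - f u) 0\<bar> \<le> ereal R"
proof (rule sup_excess_le[OF _ _ R])
  fix u assume u: "u \<in> {s..t}"
  then have "U_hat n \<alpha> x y u \<le> ereal (\<phi> u + R)" using band s by (auto simp: band_holds_def)
  moreover have "f u = ereal (\<phi> u)" using u s \<delta> by (intro f) auto
  ultimately show "U_hat n \<alpha> x y u - f u \<le> ereal R"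
    by (cases "U_hat n \<alpha> x y u") auto
qed (use s in auto)

lemma band_holds_lower:
  assumes band: "band_holds n \<alpha> x y a b \<delta> R \<phi>" and f: "\<And>u. u \<in> {a..b} \<Longrightarrow> f u = ereal (\<phi> u)"
    and ab: "a < b" and R: "0 \<le> R"
  shows "\<bar>SUP u\<in>{a..b}. max (f u - L_hat n \<alpha> x y u) 0\<bar> \<le> ereal (3 * R)"
proof (rule sup_excess_le)
  fix u assume u: "u \<in> {a..b}"
  then have "ereal (\<phi> u - 3 * R) \<le> L_hat n \<alpha> x y u" using band by (auto simp: band_holds_def)
  moreover have "f u = ereal (\<phi> u)" using u by (rule f)
  ultimately show "f u - L_hat n \<alpha> x y u \<le> ereal (3 * R)"
    by (cases "L_hat n \<alpha> x y u") auto
qed (use ab R in auto)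

lemma bounded_in_probI:
  assumes "\<And>\<eta>. \<eta> > 0 \<Longrightarrow> \<exists>K G. (\<forall>\<^sub>F n in sequentially.
      outer_measure_of (M n) {\<omega> \<in> space (M n). \<not> G n \<omega>} \<le> ennreal \<eta> \<and>
      (\<forall>\<omega>. G n \<omega> \<longrightarrow> \<bar>Z n \<omega>\<bar> \<le> ereal (K * r n)))"
  shows "bounded_in_prob M Z r"
  unfolding bounded_in_prob_def
proof (intro allI impI)
  fix \<eta> :: real assume "\<eta> > 0"
  from assms[OF this] obtain K G where KG: "\<forall>\<^sub>F n in sequentially.
      outer_measure_of (M n) {\<omega> \<in> space (M n). \<not> G n \<omega>} \<le> ennreal \<eta> \<and>
      (\<forall>\<omega>. G n \<omega> \<longrightarrow> \<bar>Z n \<omega>\<bar> \<le> ereal (K * r n))" by blast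
  have "\<forall>\<^sub>F n in sequentially.
      outer_measure_of (M n) {\<omega> \<in> space (M n). \<bar>Z n \<omega>\<bar> > ereal (K * r n)} \<le> ennreal \<eta>"
    using KG
  proof eventually_elim
    case (elim n)
    have "outer_measure_of (M n) {\<omega> \<in> space (M n). \<bar>Z n \<omega>\<bar> > ereal (K * r n)} \<le>
        outer_measure_of (M n) {\<omega> \<in> space (M n). \<not> G n \<omega>}"
      using elim by (intro outer_measure_of_mono) (auto simp: not_le[symmetric])
    also have "\<dots> \<le> ennreal \<eta>" using elim by blast
    finally show ?case .
  qed
  then show "\<exists>K. limsup (\<lambda>n. outer_measure_of (M n) {\<omega> \<in> space (M n). \<bar>Z n \<omega>\<bar> > ereal (K * r n)})
      \<le> ennreal \<eta>"
    by (intro exI[of _ K] Limsup_bounded)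
qed

section \<open>Local approximation by affine functions\<close>

lemma affine_up_to_zero:
  "affine_up_to a b \<delta> 0 (\<lambda>u. p + q * u)"
  unfolding affine_up_to_def by (intro exI[of _ "\<lambda>_. q"]) (auto simp: algebra_simps)

text \<open>The mean value theorem for \<open>\<phi> - \<phi>' u * id\<close>, whose derivative is at most \<open>L \<delta>\<^sup>\<beta>\<^sup>-\<^sup>1\<close>.\<close>
lemma affine_up_to_hoelder:
  assumes der: "\<And>u. u \<in> {a..b} \<Longrightarrow> (\<phi> has_real_derivative \<phi>' u) (at u within {a..b})"
    and hoel: "\<And>u v. u \<in> {a..b} \<Longrightarrow> v \<in> {a..b} \<Longrightarrow> \<bar>\<phi>' u - \<phi>' v\<bar> \<le> L * \<bar>u - v\<bar> powr (\<beta> - 1)"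
    and L: "L > 0" and \<beta>: "1 < \<beta>" and \<delta>: "0 < \<delta>"
  shows "affine_up_to a b \<delta> (L * \<delta> powr \<beta>) \<phi>"
  unfolding affine_up_to_def
proof (intro exI[of _ \<phi>'] ballI impI)
  fix u t assume u: "u \<in> {a..b}" and t: "t \<in> {a..b}" and tu: "\<bar>t - u\<bar> \<le> \<delta>"
  let ?g = "\<lambda>v. \<phi> v - \<phi>' u * v"
  have seg: "closed_segment u t \<subseteq> {a..b}" using u t by (intro closed_segment_subset) auto
  have "norm (?g t - ?g u) \<le> L * \<delta> powr (\<beta> - 1) * norm (t - u)"
  proof (rule field_differentiable_bound[of "closed_segment u t" ?g "\<lambda>v. \<phi>' v - \<phi>' u"])
    fix v assume v: "v \<in> closed_segment u t"
    then have vab: "v \<in> {a..b}" using seg by auto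
    show "(?g has_field_derivative \<phi>' v - \<phi>' u) (at v within closed_segment u t)"
      by (auto intro!: derivative_eq_intros DERIV_subset[OF der[OF vab] seg])
    have "\<bar>v - u\<bar> \<le> \<delta>" using v tu by (auto simp: closed_segment_eq_real_ivl split: if_splits)
    then have "\<bar>v - u\<bar> powr (\<beta> - 1) \<le> \<delta> powr (\<beta> - 1)" using \<beta> by (intro powr_mono2) auto
    then show "norm (\<phi>' v - \<phi>' u) \<le> L * \<delta> powr (\<beta> - 1)"
      using hoel[OF vab u] L by (auto intro: order_trans mult_left_mono)
  qed auto
  then have "?g t - ?g u \<le> L * \<delta> powr (\<beta> - 1) * \<bar>t - u\<bar>" by (simp add: abs_le_iff)
  also have "\<dots> \<le> L * \<delta> powr (\<beta> - 1) * \<delta>" using tu L by (intro mult_left_mono) auto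
  also have "\<dots> = L * \<delta> powr \<beta>" using \<delta> by (simp add: powr_mult_base[symmetric] powr_diff)
  finally show "\<phi> t \<le> \<phi> u + \<phi>' u * (t - u) + L * \<delta> powr \<beta>" by (simp add: algebra_simps)
qed

section \<open>Uniform design density\<close>

text \<open>The hypothesis concerns one interval for each \<open>n\<close>. Applied to intervals of small mass, chosen
  wherever there are any, it shows that eventually there are none; half of the constant is lost.\<close>
lemma design_mass_uniform:
  fixes x :: "nat \<Rightarrow> nat \<Rightarrow> real"
  assumes ab: "a < b" and c: "c > 0"
    and A1: "\<And>s t. (\<forall>n\<ge>1. a \<le> s n \<and> s n < t n \<and> t n \<le> b) \<Longrightarrow>
        liminf (\<lambda>n. ereal (ln (t n - s n) / ln (real n))) > - 1 \<Longrightarrow>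
        liminf (\<lambda>n. ereal (design_mass n (x n) {s n..t n} / (t n - s n))) \<ge> ereal c"
    and h: "\<forall>\<^sub>F n in sequentially. 0 < h n \<and> h n \<le> b - a"
      "liminf (\<lambda>n. ereal (ln (h n) / ln (real n))) > - 1"
  shows "\<forall>\<^sub>F n in sequentially. \<forall>s. a \<le> s \<longrightarrow> s + h n \<le> b \<longrightarrow>
      c / 2 * h n * real n \<le> real (card {i \<in> {1..n}. x n i \<in> {s..s + h n}})"
proof -
  (* The modification makes the interval admissible for every n, not only eventually. *)
  define h' where "h' n = (if 0 < h n \<and> h n \<le> b - a then h n else b - a)" for n
  define poor where "poor n s \<longleftrightarrow>
    a \<le> s \<and> s + h' n \<le> b \<and> design_mass n (x n) {s..s + h' n} \<le> c / 2 * h' n" for n s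
  define s where "s n = (if \<exists>s. poor n s then SOME s. poor n s else a)" for n
  have h': "0 < h' n" "h' n \<le> b - a" for n using ab by (auto simp: h'_def)
  have poor_s: "poor n (s n)" if "poor n u" for n u
    using someI[of "poor n" u] that unfolding s_def by auto
  have s: "a \<le> s n" "s n + h' n \<le> b" for n
    using poor_s[of n] h'[of n] by (cases "\<exists>u. poor n u"; auto simp: poor_def s_def)+
  have ev: "\<forall>\<^sub>F n in sequentially. h n = h' n" using h(1) by eventually_elim (simp add: h'_def)
  have "liminf (\<lambda>n. ereal (ln (h' n) / ln (real n))) = liminf (\<lambda>n. ereal (ln (h n) / ln (real n)))"
    by (rule Liminf_eq) (use ev in eventually_elim, simp)
  then have "ereal c \<le> liminf (\<lambda>n. ereal (design_mass n (x n) {s n..s n + h' n} / h' n))"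
    using A1[of s "\<lambda>n. s n + h' n"] s h' h(2) by simp
  moreover have "ereal (c / 2) < ereal c" using c by simp
  ultimately have "ereal (c / 2) < liminf (\<lambda>n. ereal (design_mass n (x n) {s n..s n + h' n} / h' n))"
    by (rule less_le_trans[rotated])
  from less_LiminfD[OF this]
  have "\<forall>\<^sub>F n in sequentially. c / 2 < design_mass n (x n) {s n..s n + h' n} / h' n" by simp
  then show ?thesis using ev eventually_ge_at_top[of 1]
  proof eventually_elim
    case (elim n)
    have "\<not> poor n (s n)"
    proof
      assume "poor n (s n)"
      then have "design_mass n (x n) {s n..s n + h' n} / h' n \<le> c / 2"
        using h'[of n] by (simp add: poor_def field_simps)
      then show False using elim(1) by simp
    qed
    have rich: "c / 2 * h n < design_mass n (x n) {u..u + h n}" if "a \<le> u" "u + h n \<le> b" for u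
    proof (rule ccontr)
      assume "\<not> ?thesis"
      then have "poor n u" using that elim(2) by (simp add: poor_def)
      then have "poor n (s n)" by (rule poor_s)
      then show False using \<open>\<not> poor n (s n)\<close> by contradiction
    qed
    show ?case
    proof (intro allI impI)
      fix u assume "a \<le> u" "u + h n \<le> b"
      from rich[OF this] show "c / 2 * h n * real n \<le> real (card {i \<in> {1..n}. x n i \<in> {u..u + h n}})"
        using elim(3) by (simp add: design_mass_def field_simps)
    qed
  qed
qed

section \<open>Rates of convergence\<close>

locale median_design =
  fixes f :: "real \<Rightarrow> ereal" and \<alpha> a b :: real
    and M :: "nat \<Rightarrow> 'w measure"
    and x :: "nat \<Rightarrow> nat \<Rightarrow> real" and Y :: "nat \<Rightarrow> nat \<Rightarrow> 'w \<Rightarrow> real"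
    and H :: "real \<Rightarrow> real"
  assumes \<alpha>: "0 < \<alpha>" "\<alpha> < 1"
    and x_sorted: "\<And>n. n \<ge> 1 \<Longrightarrow> mono_on {1..n} (x n)"
    and M_prob: "\<And>n. n \<ge> 1 \<Longrightarrow> prob_space (M n)"
    and Y_indep: "\<And>n. n \<ge> 1 \<Longrightarrow> prob_space.indep_vars (M n) (\<lambda>_. borel) (Y n) {1..n}"
    and ab: "a < b"
    and A1: "\<exists>c::real. c > 0 \<and>
      (\<forall>s t :: nat \<Rightarrow> real.
        (\<forall>n\<ge>1. a \<le> s n \<and> s n < t n \<and> t n \<le> b) \<longrightarrow>
        liminf (\<lambda>n. ereal (ln (t n - s n) / ln (real n))) > - 1 \<longrightarrow>
        liminf (\<lambda>n. ereal (design_mass n (x n) {s n..t n} / (t n - s n))) \<ge> ereal c)"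
    and A2_H: "\<exists>l::ereal. l > 0 \<and> ((\<lambda>r. ereal (H r / r)) \<longlongrightarrow> l) (at_right 0)"
    and A2: "\<And>n i r. n \<ge> 1 \<Longrightarrow> i \<in> {1..n} \<Longrightarrow> x n i \<in> {a..b} \<Longrightarrow> r > 0 \<Longrightarrow>
      measure (M n) {\<omega> \<in> space (M n). ereal (Y n i \<omega>) < f (x n i) + ereal r} \<ge> (1 + H r) / 2 \<and>
      measure (M n) {\<omega> \<in> space (M n). ereal (Y n i \<omega>) > f (x n i) - ereal r} \<ge> (1 + H r) / 2"
begin

lemma H_at_least_linear:
  obtains c r0 where "c > 0" "r0 > 0" "\<And>r. 0 < r \<Longrightarrow> r < r0 \<Longrightarrow> c * r \<le> H r"
proof -
  obtain l :: ereal where l: "l > 0" "((\<lambda>r. ereal (H r / r)) \<longlongrightarrow> l) (at_right 0)" using A2_H by blast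
  obtain c where c: "0 < ereal c" "ereal c < l" using ereal_dense2[OF l(1)] by auto
  have "\<forall>\<^sub>F r in at_right 0. ereal c < ereal (H r / r)" by (rule order_tendstoD(1)[OF l(2) c(2)])
  then obtain r0 where r0: "r0 > 0" "\<And>r. 0 < r \<Longrightarrow> r < r0 \<Longrightarrow> c < H r / r"
    unfolding eventually_at_right_field by auto
  show thesis
  proof (rule that[of c r0])
    fix r :: real assume r: "0 < r" "r < r0"
    then have "c < H r / r" by (rule r0(2))
    then show "c * r \<le> H r" using r by (simp add: pos_less_divide_eq less_imp_le)
  qed (use c r0 in auto)
qed

text \<open>The constants depend on the model only. At bandwidth \<open>\<delta>\<close> and tolerance \<open>\<epsilon>\<close>, a window contains of the
  order of \<open>n \<delta>\<close> observations, each with a bias of the order of \<open>\<epsilon>\<close>, so the signal is of the order of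
  \<open>sqrt (n \<delta>) \<epsilon>\<close>; from it the critical value and the penalty of the scale are subtracted. Both
  rates follow by choosing \<open>\<delta>\<close> and \<open>\<epsilon>\<close> such that the remainder \<open>z\<close> is large enough for the
  number of cells, which is of the order of \<open>1 / \<delta>\<close>.\<close>
definition controls_band :: "real \<Rightarrow> real \<Rightarrow> real \<Rightarrow> real \<Rightarrow> bool" where
  "controls_band c1 c2 c3 B \<longleftrightarrow> (\<forall>\<phi> \<delta> \<epsilon> E. (\<forall>u\<in>{a..b}. f u = ereal (\<phi> u)) \<longrightarrow>
      (\<forall>\<^sub>F n in sequentially. 0 < \<delta> n \<and> 4 * \<delta> n \<le> b - a) \<longrightarrow>
      liminf (\<lambda>n. ereal (ln (\<delta> n / 4) / ln (real n))) > - 1 \<longrightarrow>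
      filterlim (\<lambda>n. real n * \<delta> n) at_top sequentially \<longrightarrow>
      (\<forall>\<^sub>F n in sequentially. affine_up_to a b (\<delta> n) (E n) \<phi>) \<longrightarrow>
      (\<forall>\<^sub>F n in sequentially. 0 < \<epsilon> n) \<longrightarrow> \<epsilon> \<longlonglongrightarrow> 0 \<longrightarrow>
      (\<forall>\<^sub>F n in sequentially. \<forall>z. 0 \<le> z \<longrightarrow>
        z \<le> c1 * sqrt (real n * \<delta> n) * \<epsilon> n - B - sqrt (2 + 2 * ln (c2 / \<delta> n)) \<longrightarrow>
        outer_measure_of (M n) {\<omega> \<in> space (M n).
          \<not> band_holds n \<alpha> (x n) (\<lambda>i. Y n i \<omega>) a b (\<delta> n) (E n + \<epsilon> n) \<phi>}
        \<le> ennreal (c3 / \<delta> n * exp (- z\<^sup>2 / 2))))"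

lemma controls_bandD:
  "controls_band c1 c2 c3 B \<Longrightarrow> (\<And>u. u \<in> {a..b} \<Longrightarrow> f u = ereal (\<phi> u)) \<Longrightarrow>
      (\<forall>\<^sub>F n in sequentially. 0 < \<delta> n \<and> 4 * \<delta> n \<le> b - a) \<Longrightarrow>
      liminf (\<lambda>n. ereal (ln (\<delta> n / 4) / ln (real n))) > - 1 \<Longrightarrow>
      filterlim (\<lambda>n. real n * \<delta> n) at_top sequentially \<Longrightarrow>
      (\<forall>\<^sub>F n in sequentially. affine_up_to a b (\<delta> n) (E n) \<phi>) \<Longrightarrow>
      (\<forall>\<^sub>F n in sequentially. 0 < \<epsilon> n) \<Longrightarrow> \<epsilon> \<longlonglongrightarrow> 0 \<Longrightarrow>
      (\<forall>\<^sub>F n in sequentially. \<forall>z. 0 \<le> z \<longrightarrow>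
        z \<le> c1 * sqrt (real n * \<delta> n) * \<epsilon> n - B - sqrt (2 + 2 * ln (c2 / \<delta> n)) \<longrightarrow>
        outer_measure_of (M n) {\<omega> \<in> space (M n).
          \<not> band_holds n \<alpha> (x n) (\<lambda>i. Y n i \<omega>) a b (\<delta> n) (E n + \<epsilon> n) \<phi>}
        \<le> ennreal (c3 / \<delta> n * exp (- z\<^sup>2 / 2)))"
  unfolding controls_band_def by blast

lemma controls_band_exists:
  obtains c1 c2 c3 B where "c1 > 0" "c2 > 0" "c3 > 0" "controls_band c1 c2 c3 B"
proof -
  obtain B where B: "\<And>n. n \<ge> 1 \<Longrightarrow> kappa n \<alpha> \<le> B" using kappa_bounded[OF \<alpha>] by blast
  obtain cH r0 where H: "cH > 0" "r0 > 0" "\<And>r. 0 < r \<Longrightarrow> r < r0 \<Longrightarrow> cH * r \<le> H r"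
    using H_at_least_linear by blast
  obtain c0 where c0: "c0 > 0" and A1': "\<And>s t. (\<forall>n\<ge>1. a \<le> s n \<and> s n < t n \<and> t n \<le> b) \<Longrightarrow>
        liminf (\<lambda>n. ereal (ln (t n - s n) / ln (real n))) > - 1 \<Longrightarrow>
        liminf (\<lambda>n. ereal (design_mass n (x n) {s n..t n} / (t n - s n))) \<ge> ereal c0"
    using A1 by blast
  define c where "c = c0 / 2"
  have c: "c > 0" using c0 by (simp add: c_def)
  show thesis
  proof (rule that[of "cH * sqrt (c / 16)" "16 / c" "8 * (b - a)" B])
    show "controls_band (cH * sqrt (c / 16)) (16 / c) (8 * (b - a)) B"
      unfolding controls_band_def
    proof (intro allI impI)
      fix \<phi> and \<delta> \<epsilon> E :: "nat \<Rightarrow> real"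
      assume f': "\<forall>u\<in>{a..b}. f u = ereal (\<phi> u)"
        and \<delta>: "\<forall>\<^sub>F n in sequentially. 0 < \<delta> n \<and> 4 * \<delta> n \<le> b - a"
        and lim: "liminf (\<lambda>n. ereal (ln (\<delta> n / 4) / ln (real n))) > - 1"
        and large: "filterlim (\<lambda>n. real n * \<delta> n) at_top sequentially"
        and aff: "\<forall>\<^sub>F n in sequentially. affine_up_to a b (\<delta> n) (E n) \<phi>"
        and \<epsilon>: "\<forall>\<^sub>F n in sequentially. 0 < \<epsilon> n" "\<epsilon> \<longlonglongrightarrow> 0"
      have f: "\<And>u. u \<in> {a..b} \<Longrightarrow> f u = ereal (\<phi> u)" using f' by blast
      have "\<forall>\<^sub>F n in sequentially. 0 < \<delta> n / 4 \<and> \<delta> n / 4 \<le> b - a"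
        using \<delta> by eventually_elim auto
      from design_mass_uniform[OF ab c0 A1' this lim]
      have mass: "\<forall>\<^sub>F n in sequentially. \<forall>s. a \<le> s \<longrightarrow> s + \<delta> n / 4 \<le> b \<longrightarrow>
        c * (\<delta> n / 4) * real n \<le> real (card {i \<in> {1..n}. x n i \<in> {s..s + \<delta> n / 4}})"
        unfolding c_def .
      have big: "\<forall>\<^sub>F n in sequentially. 16 / c \<le> real n * \<delta> n"
        using large unfolding filterlim_at_top by blast
      have small: "\<forall>\<^sub>F n in sequentially. \<epsilon> n < r0" by (rule order_tendstoD(2)[OF \<epsilon>(2) H(2)])
      show "\<forall>\<^sub>F n in sequentially. \<forall>z. 0 \<le> z \<longrightarrow>
          z \<le> cH * sqrt (c / 16) * sqrt (real n * \<delta> n) * \<epsilon> n - B - sqrt (2 + 2 * ln (16 / c / \<delta> n)) \<longrightarrow>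
          outer_measure_of (M n) {\<omega> \<in> space (M n).
            \<not> band_holds n \<alpha> (x n) (\<lambda>i. Y n i \<omega>) a b (\<delta> n) (E n + \<epsilon> n) \<phi>}
          \<le> ennreal (8 * (b - a) / \<delta> n * exp (- z\<^sup>2 / 2))"
        using \<delta> aff \<epsilon>(1) mass big small eventually_ge_at_top[of 1]
      proof eventually_elim
        case (elim n)
        note n = elim(7)
        interpret prob_space "M n" by (rule M_prob[OF n])
        (* A cell has at least c h n points, and its window uses 2 d - 1 of them. *)
        define h where "h = \<delta> n / 4"
        define d where "d = nat \<lfloor>c * h * real n / 2\<rfloor>"
        have h: "h > 0" "4 * h \<le> \<delta> n" using elim(1) by (auto simp: h_def)
        have big': "4 \<le> c * h * real n" using elim(5) c by (simp add: h_def field_simps)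
        then have d: "real d \<le> c * h * real n / 2" "c * h * real n / 4 \<le> real d" "1 \<le> d"
          unfolding d_def by linarith+
        have p: "cH * \<epsilon> n \<le> H (\<epsilon> n)" "0 < cH * \<epsilon> n" using H elim(3,6) by auto
        have cells: "2 * d \<le> card {i \<in> {1..n}. x n i \<in> cell a h k}" if k: "(real k + 1) * h \<le> b - a" for k
        proof -
          have eq: "cell a h k = {a + real k * h..(a + real k * h) + \<delta> n / 4}"
            by (simp add: cell_def h_def algebra_simps)
          have "real (2 * d) \<le> c * (\<delta> n / 4) * real n" using d(1) by (simp add: h_def)
          also have "\<dots> \<le> real (card {i \<in> {1..n}. x n i \<in> cell a h k})"
          proof -
            have "real k * h + h \<le> b - a" using k by (simp only: distrib_right mult_1)
            moreover have "0 \<le> real k * h" using h by simp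
            ultimately have "a \<le> a + real k * h" "a + real k * h + \<delta> n / 4 \<le> b"
              unfolding h_def by linarith+
            then show ?thesis unfolding eq by (rule elim(4)[rule_format])
          qed
          finally show ?thesis by simp
        qed
        have Gam: "Gam ((2 * real d - 1) / real n) \<le> sqrt (2 + 2 * ln (16 / c / \<delta> n))"
        proof -
          have u: "c * \<delta> n / 16 \<le> (2 * real d - 1) / real n" "0 < c * \<delta> n / 16"
            using d n c elim(1) by (simp_all add: h_def field_simps)
          have quot: "exp 1 / ((2 * real d - 1) / real n) \<le> exp 1 / (c * \<delta> n / 16)"
            using less_le_trans[OF u(2,1)] by (intro divide_left_mono[OF u(1)] mult_pos_pos u(2)) auto
          have "ln (exp 1 / ((2 * real d - 1) / real n)) \<le> ln (exp 1 * (16 / c / \<delta> n))"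
          proof (rule ln_mono)
            have "0 < (2 * real d - 1) / real n" using u by linarith
            then show "0 < exp 1 / ((2 * real d - 1) / real n)" by (rule divide_pos_pos[OF exp_gt_zero])
            have "exp 1 / (c * \<delta> n / 16) = exp 1 * (16 / c / \<delta> n)" by simp
            then show "exp 1 / ((2 * real d - 1) / real n) \<le> exp 1 * (16 / c / \<delta> n)"
              using quot by (simp only:)
          qed
          also have "\<dots> = 1 + ln (16 / c / \<delta> n)" using c elim(1) by (subst ln_mult) auto
          finally show ?thesis unfolding Gam_def by simp
        qed
        show ?case
        proof (intro allI impI)
          fix z :: real assume z: "0 \<le> z"
            "z \<le> cH * sqrt (c / 16) * sqrt (real n * \<delta> n) * \<epsilon> n - B - sqrt (2 + 2 * ln (16 / c / \<delta> n))"
          have "cH * sqrt (c / 16) * sqrt (real n * \<delta> n) * \<epsilon> n = sqrt (c * h * real n / 4) * (cH * \<epsilon> n)"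
            by (simp add: h_def real_sqrt_mult[symmetric] mult_ac)
          also have "\<dots> \<le> sqrt (real d) * H (\<epsilon> n)"
            using d p by (intro mult_mono) auto
          finally have z': "z \<le> sqrt (real d) * H (\<epsilon> n) - kappa n \<alpha> - Gam ((2 * real d - 1) / real n)"
            using z Gam B[OF n] by linarith
          have "outer_measure_of (M n) {\<omega> \<in> space (M n).
              \<not> band_holds n \<alpha> (x n) (\<lambda>i. Y n i \<omega>) a b (\<delta> n) (E n + \<epsilon> n) \<phi>}
            \<le> ennreal (2 * ((b - a) / h) * exp (- z\<^sup>2 / 2))"
            by (rule band_failure_probability[OF Y_indep[OF n] x_sorted[OF n] f elim(2) h _ _ _ _ d(3) cells z(1) z'])
               (use elim p A2[OF n] in auto)
          then show "outer_measure_of (M n) {\<omega> \<in> space (M n).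
              \<not> band_holds n \<alpha> (x n) (\<lambda>i. Y n i \<omega>) a b (\<delta> n) (E n + \<epsilon> n) \<phi>}
            \<le> ennreal (8 * (b - a) / \<delta> n * exp (- z\<^sup>2 / 2))"
            by (simp add: h_def mult_ac)
        qed
      qed
    qed
  qed (use H c ab in auto)
qed

text \<open>An affine curve allows a constant bandwidth. The number of cells and the penalty are then bounded,
  and \<open>\<epsilon> = K n\<^sup>-\<^sup>1\<^sup>/\<^sup>2\<close> produces a signal proportional to \<open>K\<close>.\<close>
lemma affine_rates:
  assumes f: "\<And>u. u \<in> {a..b} \<Longrightarrow> f u = ereal (p + q * u)" and \<delta>: "0 < \<delta>" "4 * \<delta> \<le> b - a"
  shows "bounded_in_prob M (\<lambda>n \<omega>. SUP u\<in>{a..b}. max (f u - L_hat n \<alpha> (x n) (\<lambda>i. Y n i \<omega>) u) 0)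
      (\<lambda>n. real n powr (- 1 / 2))"
    and "a + \<delta> \<le> s \<Longrightarrow> s \<le> t \<Longrightarrow> t \<le> b - \<delta> \<Longrightarrow>
      bounded_in_prob M (\<lambda>n \<omega>. SUP u\<in>{s..t}. max (U_hat n \<alpha> (x n) (\<lambda>i. Y n i \<omega>) u - f u) 0)
        (\<lambda>n. real n powr (- 1 / 2))"
proof -
  let ?\<phi> = "\<lambda>u. p + q * u"
  obtain c1 c2 c3 B where c: "c1 > 0" "c2 > 0" "c3 > 0" and ctrl: "controls_band c1 c2 c3 B"
    by (rule controls_band_exists)
  have band: "\<exists>K>0. \<forall>\<^sub>F n in sequentially. outer_measure_of (M n) {\<omega> \<in> space (M n).
      \<not> band_holds n \<alpha> (x n) (\<lambda>i. Y n i \<omega>) a b \<delta> (K * real n powr (- 1 / 2)) ?\<phi>} \<le> ennreal \<eta>"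
    if \<eta>: "\<eta> > 0" for \<eta>
  proof -
    have "((\<lambda>z. c3 / \<delta> * exp (- z\<^sup>2 / 2)) \<longlongrightarrow> 0) at_top" by real_asymp
    then have "\<forall>\<^sub>F z in at_top. c3 / \<delta> * exp (- z\<^sup>2 / 2) < \<eta>" using \<eta> by (rule order_tendstoD)
    then obtain z0 where z0: "\<And>z. z0 \<le> z \<Longrightarrow> c3 / \<delta> * exp (- z\<^sup>2 / 2) < \<eta>"
      unfolding eventually_at_top_linorder by blast
    define z where "z = max 0 z0"
    have z: "0 \<le> z" "c3 / \<delta> * exp (- z\<^sup>2 / 2) < \<eta>"
      using z0[of z] by (auto simp: z_def)
    define K where "K = max 1 ((z + B + sqrt (2 + 2 * ln (c2 / \<delta>))) / (c1 * sqrt \<delta>))"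
    have K: "K > 0" by (simp add: K_def)
    have "(z + B + sqrt (2 + 2 * ln (c2 / \<delta>))) / (c1 * sqrt \<delta>) \<le> K" by (simp add: K_def)
    then have zK: "z \<le> c1 * sqrt \<delta> * K - B - sqrt (2 + 2 * ln (c2 / \<delta>))"
      using c \<delta> by (simp add: pos_divide_le_eq mult_ac)
    have lim: "(\<lambda>n. ereal (ln (\<delta> / 4) / ln (real n))) \<longlonglongrightarrow> ereal 0"
      by (intro tendsto_ereal) real_asymp
    have "\<forall>\<^sub>F n in sequentially. \<forall>z. 0 \<le> z \<longrightarrow>
        z \<le> c1 * sqrt (real n * \<delta>) * (K * real n powr (- 1 / 2)) - B - sqrt (2 + 2 * ln (c2 / \<delta>)) \<longrightarrow>
        outer_measure_of (M n) {\<omega> \<in> space (M n).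
          \<not> band_holds n \<alpha> (x n) (\<lambda>i. Y n i \<omega>) a b \<delta> (0 + K * real n powr (- 1 / 2)) ?\<phi>}
        \<le> ennreal (c3 / \<delta> * exp (- z\<^sup>2 / 2))"
    proof (rule controls_bandD[OF ctrl])
      show "- 1 < liminf (\<lambda>n. ereal (ln (\<delta> / 4) / ln (real n)))"
        using lim_imp_Liminf[OF _ lim] by (simp add: one_ereal_def)
      show "filterlim (\<lambda>n. real n * \<delta>) at_top sequentially" using \<delta> by real_asymp
      show "(\<lambda>n. K * real n powr (- 1 / 2)) \<longlonglongrightarrow> 0" by real_asymp
      show "\<forall>\<^sub>F n in sequentially. 0 < K * real n powr (- 1 / 2)"
        using eventually_gt_at_top[of 0] by eventually_elim (use K in simp)
    qed (use \<delta> f affine_up_to_zero in auto)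
    then have "\<forall>\<^sub>F n in sequentially. outer_measure_of (M n) {\<omega> \<in> space (M n).
      \<not> band_holds n \<alpha> (x n) (\<lambda>i. Y n i \<omega>) a b \<delta> (K * real n powr (- 1 / 2)) ?\<phi>} \<le> ennreal \<eta>"
      using eventually_gt_at_top[of 0]
    proof eventually_elim
      case (elim n)
      have "sqrt (real n) * real n powr (- 1 / 2) = 1"
        using elim(2) by (simp add: powr_half_sqrt[symmetric] flip: powr_add)
      moreover have "c1 * sqrt (real n * \<delta>) * (K * real n powr (- 1 / 2)) =
          c1 * sqrt \<delta> * K * (sqrt (real n) * real n powr (- 1 / 2))"
        unfolding real_sqrt_mult by (simp only: mult_ac)
      ultimately have signal: "c1 * sqrt (real n * \<delta>) * (K * real n powr (- 1 / 2)) = c1 * sqrt \<delta> * K"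
        by simp
      have "outer_measure_of (M n) {\<omega> \<in> space (M n).
          \<not> band_holds n \<alpha> (x n) (\<lambda>i. Y n i \<omega>) a b \<delta> (K * real n powr (- 1 / 2)) ?\<phi>}
        \<le> ennreal (c3 / \<delta> * exp (- z\<^sup>2 / 2))"
        by (rule elim(1)[rule_format, OF z(1), unfolded signal add_0_left, OF zK])
      also have "\<dots> \<le> ennreal \<eta>" using z(2) by (intro ennreal_leI) simp
      finally show ?case .
    qed
    then show ?thesis using K by blast
  qed
  show "bounded_in_prob M (\<lambda>n \<omega>. SUP u\<in>{a..b}. max (f u - L_hat n \<alpha> (x n) (\<lambda>i. Y n i \<omega>) u) 0)
      (\<lambda>n. real n powr (- 1 / 2))"
  proof (rule bounded_in_probI)
    fix \<eta> :: real assume "\<eta> > 0"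
    from band[OF this] obtain K where K: "K > 0" and ev: "\<forall>\<^sub>F n in sequentially. outer_measure_of (M n) {\<omega> \<in> space (M n).
      \<not> band_holds n \<alpha> (x n) (\<lambda>i. Y n i \<omega>) a b \<delta> (K * real n powr (- 1 / 2)) ?\<phi>} \<le> ennreal \<eta>" by blast
    have "\<bar>SUP u\<in>{a..b}. max (f u - L_hat n \<alpha> (x n) (\<lambda>i. Y n i \<omega>) u) 0\<bar> \<le> ereal (3 * K * real n powr (- 1 / 2))"
      if "band_holds n \<alpha> (x n) (\<lambda>i. Y n i \<omega>) a b \<delta> (K * real n powr (- 1 / 2)) ?\<phi>" for n \<omega>
      using band_holds_lower[OF that f ab] K by (simp add: mult.assoc)
    then show "\<exists>K G. \<forall>\<^sub>F n in sequentially. outer_measure_of (M n) {\<omega> \<in> space (M n). \<not> G n \<omega>} \<le> ennreal \<eta> \<and>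
      (\<forall>\<omega>. G n \<omega> \<longrightarrow> \<bar>SUP u\<in>{a..b}. max (f u - L_hat n \<alpha> (x n) (\<lambda>i. Y n i \<omega>) u) 0\<bar>
        \<le> ereal (K * real n powr (- 1 / 2)))"
      using ev by (intro exI[of _ "3 * K"]
        exI[of _ "\<lambda>n \<omega>. band_holds n \<alpha> (x n) (\<lambda>i. Y n i \<omega>) a b \<delta> (K * real n powr (- 1 / 2)) ?\<phi>"]) simp
  qed
  show "bounded_in_prob M (\<lambda>n \<omega>. SUP u\<in>{s..t}. max (U_hat n \<alpha> (x n) (\<lambda>i. Y n i \<omega>) u - f u) 0)
      (\<lambda>n. real n powr (- 1 / 2))" if st: "a + \<delta> \<le> s" "s \<le> t" "t \<le> b - \<delta>"
  proof (rule bounded_in_probI)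
    fix \<eta> :: real assume "\<eta> > 0"
    from band[OF this] obtain K where K: "K > 0" and ev: "\<forall>\<^sub>F n in sequentially. outer_measure_of (M n) {\<omega> \<in> space (M n).
      \<not> band_holds n \<alpha> (x n) (\<lambda>i. Y n i \<omega>) a b \<delta> (K * real n powr (- 1 / 2)) ?\<phi>} \<le> ennreal \<eta>" by blast
    have "\<bar>SUP u\<in>{s..t}. max (U_hat n \<alpha> (x n) (\<lambda>i. Y n i \<omega>) u - f u) 0\<bar> \<le> ereal (K * real n powr (- 1 / 2))"
      if "band_holds n \<alpha> (x n) (\<lambda>i. Y n i \<omega>) a b \<delta> (K * real n powr (- 1 / 2)) ?\<phi>" for n \<omega>
      by (rule band_holds_upper[OF that f st]) (use K \<delta> in auto)
    then show "\<exists>K G. \<forall>\<^sub>F n in sequentially. outer_measure_of (M n) {\<omega> \<in> space (M n). \<not> G n \<omega>} \<le> ennreal \<eta> \<and>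
      (\<forall>\<omega>. G n \<omega> \<longrightarrow> \<bar>SUP u\<in>{s..t}. max (U_hat n \<alpha> (x n) (\<lambda>i. Y n i \<omega>) u - f u) 0\<bar>
        \<le> ereal (K * real n powr (- 1 / 2)))"
      using ev by (intro exI[of _ K]
        exI[of _ "\<lambda>n \<omega>. band_holds n \<alpha> (x n) (\<lambda>i. Y n i \<omega>) a b \<delta> (K * real n powr (- 1 / 2)) ?\<phi>"]) simp
  qed
qed

text \<open>The bandwidth \<open>\<delta>\<close> with \<open>\<delta>\<^sup>2\<^sup>\<beta>\<^sup>+\<^sup>1 = \<rho>\<close> balances the approximation error \<open>L \<delta>\<^sup>\<beta>\<close> against the noise: for
  \<open>\<epsilon> = K \<delta>\<^sup>\<beta>\<close> the signal is \<open>c1 K sqrt (log (n + 1))\<close>. This dominates the penalty and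
  the logarithm of the number of cells, which is at most of order \<open>n\<close>.\<close>
lemma hoelder_rates:
  assumes \<beta>: "1 < \<beta>" and smooth: "smooth_hoelder_on \<beta> a b f"
  shows "bounded_in_prob M (\<lambda>n \<omega>. SUP u\<in>{a..b}. max (f u - L_hat n \<alpha> (x n) (\<lambda>i. Y n i \<omega>) u) 0)
      (\<lambda>n. rho n powr (\<beta> / (2 * \<beta> + 1)))"
    and "bounded_in_prob M (\<lambda>n \<omega>. SUP u\<in>{a + rho n powr (1 / (2 * \<beta> + 1))..b - rho n powr (1 / (2 * \<beta> + 1))}.
          max (U_hat n \<alpha> (x n) (\<lambda>i. Y n i \<omega>) u - f u) 0)
      (\<lambda>n. rho n powr (\<beta> / (2 * \<beta> + 1)))"
proof -
  define \<phi> where "\<phi> u = real_of_ereal (f u)" for u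
  have f: "f u = ereal (\<phi> u)" if "u \<in> {a..b}" for u
    using smooth that by (simp add: smooth_hoelder_on_def \<phi>_def ereal_real)
  obtain f' L where der: "\<And>u. u \<in> {a..b} \<Longrightarrow> (\<phi> has_real_derivative f' u) (at u within {a..b})"
    and L: "L > 0" and hoel: "\<And>u v. u \<in> {a..b} \<Longrightarrow> v \<in> {a..b} \<Longrightarrow> \<bar>f' u - f' v\<bar> \<le> L * \<bar>u - v\<bar> powr (\<beta> - 1)"
    using smooth unfolding smooth_hoelder_on_def \<phi>_def[abs_def] by blast
  define \<theta> where "\<theta> = 1 / (2 * \<beta> + 1)"
  have \<theta>: "0 < \<theta>" "\<theta> < 1" using \<beta> by (auto simp: \<theta>_def)
  define \<delta> where "\<delta> n = rho n powr \<theta>" for n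
  define r where "r n = rho n powr (\<beta> * \<theta>)" for n
  have r: "r n = \<delta> n powr \<beta>" for n by (simp add: r_def \<delta>_def powr_powr mult.commute)
  obtain c1 c2 c3 B where c: "c1 > 0" "c2 > 0" "c3 > 0" and ctrl: "controls_band c1 c2 c3 B"
    by (rule controls_band_exists)
  (* The signal 5 sqrt (log (n + 1)) leaves z = 2 sqrt (log (n + 1)) after the critical value and the
     penalty have taken 3 sqrt (log (n + 1)); then exp (- z^2 / 2) = (n + 1)^-2. *)
  define K where "K = 5 / c1"
  have K: "K > 0" "c1 * K = 5" using c by (auto simp: K_def)
  have rho1: "\<forall>\<^sub>F n in sequentially. 1 \<le> ln (real n + 1)" by real_asymp
  have rho2: "\<forall>\<^sub>F n in sequentially. rho n \<le> 1" unfolding rho_def by real_asymp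
  have \<delta>0: "\<delta> \<longlonglongrightarrow> 0" unfolding \<delta>_def[abs_def] rho_def using \<theta> by real_asymp
  have "(b - a) / 4 > 0" using ab by simp
  from order_tendstoD(2)[OF \<delta>0 this]
  have \<delta>small: "\<forall>\<^sub>F n in sequentially. 4 * \<delta> n \<le> b - a" by eventually_elim simp
  have \<delta>pos: "\<forall>\<^sub>F n in sequentially. 0 < \<delta> n"
    using rho1 eventually_gt_at_top[of 0] by eventually_elim (simp add: \<delta>_def rho_def)
  have \<delta>ge: "\<forall>\<^sub>F n in sequentially. 1 / real n \<le> \<delta> n"
    using rho1 rho2 eventually_gt_at_top[of 0]
  proof eventually_elim
    case (elim n)
    have "1 / real n \<le> rho n" unfolding rho_def using elim by (intro divide_right_mono) auto
    also have "\<dots> = rho n powr 1" using elim by (simp add: rho_def)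
    also have "\<dots> \<le> rho n powr \<theta>" using elim \<theta> by (intro powr_mono') (auto simp: rho_def)
    finally show ?case by (simp add: \<delta>_def)
  qed
  have lim: "(\<lambda>n. ereal (ln (\<delta> n / 4) / ln (real n))) \<longlonglongrightarrow> ereal (- \<theta>)"
    unfolding \<delta>_def rho_def using \<theta> by (intro tendsto_ereal) real_asymp
  have key: "\<forall>\<^sub>F n in sequentially. \<forall>z. 0 \<le> z \<longrightarrow>
        z \<le> c1 * sqrt (real n * \<delta> n) * (K * r n) - B - sqrt (2 + 2 * ln (c2 / \<delta> n)) \<longrightarrow>
        outer_measure_of (M n) {\<omega> \<in> space (M n).
          \<not> band_holds n \<alpha> (x n) (\<lambda>i. Y n i \<omega>) a b (\<delta> n) (L * r n + K * r n) \<phi>}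
        \<le> ennreal (c3 / \<delta> n * exp (- z\<^sup>2 / 2))"
  proof (rule controls_bandD[OF ctrl f])
    show "\<forall>\<^sub>F n in sequentially. 0 < \<delta> n \<and> 4 * \<delta> n \<le> b - a"
      using \<delta>pos \<delta>small by (rule eventually_conj)
    show "- 1 < liminf (\<lambda>n. ereal (ln (\<delta> n / 4) / ln (real n)))"
      using lim_imp_Liminf[OF _ lim] \<theta> by (simp add: one_ereal_def)
    show "filterlim (\<lambda>n. real n * \<delta> n) at_top sequentially"
      unfolding \<delta>_def rho_def using \<theta> by real_asymp
    show "\<forall>\<^sub>F n in sequentially. affine_up_to a b (\<delta> n) (L * r n) \<phi>"
      using \<delta>pos by eventually_elim (unfold r, rule affine_up_to_hoelder[OF der hoel L \<beta>])
    show "\<forall>\<^sub>F n in sequentially. 0 < K * r n"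
      using \<delta>pos by eventually_elim (use K in \<open>simp add: r\<close>)
    have "0 < \<beta> * \<theta>" using \<beta> \<theta> by simp
    then show "(\<lambda>n. K * r n) \<longlonglongrightarrow> 0" unfolding r_def rho_def by real_asymp
  qed
  have log_dominates: "\<forall>\<^sub>F n in sequentially. B + sqrt (2 + 2 * (ln c2 + ln (real n))) \<le> 3 * sqrt (ln (real n + 1))"
  proof -
    have "filterlim (\<lambda>n. sqrt (ln (real n + 1))) at_top sequentially"
      and "filterlim (\<lambda>n. ln (real n + 1)) at_top sequentially"
      by real_asymp+
    then have "\<forall>\<^sub>F n in sequentially. B \<le> sqrt (ln (real n + 1))"
      and "\<forall>\<^sub>F n in sequentially. 1 + ln c2 \<le> ln (real n + 1)"
      unfolding filterlim_at_top by blast+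
    then show ?thesis using eventually_gt_at_top[of 0]
    proof eventually_elim
      case (elim n)
      have "ln (real n) \<le> ln (real n + 1)" using elim(3) by simp
      then have "2 + 2 * (ln c2 + ln (real n)) \<le> 2\<^sup>2 * ln (real n + 1)" using elim(2) by simp
      then have "sqrt (2 + 2 * (ln c2 + ln (real n))) \<le> sqrt (2\<^sup>2 * ln (real n + 1))" by (rule real_sqrt_le_mono)
      then show ?case using elim(1) by (simp add: real_sqrt_mult)
    qed
  qed
  have band: "\<forall>\<^sub>F n in sequentially. outer_measure_of (M n) {\<omega> \<in> space (M n).
      \<not> band_holds n \<alpha> (x n) (\<lambda>i. Y n i \<omega>) a b (\<delta> n) ((L + K) * r n) \<phi>} \<le> ennreal \<eta>"
    if \<eta>: "\<eta> > 0" for \<eta>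
  proof -
    have "(\<lambda>n. c3 * real n / (real n + 1)\<^sup>2) \<longlonglongrightarrow> 0" by real_asymp
    from order_tendstoD(2)[OF this \<eta>] key rho1 \<delta>pos \<delta>ge log_dominates eventually_gt_at_top[of 0]
    show ?thesis
    proof eventually_elim
      case (elim n)
      note n = elim(7) and \<delta>n = elim(4)
      define z where "z = 2 * sqrt (ln (real n + 1))"
      have z0: "0 \<le> z" using elim(3) by (simp add: z_def)
      have rho0: "rho n > 0" using n by (simp add: rho_def)
      have "\<delta> n * (r n)\<^sup>2 = rho n powr (\<theta> + 2 * (\<beta> * \<theta>))"
        using rho0 by (simp add: \<delta>_def r_def powr_add powr_power mult_ac)
      also have "\<theta> + 2 * (\<beta> * \<theta>) = 1" using \<beta> by (simp add: \<theta>_def field_simps)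
      finally have "\<delta> n * (r n)\<^sup>2 = rho n" using rho0 by simp
      moreover have "sqrt (real n * \<delta> n) * r n = sqrt (real n * (\<delta> n * (r n)\<^sup>2))"
        by (simp add: real_sqrt_mult r_def)
      ultimately have "sqrt (real n * \<delta> n) * r n = sqrt (real n * rho n)" by (simp only:)
      then have sig: "sqrt (real n * \<delta> n) * r n = sqrt (ln (real n + 1))" using n by (simp add: rho_def)
      have "c1 * sqrt (real n * \<delta> n) * (K * r n) = (c1 * K) * (sqrt (real n * \<delta> n) * r n)" by (simp add: mult_ac)
      then have signal: "c1 * sqrt (real n * \<delta> n) * (K * r n) = 5 * sqrt (ln (real n + 1))"
        unfolding sig K(2) .
      have inv: "1 / \<delta> n \<le> real n" using elim(5) n \<delta>n by (simp add: field_simps)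
      have "ln (c2 / \<delta> n) \<le> ln (c2 * real n)"
        using inv c \<delta>n mult_left_mono[OF inv, of c2] by (intro ln_mono) auto
      also have "\<dots> = ln c2 + ln (real n)" using c n by (simp add: ln_mult)
      finally have "sqrt (2 + 2 * ln (c2 / \<delta> n)) \<le> sqrt (2 + 2 * (ln c2 + ln (real n)))" by simp
      then have zle: "z \<le> c1 * sqrt (real n * \<delta> n) * (K * r n) - B - sqrt (2 + 2 * ln (c2 / \<delta> n))"
        unfolding signal z_def using elim(6) by linarith
      have "z\<^sup>2 = 4 * ln (real n + 1)" using elim(3) by (simp add: z_def power_mult_distrib)
      then have "exp (- z\<^sup>2 / 2) = exp (- ln (real n + 1)) * exp (- ln (real n + 1))"
        by (simp flip: exp_add)
      also have "\<dots> = 1 / (real n + 1)\<^sup>2"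
        by (simp add: exp_minus power2_eq_square divide_inverse)
      finally have ez: "exp (- z\<^sup>2 / 2) = 1 / (real n + 1)\<^sup>2" .
      have "outer_measure_of (M n) {\<omega> \<in> space (M n).
          \<not> band_holds n \<alpha> (x n) (\<lambda>i. Y n i \<omega>) a b (\<delta> n) ((L + K) * r n) \<phi>}
        \<le> ennreal (c3 / \<delta> n * exp (- z\<^sup>2 / 2))"
        using elim(2)[rule_format, OF z0 zle] by (simp only: distrib_right)
      also have "\<dots> \<le> ennreal \<eta>"
      proof (rule ennreal_leI)
        have "c3 / \<delta> n * exp (- z\<^sup>2 / 2) = c3 * (1 / \<delta> n) * (1 / (real n + 1)\<^sup>2)" unfolding ez by simp
        also have "\<dots> \<le> c3 * real n * (1 / (real n + 1)\<^sup>2)"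
          using inv c by (intro mult_right_mono mult_left_mono) auto
        also have "\<dots> \<le> \<eta>" using elim(1) by simp
        finally show "c3 / \<delta> n * exp (- z\<^sup>2 / 2) \<le> \<eta>" .
      qed
      finally show ?case .
    qed
  qed
  have r_eq: "rho n powr (\<beta> / (2 * \<beta> + 1)) = r n" for n by (simp add: r_def \<theta>_def)
  have \<delta>_eq: "rho n powr (1 / (2 * \<beta> + 1)) = \<delta> n" for n by (simp add: \<delta>_def \<theta>_def)
  have r0: "0 \<le> (L + K) * r n" for n using L K by (simp add: r_def)
  let ?G = "\<lambda>n \<omega>. band_holds n \<alpha> (x n) (\<lambda>i. Y n i \<omega>) a b (\<delta> n) ((L + K) * r n) \<phi>"
  show "bounded_in_prob M (\<lambda>n \<omega>. SUP u\<in>{a..b}. max (f u - L_hat n \<alpha> (x n) (\<lambda>i. Y n i \<omega>) u) 0)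
      (\<lambda>n. rho n powr (\<beta> / (2 * \<beta> + 1)))"
    unfolding r_eq
  proof (rule bounded_in_probI)
    fix \<eta> :: real assume "\<eta> > 0"
    have "\<bar>SUP u\<in>{a..b}. max (f u - L_hat n \<alpha> (x n) (\<lambda>i. Y n i \<omega>) u) 0\<bar> \<le> ereal (3 * (L + K) * r n)"
      if "?G n \<omega>" for n \<omega>
      using band_holds_lower[OF that f ab r0] by (simp only: mult.assoc)
    then show "\<exists>K G. \<forall>\<^sub>F n in sequentially. outer_measure_of (M n) {\<omega> \<in> space (M n). \<not> G n \<omega>} \<le> ennreal \<eta> \<and>
      (\<forall>\<omega>. G n \<omega> \<longrightarrow> \<bar>SUP u\<in>{a..b}. max (f u - L_hat n \<alpha> (x n) (\<lambda>i. Y n i \<omega>) u) 0\<bar> \<le> ereal (K * r n))"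
      using band[OF \<open>\<eta> > 0\<close>] by (intro exI[of _ "3 * (L + K)"] exI[of _ ?G]) simp
  qed
  show "bounded_in_prob M (\<lambda>n \<omega>. SUP u\<in>{a + rho n powr (1 / (2 * \<beta> + 1))..b - rho n powr (1 / (2 * \<beta> + 1))}.
          max (U_hat n \<alpha> (x n) (\<lambda>i. Y n i \<omega>) u - f u) 0)
      (\<lambda>n. rho n powr (\<beta> / (2 * \<beta> + 1)))"
    unfolding r_eq \<delta>_eq
  proof (rule bounded_in_probI)
    fix \<eta> :: real assume "\<eta> > 0"
    have "\<forall>\<^sub>F n in sequentially. outer_measure_of (M n) {\<omega> \<in> space (M n). \<not> ?G n \<omega>} \<le> ennreal \<eta> \<and>
      (\<forall>\<omega>. ?G n \<omega> \<longrightarrow> \<bar>SUP u\<in>{a + \<delta> n..b - \<delta> n}. max (U_hat n \<alpha> (x n) (\<lambda>i. Y n i \<omega>) u - f u) 0\<bar>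
        \<le> ereal ((L + K) * r n))"
      using band[OF \<open>\<eta> > 0\<close>] \<delta>pos \<delta>small
    proof eventually_elim
      case (elim n)
      have "\<bar>SUP u\<in>{a + \<delta> n..b - \<delta> n}. max (U_hat n \<alpha> (x n) (\<lambda>i. Y n i \<omega>) u - f u) 0\<bar>
          \<le> ereal ((L + K) * r n)" if "?G n \<omega>" for \<omega>
        by (rule band_holds_upper[OF that f]) (use elim r0 in auto)
      then show ?case using elim(1) by blast
    qed
    then show "\<exists>K G. \<forall>\<^sub>F n in sequentially. outer_measure_of (M n) {\<omega> \<in> space (M n). \<not> G n \<omega>} \<le> ennreal \<eta> \<and>
      (\<forall>\<omega>. G n \<omega> \<longrightarrow> \<bar>SUP u\<in>{a + \<delta> n..b - \<delta> n}. max (U_hat n \<alpha> (x n) (\<lambda>i. Y n i \<omega>) u - f u) 0\<bar>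
        \<le> ereal (K * r n))"
      by (intro exI[of _ "L + K"] exI[of _ ?G])
  qed
qed

end

theorem theorem1:
  fixes f :: "real \<Rightarrow> ereal" and \<alpha> a b :: real
    and M :: "nat \<Rightarrow> 'w measure"
    and x :: "nat \<Rightarrow> nat \<Rightarrow> real" and Y :: "nat \<Rightarrow> nat \<Rightarrow> 'w \<Rightarrow> real"
    and H :: "real \<Rightarrow> real"
  assumes f_convex: "convex_fun f"
    and \<alpha>: "0 < \<alpha>" "\<alpha> < 1"
    and x_sorted: "\<And>n. n \<ge> 1 \<Longrightarrow> mono_on {1..n} (x n)"
    and M_prob: "\<And>n. n \<ge> 1 \<Longrightarrow> prob_space (M n)"
    and Y_indep: "\<And>n. n \<ge> 1 \<Longrightarrow> prob_space.indep_vars (M n) (\<lambda>_. borel) (Y n) {1..n}"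
    and Y_median: "\<And>n i. n \<ge> 1 \<Longrightarrow> i \<in> {1..n} \<Longrightarrow> is_median (M n) (Y n i) (f (x n i))"
    and ab: "a < b"
    and A1: "\<exists>c::real. c > 0 \<and>
      (\<forall>s t :: nat \<Rightarrow> real.
        (\<forall>n\<ge>1. a \<le> s n \<and> s n < t n \<and> t n \<le> b) \<longrightarrow>
        liminf (\<lambda>n. ereal (ln (t n - s n) / ln (real n))) > - 1 \<longrightarrow>
        liminf (\<lambda>n. ereal (design_mass n (x n) {s n..t n} / (t n - s n))) \<ge> ereal c)"
    and A2_H: "\<exists>l::ereal. l > 0 \<and> ((\<lambda>r. ereal (H r / r)) \<longlongrightarrow> l) (at_right 0)"
    and A2: "\<And>n i r. n \<ge> 1 \<Longrightarrow> i \<in> {1..n} \<Longrightarrow> x n i \<in> {a..b} \<Longrightarrow> r > 0 \<Longrightarrow>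
      measure (M n) {\<omega> \<in> space (M n). ereal (Y n i \<omega>) < f (x n i) + ereal r} \<ge> (1 + H r) / 2 \<and>
      measure (M n) {\<omega> \<in> space (M n). ereal (Y n i \<omega>) > f (x n i) - ereal r} \<ge> (1 + H r) / 2"
  shows
    "(affine_on a b f \<longrightarrow>
       bounded_in_prob M
         (\<lambda>n \<omega>. SUP u\<in>{a..b}. max (f u - L_hat n \<alpha> (x n) (\<lambda>i. Y n i \<omega>) u) 0)
         (\<lambda>n. real n powr (- 1 / 2)) \<and>
       (\<forall>a' b'. a < a' \<and> a' < b' \<and> b' < b \<longrightarrow>
         bounded_in_prob M
           (\<lambda>n \<omega>. SUP u\<in>{a'..b'}. max (U_hat n \<alpha> (x n) (\<lambda>i. Y n i \<omega>) u - f u) 0)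
           (\<lambda>n. real n powr (- 1 / 2)))) \<and>
     (\<forall>\<beta>. 1 < \<beta> \<and> \<beta> \<le> 2 \<and> smooth_hoelder_on \<beta> a b f \<longrightarrow>
       bounded_in_prob M
         (\<lambda>n \<omega>. SUP u\<in>{a..b}. max (f u - L_hat n \<alpha> (x n) (\<lambda>i. Y n i \<omega>) u) 0)
         (\<lambda>n. rho n powr (\<beta> / (2 * \<beta> + 1))) \<and>
       bounded_in_prob M
         (\<lambda>n \<omega>. SUP u\<in>{a + rho n powr (1 / (2 * \<beta> + 1))..b - rho n powr (1 / (2 * \<beta> + 1))}.
            max (U_hat n \<alpha> (x n) (\<lambda>i. Y n i \<omega>) u - f u) 0)
         (\<lambda>n. rho n powr (\<beta> / (2 * \<beta> + 1))))"
proof -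
  interpret median_design f \<alpha> a b M x Y H
    by (rule median_design.intro; fact)
  show ?thesis
  proof (intro conjI impI allI)
    assume "affine_on a b f"
    then obtain p q where f: "\<And>u. u \<in> {a..b} \<Longrightarrow> f u = ereal (p + q * u)"
      unfolding affine_on_def by blast
    show "bounded_in_prob M
         (\<lambda>n \<omega>. SUP u\<in>{a..b}. max (f u - L_hat n \<alpha> (x n) (\<lambda>i. Y n i \<omega>) u) 0)
         (\<lambda>n. real n powr (- 1 / 2))"
      using affine_rates(1)[OF f, of "(b - a) / 4"] ab by simp
    fix a' b' assume "a < a' \<and> a' < b' \<and> b' < b"
    then have ab': "a < a'" "a' < b'" "b' < b" by auto
    define \<delta> where "\<delta> = min ((b - a) / 4) (min (a' - a) (b - b'))"
    have "\<delta> \<le> (b - a) / 4" "\<delta> \<le> a' - a" "\<delta> \<le> b - b'" unfolding \<delta>_def by linarith+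
    moreover have "0 < \<delta>" using ab ab' by (simp add: \<delta>_def)
    ultimately have \<delta>: "0 < \<delta>" "4 * \<delta> \<le> b - a" "a + \<delta> \<le> a'" "a' \<le> b'" "b' \<le> b - \<delta>"
      using ab' by auto
    show "bounded_in_prob M
           (\<lambda>n \<omega>. SUP u\<in>{a'..b'}. max (U_hat n \<alpha> (x n) (\<lambda>i. Y n i \<omega>) u - f u) 0)
           (\<lambda>n. real n powr (- 1 / 2))"
      by (rule affine_rates(2)[OF f \<delta>])
  qed (use hoelder_rates in blast)+
qed

end
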